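(* Let $m\ge 3$ and let $\mathcal{A}$ be an $m$-homogeneous supersolvable line arrangement in the complex projective plane $\mathbb{P}^2$ having $M\ge 2$ modular points. Then there is a unique integer $k$ with $0\le k\le m-2$ and a unique equivalence class $[w]\in\overline{W(m-2,k)}$ such that the associated central plane arrangements $\widetilde{\mathcal{A}}$ and $\widetilde{\mathcal{A}(w)}$ in $\mathbb{C}^3$ are lattice-isotopic. In particular, the intersection lattices $L(\widetilde{\mathcal{A}})$ and $L(\widetilde{\mathcal{A}(w)})$ are isomorphic. The number $M$ of modular points of $\mathcal{A}$ is given by: (1) $M=2$ if $k<m-2$; (2) $M=3$ if $k=m-2\ge 2$; (3) $M=4$ if $k=m-2=1$. Moreover, when $k=m-2$, $\mathcal{A}$ is projectively equivalent to the full monomial arrangement $\mathcal{A}(m-2,1,3)$.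
   Context: A line arrangement in $\mathbb{P}^2$ is a finite set of distinct lines. An intersection point is a point lying on at least two lines of the arrangement; its multiplicity is the number of lines through it. An intersection point $p$ is modular if for every other intersection point $q$ the line $\overline{pq}$ belongs to the arrangement. The arrangement is supersolvable if it has a modular point, and it is $m$-homogeneous supersolvable if it is supersolvable and all its modular points have the same multiplicity $m$. For a line arrangement $\mathcal{A}: f=0$ in $\mathbb{P}^2$, $\widetilde{\mathcal{A}}: f=0$ denotes the associated central plane arrangement in $\mathbb{C}^3$, and $L(\widetilde{\mathcal{A}})$ its intersection lattice. Full monomial arrangement: for $n\ge 1$, $\mathcal{A}(n,1,3): xyz(x^n-y^n)(y^n-z^n)(x^n-z^n)=0$. The sets $\overline{W(n,k)}$ and the arrangements $\mathcal{A}(w)$: let $n\ge 1$ and let $\mu_n$ be the group of $n$-th roots of unity in $\mathbb{C}$. For $1\le k\le n$ let $W(n,k)$ be the set of $k$-tuples $w=(w_1,\dots,w_k)\in\mu_n^k$ with pairwise distinct entries, and let $\mathcal{A}(w)$ be the line arrangement $$\mathcal{A}(w):\ xyz(x^n-y^n)(x^n-z^n)\prod_{j=1}^k(z-w_jy)=0 .$$ The following operations act on $W(n,k)$: permutations of the entries by the symmetric group $\Sigma_k$; translations $w\mapsto aw=(aw_1,\dots,aw_k)$ with $a\in\mu_n$; and the inversion $w\mapsto(w_1^{-1},\dots,w_k^{-1})$. Together they generate an action of the semidirect product $G=(\Sigma_k\times\mu_n)\rtimes\mu_2$, where $-1\in\mu_2$ acts on $\Sigma_k\times\mu_n$ by $(\sigma,a)\mapsto(\sigma,a^{-1})$.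 Put $\overline{W(n,k)}=W(n,k)/G$, with $[w]$ the class of $w$; the arrangement $\mathcal{A}(w)$ depends only on $[w]$ up to projective equivalence. For $k=0$, $W(n,0)=\overline{W(n,0)}=\{w_0\}$ is a singleton and $\mathcal{A}(w_0): xyz(x^n-y^n)(x^n-z^n)=0$. Lattice-isotopic: two central plane arrangements in $\mathbb{C}^3$ are lattice-isotopic if they can be joined by a smooth one-parameter family of central plane arrangements $\mathcal{B}_t=\{\ker\alpha_1(t),\dots,\ker\alpha_d(t)\}$, $t\in[0,1]$, with the linear forms $\alpha_i(t)$ depending smoothly on $t$ and with constant intersection lattice (that is, the planes are distinct for each $t$, and for each subset $I\subseteq\{1,\dots,d\}$ the rank of $\{\alpha_i(t)\}_{i\in I}$ is independent of $t$). *)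

theory Defs
  imports "HOL-Analysis.Analysis"
begin

text \<open>
  A point of the complex projective plane is a one-dimensional linear subspace of \<open>\<complex>\<^sup>3\<close>, and a line
  is identified with the two-dimensional subspace spanned by its points, so that incidence is
  inclusion.  Under this identification a line arrangement and its associated central plane
  arrangement in \<open>\<complex>\<^sup>3\<close> are the same set of subspaces.
\<close>

definition proj_point :: "(complex^3) set \<Rightarrow> bool" where
  "proj_point p \<longleftrightarrow> vec.subspace p \<and> vec.dim p = 1"

definition proj_line :: "(complex^3) set \<Rightarrow> bool" where
  "proj_line l \<longleftrightarrow> vec.subspace l \<and> vec.dim l = 2"

definition line_arrangement :: "(complex^3) set set \<Rightarrow> bool" where
  "line_arrangement A \<longleftrightarrow> finite A \<and> (\<forall>l\<in>A. proj_line l)"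

definition multiplicity_at :: "(complex^3) set set \<Rightarrow> (complex^3) set \<Rightarrow> nat" where
  "multiplicity_at A p = card {l \<in> A. p \<subseteq> l}"

definition intersection_points :: "(complex^3) set set \<Rightarrow> (complex^3) set set" where
  "intersection_points A = {p. proj_point p \<and> 2 \<le> multiplicity_at A p}"

definition modular_points :: "(complex^3) set set \<Rightarrow> (complex^3) set set" where
  "modular_points A =
     {p \<in> intersection_points A. \<forall>q \<in> intersection_points A. q \<noteq> p \<longrightarrow> vec.span (p \<union> q) \<in> A}"

definition supersolvable :: "(complex^3) set set \<Rightarrow> bool" where
  "supersolvable A \<longleftrightarrow> modular_points A \<noteq> {}"

definition homogeneous_supersolvable :: "nat \<Rightarrow> (complex^3) set set \<Rightarrow> bool" where
  "homogeneous_supersolvable m A \<longleftrightarrow>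
     supersolvable A \<and> (\<forall>p \<in> modular_points A. multiplicity_at A p = m)"

text \<open>
  The arrangement \<open>f = 0\<close>, where \<open>f\<close> is a product of linear forms: the lines contained in the zero
  locus of \<open>f\<close>.
\<close>

definition arrangement_of :: "(complex^3 \<Rightarrow> complex) \<Rightarrow> (complex^3) set set" where
  "arrangement_of f = {l. proj_line l \<and> (\<forall>v\<in>l. f v = 0)}"

definition full_monomial :: "nat \<Rightarrow> (complex^3) set set" where
  "full_monomial n = arrangement_of (\<lambda>v. let x = v$1; y = v$2; z = v$3 in
     x * y * z * (x^n - y^n) * (y^n - z^n) * (x^n - z^n))"

definition tuple_arrangement :: "nat \<Rightarrow> complex list \<Rightarrow> (complex^3) set set" where
  "tuple_arrangement n w = arrangement_of (\<lambda>v. let x = v$1; y = v$2; z = v$3 in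
     x * y * z * (x^n - y^n) * (x^n - z^n) * (\<Prod>j<length w. z - w!j * y))"

definition mu :: "nat \<Rightarrow> complex set" where
  "mu n = {a. a^n = 1}"

definition W :: "nat \<Rightarrow> nat \<Rightarrow> complex list set" where
  "W n k = {w. length w = k \<and> set w \<subseteq> mu n \<and> distinct w}"

text \<open>
  The action of the element \<open>(\<sigma>, a, e)\<close> of \<open>G = (\<Sigma>\<^sub>k \<times> \<mu>\<^sub>n) \<rtimes> \<mu>\<^sub>2\<close>; the two elements of \<open>\<mu>\<^sub>2\<close> are
  the integers \<open>1\<close> and \<open>-1\<close>.
\<close>

definition G_act :: "(nat \<Rightarrow> nat) \<Rightarrow> complex \<Rightarrow> int \<Rightarrow> complex list \<Rightarrow> complex list" where
  "G_act \<sigma> a e w = map (\<lambda>j. a * (w ! \<sigma> j) powi e) [0..<length w]"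

definition G_orbit_rel :: "nat \<Rightarrow> nat \<Rightarrow> (complex list \<times> complex list) set" where
  "G_orbit_rel n k = {(w, w'). w \<in> W n k \<and> w' \<in> W n k \<and>
     (\<exists>\<sigma> a e. \<sigma> permutes {..<k} \<and> a \<in> mu n \<and> e \<in> {1, -1} \<and> w' = G_act \<sigma> a e w)}"

lemma equiv_G_orbit_rel:
  assumes "n \<ge> 1"
  shows "equiv (W n k) (G_orbit_rel n k)"
proof (rule equivI)
  have pw: "b powi e \<in> mu n" if "b \<in> mu n" "e \<in> {1, -1}" for b and e :: int
    using that by (auto simp: mu_def power_int_minus power_inverse)
  have ml: "b * c \<in> mu n" if "b \<in> mu n" "c \<in> mu n" for b c
    using that by (auto simp: mu_def power_mult_distrib)
  have nz: "b \<noteq> 0" if "b \<in> mu n" for b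
    using that assms by (auto simp: mu_def power_0_left)
  show "G_orbit_rel n k \<subseteq> W n k \<times> W n k"
    by (auto simp: G_orbit_rel_def)
  show "refl_on (W n k) (G_orbit_rel n k)"
  proof (rule refl_onI)
    fix w assume w: "w \<in> W n k"
    have "id permutes {..<k}" "1 \<in> mu n" "(1::int) \<in> {1, -1}" "w = G_act id 1 1 w"
      by (auto simp: mu_def G_act_def map_nth permutes_id)
    with w show "(w, w) \<in> G_orbit_rel n k"
      unfolding G_orbit_rel_def by blast
  qed
  show "sym (G_orbit_rel n k)"
  proof (rule symI)
    fix w w' assume "(w, w') \<in> G_orbit_rel n k"
    then obtain \<sigma> a e where *: "w \<in> W n k" "w' \<in> W n k" "\<sigma> permutes {..<k}" "a \<in> mu n"
      "e \<in> {1, -1}" "w' = G_act \<sigma> a e w"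
      unfolding G_orbit_rel_def by blast
    have len: "length w = k" "length w' = k"
      using * by (auto simp: W_def)
    have "w = G_act (inv \<sigma>) (inverse a powi e) e w'"
    proof (rule nth_equalityI)
      fix j assume "j < length w"
      moreover from this have "inv \<sigma> j < k"
        using permutes_in_image[OF permutes_inv[OF *(3)], of j] len by simp
      moreover have "\<sigma> (inv \<sigma> j) = j"
        using *(3) by (simp add: permutes_inverses)
      ultimately show "w ! j = G_act (inv \<sigma>) (inverse a powi e) e w' ! j"
        using len *(5) nz[OF *(4)] unfolding *(6)
        by (auto simp: G_act_def power_int_minus)
    qed (simp add: G_act_def len)
    moreover have "inverse a powi e \<in> mu n"
      using pw[OF _ *(5), of "inverse a"] *(4) by (simp add: mu_def power_inverse)
    ultimately show "(w', w) \<in> G_orbit_rel n k"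
      using * permutes_inv[OF *(3)] unfolding G_orbit_rel_def by blast
  qed
  show "trans (G_orbit_rel n k)"
  proof (rule transI)
    fix w w' w'' assume "(w, w') \<in> G_orbit_rel n k" "(w', w'') \<in> G_orbit_rel n k"
    then obtain \<sigma> a e \<tau> b f where *: "w \<in> W n k" "w' \<in> W n k" "w'' \<in> W n k"
      "\<sigma> permutes {..<k}" "a \<in> mu n" "e \<in> {1, -1}" "w' = G_act \<sigma> a e w"
      "\<tau> permutes {..<k}" "b \<in> mu n" "f \<in> {1, -1}" "w'' = G_act \<tau> b f w'"
      unfolding G_orbit_rel_def by blast
    have len: "length w = k" "length w' = k" "length w'' = k"
      using * by (auto simp: W_def)
    have "w'' = G_act (\<sigma> \<circ> \<tau>) (b * a powi f) (e * f) w"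
    proof (rule nth_equalityI)
      fix j assume "j < length w''"
      moreover from this have "\<tau> j < k"
        using permutes_in_image[OF *(8), of j] len by simp
      ultimately show "w'' ! j = G_act (\<sigma> \<circ> \<tau>) (b * a powi f) (e * f) w ! j"
        using len unfolding *(11) *(7)
        by (simp add: G_act_def power_int_mult_distrib power_int_mult mult.assoc)
    qed (simp add: G_act_def len)
    moreover have "b * a powi f \<in> mu n"
      using ml pw *(5,9,10) by blast
    moreover have "e * f \<in> {1, -1}"
      using *(6,10) by auto
    ultimately show "(w, w'') \<in> G_orbit_rel n k"
      using * permutes_compose[OF *(8,4)] unfolding G_orbit_rel_def by blast
  qed
qed

definition W_bar :: "nat \<Rightarrow> nat \<Rightarrow> complex list set set" where
  "W_bar n k = W n k // G_orbit_rel n k"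

text \<open>
  A linear form on \<open>\<complex>\<^sup>3\<close> is given by its coefficient vector.
\<close>

definition form_kernel :: "complex^3 \<Rightarrow> (complex^3) set" where
  "form_kernel a = {v. (\<Sum>j\<in>UNIV. a$j * v$j) = 0}"

text \<open>
  Smoothness means \<open>C\<^sup>\<infinity>\<close>, with one-sided derivatives at the end points; \<open>D r\<close> is the derivative
  of order \<open>r\<close>.
\<close>

definition smooth_on_unit_interval :: "(real \<Rightarrow> complex^3) \<Rightarrow> bool" where
  "smooth_on_unit_interval f \<longleftrightarrow>
     (\<exists>D :: nat \<Rightarrow> real \<Rightarrow> complex^3. (\<forall>t\<in>{0..1}. D 0 t = f t) \<and>
        (\<forall>r. \<forall>t\<in>{0..1}. (D r has_vector_derivative D (Suc r) t) (at t within {0..1})))"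

definition lattice_isotopic :: "(complex^3) set set \<Rightarrow> (complex^3) set set \<Rightarrow> bool" where
  "lattice_isotopic A B \<longleftrightarrow>
     (\<exists>(d::nat) (\<alpha> :: nat \<Rightarrow> real \<Rightarrow> complex^3).
        (\<forall>i\<in>{1..d}. smooth_on_unit_interval (\<alpha> i)) \<and>
        (\<forall>t\<in>{0..1}. (\<forall>i\<in>{1..d}. \<alpha> i t \<noteq> 0) \<and> inj_on (\<lambda>i. form_kernel (\<alpha> i t)) {1..d}) \<and>
        (\<forall>I\<subseteq>{1..d}. \<forall>s\<in>{0..1}. \<forall>t\<in>{0..1}.
           vec.dim ((\<lambda>i. \<alpha> i s) ` I) = vec.dim ((\<lambda>i. \<alpha> i t) ` I)) \<and>
        A = (\<lambda>i. form_kernel (\<alpha> i 0)) ` {1..d} \<and>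
        B = (\<lambda>i. form_kernel (\<alpha> i 1)) ` {1..d})"

text \<open>
  The empty intersection is the whole space \<open>\<complex>\<^sup>3\<close>.
\<close>

definition intersection_lattice :: "(complex^3) set set \<Rightarrow> (complex^3) set set" where
  "intersection_lattice A = {\<Inter>S | S. S \<subseteq> A}"

definition lattice_isomorphic :: "(complex^3) set set \<Rightarrow> (complex^3) set set \<Rightarrow> bool" where
  "lattice_isomorphic A B \<longleftrightarrow>
     (\<exists>\<phi>. bij_betw \<phi> (intersection_lattice A) (intersection_lattice B) \<and>
        (\<forall>X \<in> intersection_lattice A. \<forall>Y \<in> intersection_lattice A. X \<supseteq> Y \<longleftrightarrow> \<phi> X \<supseteq> \<phi> Y))"

definition projectively_equivalent :: "(complex^3) set set \<Rightarrow> (complex^3) set set \<Rightarrow> bool" where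
  "projectively_equivalent A B \<longleftrightarrow>
     (\<exists>P :: complex^3^3. invertible P \<and> B = (\<lambda>l. (\<lambda>v. P *v v) ` l) ` A)"

end

theory Submission
  imports Defs
begin

text \<open>
  Let \<open>p \<noteq> q\<close> be modular points. With the line through them at infinity, the
      lines through \<open>p\<close>
  and \<open>q\<close> become \<open>y = a\<close> (\<open>a \<in> A\<close>) and \<open>z =
      b\<close> (\<open>b \<in> B\<close>), where \<open>A\<close> and \<open>B\<close> have
      \<open>m - 1\<close> elements. By
  modularity every other line \<open>z = s y + t\<close> maps \<open>A\<close> bijectively onto
      \<open>B\<close>, hence the barycentre of
  \<open>A\<close> to that of \<open>B\<close>; so all these lines are concurrent, and if there are
      at least two of them then
  their common point lies on the grid. Moving it to the origin, quotients of slopes permute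
  \<open>A - {0}\<close>, so they are \<open>(m - 2)\<close>-th roots of unity. An equivariant
      bijection from \<open>A - {0}\<close> to
  the roots of unity, followed by linear interpolation over a generic path in the complex
  parameter line, gives the isotopy to the arrangement of a tuple \<open>w\<close>. Conversely,
      along an isotopy every quotient of
  slopes is a cross ratio that is continuous and always a root of unity of bounded order, hence
  constant; this recovers the class of \<open>w\<close>. The modular points are found by comparing
  multiplicities.
\<close>

section \<open>Linear forms on complex three-space\<close>

text \<open>An isotopy is needed because arrangements with the same slopes can have moduli: in
  general \<open>A - {0}\<close> is a union of orbits of the group generated by the slope quotients,
  and the orbits can be scaled independently. When all roots of unity occur there is a single orbit,
  and a projective map suffices. The group acting on tuples is the ambiguity of the coordinates:
  permutations because only the set of slopes matters, translations from rescaling the two pencils,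
  inversion from exchanging the two modular points. To compare slopes at both ends of an isotopy,
  the pair of modular points has to be recognised at the end. For fewer than \<open>m - 2\<close>
  slopes and \<open>m\<close> at least 4 they are the only points of multiplicity \<open>m\<close>.
  For \<open>m - 2\<close> slopes there are more, but then the tuple lists all roots of unity and
  there is only one class. Planes in three-space have forms of rank at most three, so the lattice
  enters only through pairwise independence and the vanishing of determinants of triples.\<close>

definition ev :: "complex^3 \<Rightarrow> complex^3 \<Rightarrow> complex" where
  "ev a v = (\<Sum>j\<in>UNIV. a$j * v$j)"

text \<open>Used in two dual ways: the point common to two lines given by forms, and the form of the
  line joining two points.\<close>

definition cross :: "complex^3 \<Rightarrow> complex^3 \<Rightarrow> complex^3" where
  "cross a b = vector [a$2 * b$3 - a$3 * b$2, a$3 * b$1 - a$1 * b$3, a$1 * b$2 - a$2 * b$1]"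

definition det3 :: "complex^3 \<Rightarrow> complex^3 \<Rightarrow> complex^3 \<Rightarrow>
    complex" where
  "det3 a b c = ev a (cross b c)"

lemma ev_3: "ev a v = a$1 * v$1 + a$2 * v$2 + a$3 * v$3"
  by (simp add: ev_def sum_3)

lemma cross_nth [simp]:
  "cross a b $ 1 = a$2 * b$3 - a$3 * b$2"
  "cross a b $ 2 = a$3 * b$1 - a$1 * b$3"
  "cross a b $ 3 = a$1 * b$2 - a$2 * b$1"
  by (simp_all add: cross_def)

lemma vec3_eq_iff: "(a :: complex^3) = b \<longleftrightarrow> a$1 = b$1 \<and> a$2 = b$2 \<and>
    a$3 = b$3"
  by (simp add: vec_eq_iff forall_3)

lemmas vec3_simps = vec3_eq_iff ev_3 det3_def

lemma form_kernel_eq: "form_kernel a = {v. ev a v = 0}"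
  by (simp add: form_kernel_def ev_def)

lemma in_form_kernel: "v \<in> form_kernel a \<longleftrightarrow> ev a v = 0"
  by (simp add: form_kernel_eq)

lemma ev_linear [simp]:
  "ev (a + b) v = ev a v + ev b v" "ev (a - b) v = ev a v - ev b v" "ev (c *s a) v = c * ev a v"
  "ev a (u + v) = ev a u + ev a v" "ev a (u - v) = ev a u - ev a v" "ev a (c *s v) = c * ev a v"
  "ev 0 v = 0" "ev a 0 = 0"
  by (simp_all add: ev_3 algebra_simps)

lemma ev_commute: "ev a v = ev v a"
  by (simp add: ev_3)

lemma ev_cross_self [simp]: "ev a (cross a b) = 0" "ev b (cross a b) = 0"
  "ev (cross a b) a = 0" "ev (cross a b) b = 0"
  by (simp_all add: ev_3 algebra_simps)

lemma det3_cyclic: "det3 a b c = det3 b c a" "det3 a b c = det3 c a b"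
  by (simp_all add: vec3_simps algebra_simps)

lemma det3_swap: "det3 b a c = - det3 a b c" "det3 a c b = - det3 a b c"
  by (simp_all add: vec3_simps algebra_simps)

lemma det3_repeat [simp]: "det3 a a b = 0" "det3 a b a = 0" "det3 b a a = 0"
  by (simp_all add: vec3_simps algebra_simps)

lemma cramer:
  "det3 a b d *s c = det3 c b d *s a + det3 a c d *s b + det3 a b c *s d"
  by (simp add: vec3_simps algebra_simps)

lemma ev_nondegenerate:
  assumes "a \<noteq> 0" shows "\<exists>v. ev a v = 1"
proof -
  obtain i where i: "a $ i \<noteq> 0" using assms by (auto simp: vec_eq_iff)
  have "ev a (axis i (1 / a$i)) = (\<Sum>j\<in>UNIV. if j = i then 1 else 0)"
    unfolding ev_def using i by (intro sum.cong) (auto simp: axis_def)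
  then show ?thesis by auto
qed

lemma det3_nonzero_imp_cross:
  assumes "det3 a b c \<noteq> 0" shows "cross a b \<noteq> 0" "cross b c \<noteq> 0" "cross a c
      \<noteq> 0"
proof -
  have *: "det3 a b c = ev (cross b c) a" "det3 a b c = ev (cross a b) c" "det3 a b c = - ev (cross
      a c) b"
    by (simp_all add: vec3_simps algebra_simps)
  show "cross a b \<noteq> 0" "cross b c \<noteq> 0" "cross a c \<noteq> 0"
    using assms * by auto
qed

lemma cross_nonzero_imp: "cross a b \<noteq> 0 \<Longrightarrow> a \<noteq> 0" "cross a b \<noteq>
    0 \<Longrightarrow> b \<noteq> 0"
  by (auto simp: vec3_simps)

lemma cross_zero_iff:
  assumes "a \<noteq> 0" shows "cross a b = 0 \<longleftrightarrow> (\<exists>t. b = t *s a)"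
proof
  assume c: "cross a b = 0"
  obtain v where v: "ev a v = 1" using ev_nondegenerate[OF assms] by blast
  have "ev a v *s b = ev b v *s a"
  proof -
    \<comment> \<open>Expansion of the double cross product.\<close>
    have "ev a v *s b - ev b v *s a = cross (cross a b) v" "cross 0 v = 0"
      by (simp_all add: vec3_simps algebra_simps)
    then show ?thesis using c by simp
  qed
  then show "\<exists>t. b = t *s a" using v by auto
qed (auto simp: vec3_simps algebra_simps)

lemma span_insert_iff: "c \<in> vec.span {a, b} \<longleftrightarrow> (\<exists>s t. c = s *s a + t
    *s (b :: complex^3))"
proof -
  have "c \<in> vec.span {a, b} \<longleftrightarrow> (\<exists>k l. c - k *s a = l *s b)"
    by (auto simp: vec.span_breakdown_eq vec.span_singleton)
  then show ?thesis by (metis add.commute diff_add_cancel add_diff_cancel_left')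
qed

lemma det3_zero_iff_span:
  assumes "cross a b \<noteq> 0" shows "det3 a b c = 0 \<longleftrightarrow> c \<in> vec.span {a, b}"
proof
  assume z: "det3 a b c = 0"
  obtain d where "ev (cross a b) d = 1" using ev_nondegenerate[OF assms] by blast
  then have d: "det3 a b d = 1" by (simp add: det3_cyclic(2)[of a b d]) (simp add: det3_def ev_commute)
  have "c = det3 c b d *s a + det3 a c d *s b"
    using cramer[of a b d c] z d by simp
  then show "c \<in> vec.span {a, b}" unfolding span_insert_iff by blast
next
  assume "c \<in> vec.span {a, b}"
  then show "det3 a b c = 0" unfolding span_insert_iff
    by (auto simp: vec3_simps algebra_simps)
qed

lemma dim_singleton3: "(a :: complex^3) \<noteq> 0 \<Longrightarrow> vec.dim {a} = 1"
  by (simp add: vec.dim_insert)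

lemma dim_pair:
  assumes "cross a b \<noteq> 0" shows "vec.dim {a, b} = 2"
proof -
  have "b \<noteq> 0" "a \<notin> vec.span {b}"
    using assms cross_nonzero_imp[OF assms]
    by (auto simp: vec.span_singleton vec3_simps)
  then show ?thesis by (simp add: vec.dim_insert)
qed

lemma dim_triple_iff: "vec.dim {a, b, c} = 3 \<longleftrightarrow> det3 a b c \<noteq> 0"
proof (cases "cross a b = 0")
  case False
  have "vec.dim {a, b, c} = vec.dim (insert c {a, b})" by (simp add: insert_commute)
  then show ?thesis
    using det3_zero_iff_span[OF False, of c] dim_pair[OF False] by (simp add: vec.dim_insert)
next
  case True
  then have "det3 a b c = 0" by (metis det3_nonzero_imp_cross(1))
  moreover have "vec.dim {a, b, c} \<noteq> 3"
  proof (cases "a = 0")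
    case True
    then show ?thesis by (auto simp: vec.dim_insert vec.span_zero)
  next
    case False
    then obtain t where "b = t *s a" using True cross_zero_iff by blast
    then have "b \<in> vec.span {a, c}"
      using vec.span_scale[OF vec.span_base, of a "{a, c}" t] by simp
    moreover have "vec.dim {a, b, c} = vec.dim (insert b {a, c})" by (simp add: insert_commute)
    ultimately show ?thesis by (auto simp: vec.dim_insert)
  qed
  ultimately show ?thesis by simp
qed

lemma dim_complex3: "vec.dim (UNIV :: (complex^3) set) = 3"
  by (simp only: vec_dim_card) simp

lemma subspace_form_kernel: "vec.subspace (form_kernel a)"
  by (auto simp: vec.subspace_def form_kernel_eq)

lemma dim_form_kernel:
  assumes "a \<noteq> 0" shows "vec.dim (form_kernel a) = 2"
proof (rule antisym)
  obtain v where "ev a v = 1" using ev_nondegenerate[OF assms] by blast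
  then have "form_kernel a \<noteq> UNIV" by (metis UNIV_I in_form_kernel zero_neq_one)
  then have "vec.dim (form_kernel a) \<noteq> 3"
    using vec.subspace_dim_equal[OF subspace_form_kernel vec.subspace_UNIV, of a] dim_complex3 by auto
  moreover have "vec.dim (form_kernel a) \<le> 3"
    using vec.dim_subset[of "form_kernel a" UNIV] dim_complex3 by simp
  ultimately show "vec.dim (form_kernel a) \<le> 2" by linarith
  obtain u where u: "cross a u \<noteq> 0"
  proof -
    have "\<exists>u. cross a u \<noteq> 0"
    proof (rule ccontr)
      assume "\<not> ?thesis"
      then have "cross a (axis 1 1) = 0" "cross a (axis 2 1) = 0" by auto
      then show False using assms by (simp add: vec3_simps axis_def)
    qed
    then show ?thesis using that by blast
  qed
  obtain w where w: "ev (cross a u) w = 1" using ev_nondegenerate[OF u] by blast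
  \<comment> \<open>Both \<open>cross a u\<close> and \<open>cross a w\<close> lie in the kernel of
    \<open>a\<close>; they are independent because their own cross product is a nonzero multiple of
    \<open>a\<close>.\<close>
  have "cross (cross a u) (cross a w) = det3 a u w *s a"
    by (simp add: vec3_simps algebra_simps)
  moreover have "det3 a u w = 1" using w by (simp add: vec3_simps algebra_simps)
  ultimately have "cross (cross a u) (cross a w) \<noteq> 0" using assms by simp
  then have "vec.dim {cross a u, cross a w} = 2" by (rule dim_pair)
  moreover have "{cross a u, cross a w} \<subseteq> form_kernel a" by (simp add: form_kernel_eq)
  ultimately show "2 \<le> vec.dim (form_kernel a)" by (metis vec.dim_subset)
qed

lemma proj_line_form_kernel: "a \<noteq> 0 \<Longrightarrow> proj_line (form_kernel a)"
  by (simp add: proj_line_def subspace_form_kernel dim_form_kernel)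

lemma proj_line_subset_eq:
  assumes "proj_line l" "proj_line l'" "l \<subseteq> l'" shows "l = l'"
  using vec.subspace_dim_equal[of l l'] assms by (auto simp: proj_line_def)

lemma proj_line_spanned:
  assumes "proj_line l" shows "\<exists>u v. u \<in> l \<and> v \<in> l \<and> cross u v \<noteq> 0"
proof (rule ccontr)
  assume "\<not> ?thesis"
  then have c: "cross u v = 0" if "u \<in> l" "v \<in> l" for u v using that by blast
  have d: "vec.dim l = 2" using assms by (simp add: proj_line_def)
  obtain u where u: "u \<in> l" "u \<noteq> 0"
  proof (cases "l \<subseteq> {0}")
    case True
    then show ?thesis using d by (metis vec.dim_eq_0 zero_neq_numeral)
  qed (use that in auto)
  have "l \<subseteq> vec.span {u}"
    using c[OF u(1)] cross_zero_iff[OF u(2)] by (auto simp: vec.span_singleton)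
  then have "vec.dim l \<le> vec.dim {u}" using vec.dim_subset vec.dim_span by metis
  then show False using d u(2) by (simp add: dim_singleton3)
qed

lemma form_kernel_cross:
  assumes "cross u v \<noteq> 0" shows "form_kernel (cross u v) = vec.span {u, v}"
proof -
  have "c \<in> vec.span {u, v} \<longleftrightarrow> ev (cross u v) c = 0" for c
    using det3_zero_iff_span[OF assms, of c]
    by (metis det3_cyclic(2) det3_def ev_commute)
  then show ?thesis by (auto simp: form_kernel_eq)
qed

lemma proj_line_through:
  assumes "proj_line l" "u \<in> l" "v \<in> l" "cross u v \<noteq> 0"
  shows "l = form_kernel (cross u v)"
proof -
  have "vec.span {u, v} \<subseteq> l"
    using assms by (intro vec.span_minimal) (auto simp: proj_line_def)
  then show ?thesis
    using proj_line_subset_eq[OF proj_line_form_kernel[OF assms(4)] assms(1)]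
      form_kernel_cross[OF assms(4)] by auto
qed

lemma proj_line_iff: "proj_line l \<longleftrightarrow> (\<exists>a. a \<noteq> 0 \<and> l =
    form_kernel a)"
  using proj_line_spanned proj_line_through proj_line_form_kernel by metis

lemma form_kernel_eq_imp_cross:
  assumes "form_kernel a = form_kernel b" shows "cross a b = 0"
proof (rule ccontr)
  assume "cross a b \<noteq> 0"
  then obtain e where e: "ev (cross a b) e = 1" using ev_nondegenerate by blast
  \<comment> \<open>\<open>cross b e\<close> lies in the kernel of \<open>b\<close>, while
    \<open>a\<close> takes on it the value \<open>det3 a b e\<close>, which is
    \<open>ev (cross a b) e\<close>, hence 1.\<close>
  have "cross b e \<in> form_kernel a" using assms by (simp add: form_kernel_eq)
  then show False using e by (simp add: in_form_kernel vec3_simps algebra_simps)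
qed

lemma form_kernel_scale: "c \<noteq> 0 \<Longrightarrow> form_kernel (c *s a) = form_kernel a"
  by (simp add: form_kernel_eq)

lemma form_kernel_eq_iff:
  assumes "a \<noteq> 0" "b \<noteq> 0"
  shows "form_kernel a = form_kernel b \<longleftrightarrow> (\<exists>t. t \<noteq> 0 \<and> b = t
      *s a)"
proof
  assume "form_kernel a = form_kernel b"
  then obtain t where "b = t *s a"
    using form_kernel_eq_imp_cross[of a b] cross_zero_iff[OF assms(1)] by blast
  moreover from this have "t \<noteq> 0" using assms by auto
  ultimately show "\<exists>t. t \<noteq> 0 \<and> b = t *s a" by blast
qed (auto simp: form_kernel_scale)

lemma proj_point_iff: "proj_point p \<longleftrightarrow> (\<exists>u. u \<noteq> 0 \<and> p =
    vec.span {u})"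
proof
  assume p: "proj_point p"
  then obtain u where u: "u \<in> p" "u \<noteq> 0"
  proof (cases "p \<subseteq> {0}")
    case True
    then show ?thesis using p by (metis vec.dim_eq_0 zero_neq_one proj_point_def)
  qed (use that in auto)
  have "vec.span {u} \<subseteq> p" using p u by (intro vec.span_minimal) (auto simp: proj_point_def)
  then have "vec.span {u} = p"
    using vec.subspace_dim_equal[of "vec.span {u}" p] p u by (simp add: proj_point_def dim_singleton3)
  then show "\<exists>u. u \<noteq> 0 \<and> p = vec.span {u}" using u by blast
qed (auto simp: proj_point_def dim_singleton3)

lemma span_singleton_eq_iff:
  assumes "u \<noteq> 0" "v \<noteq> 0" shows "vec.span {u} = vec.span {v} \<longleftrightarrow>
      cross u v = 0"
proof
  assume "vec.span {u} = vec.span {v}"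
  then have "v \<in> vec.span {u}" using vec.span_base by blast
  then show "cross u v = 0" using cross_zero_iff[OF assms(1)] by (auto simp: vec.span_singleton)
next
  assume "cross u v = 0"
  then obtain t where "v = t *s u" using cross_zero_iff[OF assms(1)] by blast
  moreover from this have "t \<noteq> 0" using assms by auto
  ultimately show "vec.span {u} = vec.span {v}"
    using vec.span_image_scale[of "{u}" "\<lambda>_. t"] by simp
qed

lemma span_subset_line: "proj_line l \<Longrightarrow> vec.span {u} \<subseteq> l
    \<longleftrightarrow> u \<in> l"
  using vec.span_minimal[of "{u}" l] vec.span_base[of u "{u}"] by (auto simp: proj_line_def)

lemma basis_solve:
  assumes "det3 X Y Z \<noteq> 0"
  shows "\<exists>v. ev X v = x \<and> ev Y v = y \<and> ev Z v = z"
proof -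
  let ?v = "(x / det3 X Y Z) *s cross Y Z + (y / det3 X Y Z) *s cross Z X + (z / det3 X Y Z) *s
      cross X Y"
  have "ev X (cross Y Z) = det3 X Y Z" "ev Y (cross Z X) = det3 X Y Z" "ev Z (cross X Y) = det3 X Y Z"
    by (simp_all add: vec3_simps algebra_simps)
  then have "ev X ?v = x \<and> ev Y ?v = y \<and> ev Z ?v = z" using assms by simp
  then show ?thesis by blast
qed

lemma basis_eq_0:
  assumes "det3 X Y Z \<noteq> 0" "ev X v = 0" "ev Y v = 0" "ev Z v = 0" shows "v = 0"
proof -
  have "det3 X Y Z *s v = ev X v *s cross Y Z + ev Y v *s cross Z X + ev Z v *s cross X Y"
    by (simp add: vec3_simps algebra_simps)
  then show ?thesis using assms by simp
qed

lemma basis_combination: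
  assumes "det3 X Y Z \<noteq> 0" shows "\<exists>a b c. d = a *s X + b *s Y + c *s Z"
proof -
  have "d = (1 / det3 X Y Z) *s (det3 X Y Z *s d)" using assms by simp
  also have "\<dots> = (det3 d Y Z / det3 X Y Z) *s X + (det3 X d Z / det3 X Y Z) *s Y + (det3 X Y
      d / det3 X Y Z) *s Z"
    unfolding cramer[of X Y Z d] using assms by (simp add: vec.scale_right_distrib)
  finally show ?thesis by blast
qed

text \<open>The double annihilator of a set of forms is its span. This converts an inclusion between
  intersections of planes into a statement about ranks of forms.\<close>

lemma in_span_iff_annihilated:
  fixes S :: "(complex^3) set"
  shows "b \<in> vec.span S \<longleftrightarrow> (\<forall>v. (\<forall>a\<in>S. ev a v = 0)
      \<longrightarrow> ev b v = 0)"
proof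
  assume b: "b \<in> vec.span S"
  show "\<forall>v. (\<forall>a\<in>S. ev a v = 0) \<longrightarrow> ev b v = 0"
  proof (intro allI impI)
    fix v assume v: "\<forall>a\<in>S. ev a v = 0"
    have "vec.span S \<subseteq> form_kernel v"
      using v by (intro vec.span_minimal subspace_form_kernel) (auto simp: form_kernel_eq ev_commute)
    then show "ev b v = 0" using b by (auto simp: form_kernel_eq ev_commute)
  qed
next
  assume ann: "\<forall>v. (\<forall>a\<in>S. ev a v = 0) \<longrightarrow> ev b v = 0"
  show "b \<in> vec.span S"
  proof (rule ccontr)
    assume nb: "b \<notin> vec.span S"
    obtain B where B: "B \<subseteq> S" "vec.independent B" "S \<subseteq> vec.span B"
      using vec.maximal_independent_subset[of S] by blast
    have sp: "vec.span B = vec.span S"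
      using B by (metis vec.span_eq vec.span_mono vec.span_superset subset_trans)
    then have "vec.independent (insert b B)"
      using B nb by (simp add: vec.independent_insert)
    then obtain f where f: "Vector_Spaces.linear (*s) (*s) f"
      "\<forall>x\<in>insert b B. f x = (if x = b then (axis 1 1 :: complex^3) else 0)"
      using vec.linear_independent_extend[of "insert b B" "\<lambda>x. if x = b then axis 1 1 else
          0"] by blast
    \<comment> \<open>\<open>f\<close> sends \<open>b\<close> to the first unit vector and kills
      \<open>B\<close>, so the first row of its matrix is a vector annihilated by \<open>S\<close>
      but not by \<open>b\<close>.\<close>
    define v where "v = matrix f $ 1"
    have fv: "f x $ 1 = ev v x" for x
      by (simp add: v_def ev_def matrix_vector_mult_def flip: matrix_works[OF f(1)])
    have "b \<notin> B" using nb sp vec.span_base by blast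
    then have "\<forall>a\<in>B. ev v a = 0" using f(2) fv by (metis insertCI zero_index)
    then have "S \<subseteq> form_kernel v"
      using B(3) vec.span_minimal[OF _ subspace_form_kernel, of B v] by (auto simp: form_kernel_eq)
    then have "ev b v = 0" using ann by (metis subsetD in_form_kernel ev_commute)
    moreover have "ev b v = 1" using f(2) fv[of b] by (simp add: ev_commute axis_def)
    ultimately show False by simp
  qed
qed

section \<open>Lattice isotopy\<close>

lemma dim_family:
  fixes u :: "'i \<Rightarrow> complex^3"
  assumes "i \<in> I" "j \<in> I" "cross (u i) (u j) \<noteq> 0"
  shows "vec.dim (u ` I) = (if \<exists>k\<in>I. det3 (u i) (u j) (u k) \<noteq> 0 then 3 else 2)"
proof (cases "\<exists>k\<in>I. det3 (u i) (u j) (u k) \<noteq> 0")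
  case True
  then obtain k where k: "k \<in> I" "det3 (u i) (u j) (u k) \<noteq> 0" by blast
  have "vec.dim {u i, u j, u k} \<le> vec.dim (u ` I)"
    using assms k by (intro vec.dim_subset) auto
  moreover have "vec.dim (u ` I) \<le> 3"
    using vec.dim_subset[of "u ` I" UNIV] dim_complex3 by simp
  ultimately show ?thesis using dim_triple_iff[of "u i" "u j" "u k"] k True by simp
next
  case False
  have "u ` I \<subseteq> vec.span {u i, u j}"
    using False det3_zero_iff_span[OF assms(3)] by auto
  then have "vec.dim (u ` I) \<le> vec.dim {u i, u j}" using vec.dim_subset vec.dim_span by metis
  moreover have "vec.dim {u i, u j} \<le> vec.dim (u ` I)"
    using assms by (intro vec.dim_subset) auto
  ultimately show ?thesis using dim_pair[OF assms(3)] False by simp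
qed

text \<open>In three-space, the rank of a family of nonzero, pairwise independent forms is decided
  by which triples are dependent. Constancy of the lattice thus becomes a matter of cross products
  and determinants.\<close>

lemma dim_family_eq:
  fixes u v :: "'i \<Rightarrow> complex^3"
  assumes nz: "\<And>i. i \<in> I \<Longrightarrow> u i \<noteq> 0 \<and> v i \<noteq> 0"
    and pr: "\<And>i j. i \<in> I \<Longrightarrow> j \<in> I \<Longrightarrow> i \<noteq> j
        \<Longrightarrow> cross (u i) (u j) \<noteq> 0 \<and> cross (v i) (v j) \<noteq> 0"
    and tr: "\<And>i j k. i \<in> I \<Longrightarrow> j \<in> I \<Longrightarrow> k \<in> I
        \<Longrightarrow>
      det3 (u i) (u j) (u k) = 0 \<longleftrightarrow> det3 (v i) (v j) (v k) = 0"
  shows "vec.dim (u ` I) = vec.dim (v ` I)"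
proof (cases "\<exists>i\<in>I. \<exists>j\<in>I. i \<noteq> j")
  case True
  then obtain i j where ij: "i \<in> I" "j \<in> I" "i \<noteq> j" by blast
  show ?thesis
    using dim_family[of i I j u] dim_family[of i I j v] ij pr[OF ij] tr[OF ij(1,2)] by simp
next
  case False
  then consider "I = {}" | i where "I = {i}" by blast
  then show ?thesis
  proof cases
    case (2 i)
    then show ?thesis using nz[of i] by (simp add: dim_singleton3)
  qed simp
qed

text \<open>A flat lies in the kernel of a form exactly when adding this form to those defining the
  flat does not raise the rank. Inclusion of flats is therefore a rank condition on index sets, the
  same at both ends.\<close>

lemma lattice_isotopic_imp_isomorphic:
  assumes "lattice_isotopic A B" shows "lattice_isomorphic A B"
proof -
  obtain d :: nat and \<alpha> :: "nat \<Rightarrow> real \<Rightarrow> complex^3" where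
    rk: "\<And>I s t. I \<subseteq> {1..d} \<Longrightarrow> s \<in> {0..1} \<Longrightarrow> t
        \<in> {0..1} \<Longrightarrow>
           vec.dim ((\<lambda>i. \<alpha> i s) ` I) = vec.dim ((\<lambda>i. \<alpha> i t) ` I)"
    and A: "A = (\<lambda>i. form_kernel (\<alpha> i 0)) ` {1..d}"
    and B: "B = (\<lambda>i. form_kernel (\<alpha> i 1)) ` {1..d}"
    using assms unfolding lattice_isotopic_def by blast
  define F where "F t J = \<Inter>((\<lambda>i. form_kernel (\<alpha> i t)) ` J)" for t J
  have sub1: "F t J \<subseteq> form_kernel (\<alpha> i t) \<longleftrightarrow>
      vec.dim ((\<lambda>i. \<alpha> i t) ` insert i J) = vec.dim ((\<lambda>i. \<alpha> i t) ` J)"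
          for t J i
  proof -
    have "F t J \<subseteq> form_kernel (\<alpha> i t) \<longleftrightarrow> \<alpha> i t \<in>
        vec.span ((\<lambda>i. \<alpha> i t) ` J)"
      unfolding in_span_iff_annihilated F_def by (auto simp: form_kernel_eq)
    then show ?thesis by (simp add: vec.dim_insert)
  qed
  have key: "F 0 J \<subseteq> F 0 K \<longleftrightarrow> F 1 J \<subseteq> F 1 K" if J: "J
      \<subseteq> {1..d}" and K: "K \<subseteq> {1..d}" for J K
  proof -
    have "F 0 J \<subseteq> form_kernel (\<alpha> i 0) \<longleftrightarrow> F 1 J \<subseteq>
        form_kernel (\<alpha> i 1)" if "i \<in> K" for i
    proof -
      have "insert i J \<subseteq> {1..d}" using that J K by auto
      then show ?thesis
        unfolding sub1 using rk[of "insert i J" 0 1] rk[OF J, of 0 1] by simp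
    qed
    then show ?thesis unfolding F_def by (simp add: le_INF_iff)
  qed
  have LA: "intersection_lattice A = F 0 ` Pow {1..d}"
    unfolding intersection_lattice_def A F_def by (auto simp: subset_image_iff image_iff)
  have LB: "intersection_lattice B = F 1 ` Pow {1..d}"
    unfolding intersection_lattice_def B F_def by (auto simp: subset_image_iff image_iff)
  \<comment> \<open>Different index sets may cut out the same flat; taking all planes that contain
    it makes the map depend on the flat alone.\<close>
  define \<phi> where "\<phi> X = F 1 {i \<in> {1..d}. X \<subseteq> form_kernel (\<alpha> i 0)}" for X
  have \<phi>: "\<phi> (F 0 J) = F 1 J" if J: "J \<subseteq> {1..d}" for J
  proof -
    define K where "K = {i \<in> {1..d}. F 0 J \<subseteq> form_kernel (\<alpha> i 0)}"
    have K: "K \<subseteq> {1..d}" unfolding K_def by blast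
    have "F 0 J = F 0 K"
    proof (rule subset_antisym)
      show "F 0 J \<subseteq> F 0 K" unfolding F_def K_def by blast
      have "J \<subseteq> K" using J unfolding F_def K_def by blast
      then show "F 0 K \<subseteq> F 0 J" unfolding F_def by blast
    qed
    then have "F 1 J = F 1 K" using key[OF J K] key[OF K J] by simp
    then show ?thesis unfolding \<phi>_def K_def by simp
  qed
  have ord: "F 0 J \<supseteq> F 0 K \<longleftrightarrow> \<phi> (F 0 J) \<supseteq> \<phi> (F 0
      K)" if "J \<subseteq> {1..d}" "K \<subseteq> {1..d}" for J K
    using \<phi> that key by simp
  have ord': "X \<supseteq> Y \<longleftrightarrow> \<phi> X \<supseteq> \<phi> Y" if "X \<in>
      intersection_lattice A" "Y \<in> intersection_lattice A" for X Y
    using that ord unfolding LA by auto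
  have "bij_betw \<phi> (intersection_lattice A) (intersection_lattice B)"
  proof (rule bij_betw_imageI)
    show "inj_on \<phi> (intersection_lattice A)"
      using ord' by (intro inj_onI) (metis order_refl subset_antisym)
    show "\<phi> ` intersection_lattice A = intersection_lattice B"
      unfolding LA LB image_image using \<phi> by (intro image_cong) auto
  qed
  then show ?thesis unfolding lattice_isomorphic_def using ord' by blast
qed

text \<open>The arcs for different \<open>c\<close> meet only at 0 and 1, which are not in
  \<open>F\<close>; so each point of \<open>F\<close> rules out at most one
  \<open>c\<close>.\<close>

lemma avoiding_path:
  fixes F :: "complex set"
  assumes "finite F" "0 \<notin> F" "1 \<notin> F"
  shows "\<exists>c::real. \<forall>t\<in>{0..1}. of_real t + \<i> * of_real (c * t * (1 - t))
      \<notin> F"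
proof -
  obtain c where c: "c \<notin> (\<lambda>f. Im f / (Re f * (1 - Re f))) ` F"
    using ex_new_if_finite[OF infinite_UNIV_char_0] assms(1) by blast
  have "of_real t + \<i> * of_real (c * t * (1 - t)) \<notin> F" for t
  proof
    let ?f = "of_real t + \<i> * of_real (c * t * (1 - t)) :: complex"
    assume f: "?f \<in> F"
    then have "t \<noteq> 0" "t \<noteq> 1" using assms by auto
    then have "c = Im ?f / (Re ?f * (1 - Re ?f))" by simp
    then show False using c f by blast
  qed
  then show ?thesis by blast
qed

text \<open>Derivatives of every order along the real interval are restrictions of the formal
  derivatives \<open>pderiv\<close>.\<close>

lemma smooth_polynomial_path:
  assumes "\<And>j t. f t $ j = poly (p j) (of_real t)"
  shows "smooth_on_unit_interval f"
proof -
  define D :: "nat \<Rightarrow> real \<Rightarrow> complex^3"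
    where "D r t = (\<Sum>j\<in>UNIV. axis j (poly ((pderiv ^^ r) (p j)) (of_real t)))" for r t
  have bl: "bounded_linear (axis j :: complex \<Rightarrow> complex^3)" for j
    unfolding linear_conv_bounded_linear[symmetric] by (intro linearI) (auto simp: vec_eq_iff axis_def)
  have "(D r has_vector_derivative D (Suc r) t) (at t within {0..1})" for r t
    unfolding D_def funpow.simps comp_def
    by (intro has_vector_derivative_sum bounded_linear.has_vector_derivative[OF bl]
        has_vector_derivative_real_field poly_DERIV)
  moreover have "D 0 t = f t" for t
    by (simp add: vec_eq_iff D_def axis_def assms)
  ultimately show ?thesis unfolding smooth_on_unit_interval_def by blast
qed

text \<open>
  A complex one-parameter family may degenerate at finitely many parameters: the path from
      \<open>0\<close> to
  \<open>1\<close> avoids them, because removing a finite set does not disconnect the complex line.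
\<close>

lemma lattice_isotopicI:
  fixes \<beta> :: "'k \<Rightarrow> complex \<Rightarrow> complex^3"
  assumes fin: "finite K"
    and poly: "\<And>i j. i \<in> K \<Longrightarrow> \<exists>p. \<forall>s. \<beta> i s $ j =
        poly p s"
    and F: "finite F" "0 \<notin> F" "1 \<notin> F"
    and nz: "\<And>i s. i \<in> K \<Longrightarrow> s \<notin> F \<Longrightarrow> \<beta> i s
        \<noteq> 0"
    and pr: "\<And>i j s. i \<in> K \<Longrightarrow> j \<in> K \<Longrightarrow> i \<noteq> j
        \<Longrightarrow> s \<notin> F \<Longrightarrow> cross (\<beta> i s) (\<beta> j s) \<noteq> 0"
    and tr: "\<And>i j k s s'. i \<in> K \<Longrightarrow> j \<in> K \<Longrightarrow> k \<in> K
        \<Longrightarrow> s \<notin> F \<Longrightarrow> s' \<notin> F \<Longrightarrow>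
      det3 (\<beta> i s) (\<beta> j s) (\<beta> k s) = 0 \<longleftrightarrow> det3 (\<beta> i s')
          (\<beta> j s') (\<beta> k s') = 0"
  shows "lattice_isotopic ((\<lambda>i. form_kernel (\<beta> i 0)) ` K) ((\<lambda>i. form_kernel
      (\<beta> i 1)) ` K)"
proof -
  obtain c where c: "\<And>t. t \<in> {0..1} \<Longrightarrow> of_real t + \<i> * of_real (c * t *
      (1 - t)) \<notin> F"
    using avoiding_path[OF F] by blast
  \<comment> \<open>The arc of \<open>avoiding_path\<close> written as a polynomial in
    \<open>t\<close>, so that composing with it keeps all coordinates polynomial and hence
    smooth.\<close>
  define q where "q = [:0, 1 + \<i> * of_real c, - (\<i> * of_real c):]"
  define \<sigma> where "\<sigma> t = poly q (of_real t)" for t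
  have \<sigma>: "\<sigma> t \<notin> F" if "t \<in> {0..1}" for t
    using c[OF that] by (simp add: \<sigma>_def q_def algebra_simps)
  have \<sigma>01: "\<sigma> 0 = 0" "\<sigma> 1 = 1" by (simp_all add: \<sigma>_def q_def)
  obtain N :: nat and h where h: "bij_betw h {1..N} K" using ex_bij_betw_nat_finite_1[OF fin] by blast
  define \<alpha> where "\<alpha> i t = \<beta> (h i) (\<sigma> t)" for i t
  have hK: "h i \<in> K" if "i \<in> {1..N}" for i using h that by (auto simp: bij_betw_def)
  have hne: "h i \<noteq> h j" if "i \<in> {1..N}" "j \<in> {1..N}" "i \<noteq> j" for i j
    using inj_onD[OF bij_betw_imp_inj_on[OF h]] that by blast
  have sm: "smooth_on_unit_interval (\<alpha> i)" if i: "i \<in> {1..N}" for i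
  proof -
    have "\<forall>j. \<exists>p. \<forall>s. \<beta> (h i) s $ j = poly p s" using poly[OF hK[OF
        i]] by blast
    then obtain p where p: "\<And>j s. \<beta> (h i) s $ j = poly (p j) s" by metis
    show ?thesis
      by (rule smooth_polynomial_path[where p = "\<lambda>j. pcompose (p j) q"])
        (simp add: \<alpha>_def p \<sigma>_def poly_pcompose)
  qed
  have inj: "inj_on (\<lambda>i. form_kernel (\<alpha> i t)) {1..N}" if "t \<in> {0..1}" for t
    using form_kernel_eq_imp_cross pr[OF hK hK hne \<sigma>[OF that]] unfolding \<alpha>_def
    by (intro inj_onI) blast
  have rk: "vec.dim ((\<lambda>i. \<alpha> i s) ` I) = vec.dim ((\<lambda>i. \<alpha> i t) ` I)"
    if I: "I \<subseteq> {1..N}" and "s \<in> {0..1}" "t \<in> {0..1}" for I s t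
    unfolding \<alpha>_def
    by (rule dim_family_eq; use I hK hne nz pr tr \<sigma> that in \<open>auto simp: subset_iff\<close>)
  have im: "(\<lambda>i. form_kernel (\<beta> i (\<sigma> t))) ` K = (\<lambda>i. form_kernel
      (\<alpha> i t)) ` {1..N}" for t
    unfolding bij_betw_imp_surj_on[OF h, symmetric] by (simp add: \<alpha>_def image_image)
  have nz': "\<alpha> i t \<noteq> 0" if "i \<in> {1..N}" "t \<in> {0..1}" for i t
    using nz[OF hK \<sigma>] that by (simp add: \<alpha>_def)
  show ?thesis
    unfolding lattice_isotopic_def
  proof (intro exI conjI ballI allI impI)
    show "(\<lambda>i. form_kernel (\<beta> i 0)) ` K = (\<lambda>i. form_kernel (\<alpha> i 0)) `
        {1..N}"
      "(\<lambda>i. form_kernel (\<beta> i 1)) ` K = (\<lambda>i. form_kernel (\<alpha> i 1)) ` {1..N}"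
      using im[of 0] im[of 1] unfolding \<sigma>01 by blast+
  qed (use sm inj rk nz' in blast)+
qed

section \<open>Arrangements in normal form\<close>

lemma det3_linear:
  "det3 (a + a') b c = det3 a b c + det3 a' b c" "det3 (k *s a) b c = k * det3 a b c"
  "det3 a (b + b') c = det3 a b c + det3 a b' c" "det3 a (k *s b) c = k * det3 a b c"
  "det3 a b (c + c') = det3 a b c + det3 a b c'" "det3 a b (k *s c) = k * det3 a b c"
  by (simp_all add: vec3_simps algebra_simps)

definition comb :: "complex^3 \<Rightarrow> complex^3 \<Rightarrow> complex^3 \<Rightarrow>
    complex^3 \<Rightarrow> complex^3" where
  "comb X Y Z v = v$1 *s X + v$2 *s Y + v$3 *s Z"

text \<open>Multiplicativity of the determinant: incidences can be read off the coordinates,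
  whichever basis carries them.\<close>

lemma det3_comb:
  "det3 (comb X Y Z u) (comb X Y Z v) (comb X Y Z w) = det3 u v w * det3 X Y Z"
proof -
  have "det3 X Z Y = - det3 X Y Z" "det3 Y X Z = - det3 X Y Z" "det3 Y Z X = det3 X Y Z"
    "det3 Z X Y = det3 X Y Z" "det3 Z Y X = - det3 X Y Z"
    by (simp_all add: vec3_simps algebra_simps)
  then show ?thesis
    unfolding comb_def det3_linear by (simp add: vec3_simps) (simp add: algebra_simps)
qed

lemma cross_comb:
  assumes "cross u v \<noteq> 0" "det3 X Y Z \<noteq> 0"
  shows "cross (comb X Y Z u) (comb X Y Z v) \<noteq> 0"
proof -
  obtain e where "ev (cross u v) e = 1" using ev_nondegenerate[OF assms(1)] by blast
  moreover have "det3 u v e = ev (cross u v) e" by (simp add: vec3_simps algebra_simps)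
  ultimately have "det3 (comb X Y Z u) (comb X Y Z v) (comb X Y Z e) \<noteq> 0"
    using assms(2) by (simp add: det3_comb)
  then show ?thesis by (rule det3_nonzero_imp_cross)
qed

text \<open>\<open>Base\<close> is the line joining the two modular points, \<open>First\<close> and
  \<open>Second\<close> are the other lines through one of them, \<open>Third\<close> the lines
  through neither. Indices, unlike sets of vectors, keep track of a line while it moves.\<close>

datatype line_index = Base | First complex | Second complex | Third complex

definition index_set :: "complex set \<Rightarrow> complex set \<Rightarrow> complex set
    \<Rightarrow> line_index set" where
  "index_set A B S = insert Base (First ` A \<union> Second ` B \<union> Third ` S)"

text \<open>The index is a label, and \<open>a\<close> and \<open>b\<close> say where the labelled
  line is placed. Slopes are taken literally, since the deformation below does not change
  them.\<close>

fun coords :: "(complex \<Rightarrow> complex) \<Rightarrow> (complex \<Rightarrow> complex)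
    \<Rightarrow> line_index \<Rightarrow> complex^3" where
  "coords a b Base = vector [1, 0, 0]"
| "coords a b (First u) = vector [- a u, 1, 0]"
| "coords a b (Second u) = vector [- b u, 0, 1]"
| "coords a b (Third s) = vector [0, - s, 1]"

definition frm :: "complex^3 \<Rightarrow> complex^3 \<Rightarrow> complex^3 \<Rightarrow> (complex
    \<Rightarrow> complex) \<Rightarrow> (complex \<Rightarrow> complex)
    \<Rightarrow> line_index \<Rightarrow> complex^3" where
  "frm X Y Z a b i = comb X Y Z (coords a b i)"

lemma frm_simps [simp]:
  "frm X Y Z a b Base = X"
  "frm X Y Z a b (First u) = Y - a u *s X"
  "frm X Y Z a b (Second u) = Z - b u *s X"
  "frm X Y Z a b (Third s) = Z - s *s Y"
  by (simp_all add: frm_def comb_def vec3_eq_iff)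

definition arr :: "complex^3 \<Rightarrow> complex^3 \<Rightarrow> complex^3 \<Rightarrow> complex
    set \<Rightarrow> complex set \<Rightarrow> complex set
    \<Rightarrow> (complex^3) set set" where
  "arr X Y Z A B S = insert (form_kernel X) ((\<lambda>u. form_kernel (Y - u *s X)) ` A \<union>
     (\<lambda>u. form_kernel (Z - u *s X)) ` B \<union> (\<lambda>s. form_kernel (Z - s *s Y)) ` S)"

lemma image_frm:
  "(\<lambda>i. form_kernel (frm X Y Z a b i)) ` index_set A B S = arr X Y Z (a ` A) (b ` B) S"
  by (simp add: arr_def index_set_def image_Un image_image)

text \<open>Conditions under which placing the lines by \<open>a\<close> and \<open>b\<close>
  neither creates nor destroys a triple point. Label 0 belongs to the two lines through the common
  point of the \<open>Third\<close> lines, which must stay there.\<close>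

definition compatible :: "complex set \<Rightarrow> complex set \<Rightarrow> complex set
    \<Rightarrow> (complex \<Rightarrow> complex) \<Rightarrow> (complex \<Rightarrow> complex)
        \<Rightarrow> bool" where
  "compatible A B S a b \<longleftrightarrow> 0 \<in> A \<and> 0 \<in> B \<and> 0 \<notin> S \<and>
      inj_on a A \<and> inj_on b B \<and> a 0 = 0 \<and> b 0 = 0 \<and>
     (\<forall>s\<in>S. \<forall>u\<in>A. \<forall>v\<in>B. b v = s * a u \<longleftrightarrow> v =
         s * u)"

lemma compatible_id: "0 \<in> A \<Longrightarrow> 0 \<in> B \<Longrightarrow> 0 \<notin> S
    \<Longrightarrow> compatible A B S id id"
  by (simp add: compatible_def)

lemma cross_coords:
  assumes "compatible A B S a b" "i \<in> index_set A B S" "j \<in> index_set A B S" "i \<noteq> j"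
  shows "cross (coords a b i) (coords a b j) \<noteq> 0"
  using assms unfolding compatible_def index_set_def
  by (auto simp: vec3_eq_iff dest: inj_onD)

lemma det3_coords_zero_iff:
  assumes "compatible A B S a b"
    and "i \<in> index_set A B S" "j \<in> index_set A B S" "k \<in> index_set A B S"
  shows "det3 (coords a b i) (coords a b j) (coords a b k) = 0 \<longleftrightarrow>
    det3 (coords id id i) (coords id id j) (coords id id k) = 0"
proof -
  have A: "a u = a v \<longleftrightarrow> u = v" if "u \<in> A" "v \<in> A" for u v
    using assms(1) that by (auto simp: compatible_def dest: inj_onD)
  have B: "b u = b v \<longleftrightarrow> u = v" if "u \<in> B" "v \<in> B" for u v
    using assms(1) that by (auto simp: compatible_def dest: inj_onD)
  have A0: "a u = 0 \<longleftrightarrow> u = 0" if "u \<in> A" for u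
    using assms(1) A[of u 0] that by (auto simp: compatible_def)
  have B0: "b u = 0 \<longleftrightarrow> u = 0" if "u \<in> B" for u
    using assms(1) B[of u 0] that by (auto simp: compatible_def)
  have S: "b v = s * a u \<longleftrightarrow> v = s * u" if "s \<in> S" "u \<in> A" "v \<in> B"
      for s u v
    using assms(1) that by (auto simp: compatible_def)
  have S': "s * a u = b v \<longleftrightarrow> s * u = v" "a u * s = b v \<longleftrightarrow> u *
      s = v" "b v = a u * s \<longleftrightarrow> v = u * s"
    if "s \<in> S" "u \<in> A" "v \<in> B" for s u v
    using S[OF that] by (auto simp: mult.commute)
  have S0: "s \<noteq> 0" if "s \<in> S" for s using assms(1) that by (auto simp: compatible_def)
  have d: "s * x = s' * x \<longleftrightarrow> s = s' \<or> x = 0" "x * s = x * s'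
      \<longleftrightarrow> s = s' \<or> x = 0" for s s' x :: complex
    by auto
  from assms(2-4) show ?thesis
    unfolding index_set_def
    by (elim insertE UnE imageE; simp add: det3_def ev_3 A B A0 B0 S S' S0 d)
qed

definition polynomial_fun :: "(complex \<Rightarrow> complex) \<Rightarrow> bool" where
  "polynomial_fun h \<longleftrightarrow> (\<exists>p. \<forall>s. h s = poly p s)"

lemma polynomial_fun_intros:
  "polynomial_fun (\<lambda>s. c)" "polynomial_fun (\<lambda>s. s)"
  "polynomial_fun g \<Longrightarrow> polynomial_fun h \<Longrightarrow> polynomial_fun
      (\<lambda>s. g s + h s)"
  "polynomial_fun g \<Longrightarrow> polynomial_fun h \<Longrightarrow> polynomial_fun
      (\<lambda>s. g s - h s)"
  "polynomial_fun g \<Longrightarrow> polynomial_fun h \<Longrightarrow> polynomial_fun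
      (\<lambda>s. g s * h s)"
proof -
  show "polynomial_fun (\<lambda>s. c)" unfolding polynomial_fun_def by (rule exI[of _ "[:c:]"]) simp
  show "polynomial_fun (\<lambda>s. s)" unfolding polynomial_fun_def by (rule exI[of _ "[:0, 1:]"]) simp
qed (unfold polynomial_fun_def, metis poly_add, metis poly_diff, metis poly_mult)

lemma finite_zeros_polynomial_fun:
  assumes "polynomial_fun h" "h c \<noteq> 0" shows "finite {s. h s = 0}"
proof -
  obtain p where p: "\<And>s. h s = poly p s" using assms(1) unfolding polynomial_fun_def by blast
  then have "p \<noteq> 0" using assms(2) by auto
  then show ?thesis using poly_roots_finite[of p] p by simp
qed

lemma finite_coincidences:
  assumes "polynomial_fun g" "polynomial_fun h" "g c \<noteq> h c" shows "finite {s. g s = h s}"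
  using finite_zeros_polynomial_fun[of "\<lambda>s. g s - h s" c] assms polynomial_fun_intros by simp

text \<open>
  Linear interpolation commutes with multiplication by a slope \<open>s \<in> S\<close>, so every
      incidence
  that holds at both ends persists along the family.
\<close>

lemma arr_lattice_isotopic:
  assumes d: "det3 X Y Z \<noteq> 0" "det3 X' Y' Z' \<noteq> 0"
    and fin: "finite A" "finite B" "finite S"
    and z: "0 \<in> A" "0 \<in> B" "0 \<notin> S" "f 0 = 0" "g 0 = 0"
    and inj: "inj_on f A" "inj_on g B"
    and S: "\<And>s a. s \<in> S \<Longrightarrow> a \<in> A \<Longrightarrow> s * a \<in> B \<and>
        g (s * a) = s * f a"
  shows "lattice_isotopic (arr X Y Z A B S) (arr X' Y' Z' (f ` A) (g ` B) S)"
proof -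
  \<comment> \<open>The basis is interpolated along with the positions.\<close>
  define V where "V U U' s = (1 - s) *s U + s *s U'" for U U' :: "complex^3" and s
  define a where "a s u = (1 - s) * u + s * f u" for s u
  define b where "b s u = (1 - s) * u + s * g u" for s u
  \<comment> \<open>Degenerate parameters: the basis becomes dependent, two lines of a pencil
    collide, or a new triple point appears. Each is the zero set of a polynomial that does not
    vanish at 0.\<close>
  define F where "F = {s. det3 (V X X' s) (V Y Y' s) (V Z Z' s) = 0} \<union>
    (\<Union>(u, v)\<in>{(u, v)\<in>A \<times> A. u \<noteq> v}. {s. a s u = a s v}) \<union>
    (\<Union>(u, v)\<in>{(u, v)\<in>B \<times> B. u \<noteq> v}. {s. b s u = b s v}) \<union>
    (\<Union>(w, u, v)\<in>{(w, u, v)\<in>S \<times> A \<times> B. v \<noteq> w * u}. {s. b s v = w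
        * a s u})"
  define \<beta> where "\<beta> i s = frm (V X X' s) (V Y Y' s) (V Z Z' s) (a s) (b s) i" for i s
  note pf = polynomial_fun_intros
  have pV: "polynomial_fun (\<lambda>s. V U U' s $ j)" for U U' j
    unfolding V_def by (simp, intro pf)
  have pa: "polynomial_fun (\<lambda>s. a s u)" for u
    unfolding a_def by (intro pf)
  have pb: "polynomial_fun (\<lambda>s. b s u)" for u
    unfolding b_def by (intro pf)
  have fi: "finite {(u, v)\<in>A \<times> A. u \<noteq> v}" "finite {(u, v)\<in>B \<times> B. u
      \<noteq> v}"
    "finite {(w, u, v)\<in>S \<times> A \<times> B. v \<noteq> w * u}"
    by (rule finite_subset[of _ "A \<times> A"]; use fin in auto)
      (rule finite_subset[of _ "B \<times> B"] finite_subset[of _ "S \<times> A \<times> B"]; use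
          fin in auto)+
  have a0: "a 0 u = u" "a 1 u = f u" "b 0 u = u" "b 1 u = g u" for u by (simp_all add: a_def b_def)
  have V0: "V U U' 0 = U" "V U U' 1 = U'" for U U' by (simp_all add: V_def)
  have F: "finite F"
    unfolding F_def
  proof (intro finite_UnI finite_UN_I fi; (clarify)?)
    show "finite {s. det3 (V X X' s) (V Y Y' s) (V Z Z' s) = 0}"
    proof (rule finite_zeros_polynomial_fun[where c = 0])
      show "polynomial_fun (\<lambda>s. det3 (V X X' s) (V Y Y' s) (V Z Z' s))"
        unfolding det3_def ev_3 cross_nth by (intro pf pV)
    qed (use d in \<open>simp add: V0\<close>)
    show "finite {s. a s u = a s v}" if "u \<noteq> v" for u v
      by (rule finite_coincidences[OF pa pa, where c = 0]) (use that in \<open>simp add: a0\<close>)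
    show "finite {s. b s u = b s v}" if "u \<noteq> v" for u v
      by (rule finite_coincidences[OF pb pb, where c = 0]) (use that in \<open>simp add: a0\<close>)
    show "finite {s. b s v = w * a s u}" if "v \<noteq> w * u" for u v w
      by (rule finite_coincidences[OF pb pf(5)[OF pf(1) pa], where c = 0]) (use that in \<open>simp
          add: a0\<close>)
  qed
  have F0: "0 \<notin> F" unfolding F_def using d by (auto simp: V0 a0)
  \<comment> \<open>No new triple point at the far end: \<open>w * u\<close> lies in
    \<open>B\<close> and is sent to \<open>w * f u\<close>, and \<open>g\<close> is injective on
    \<open>B\<close>.\<close>
  have ginj: "g v \<noteq> w * f u" if "w \<in> S" "u \<in> A" "v \<in> B" "v \<noteq> w * u" for u v w
    using S[of w u] inj_onD[OF inj(2), of v "w * u"] that by auto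
  have F1: "1 \<notin> F" unfolding F_def using d inj ginj by (auto simp: V0 a0 dest: inj_onD)
  have dV: "det3 (V X X' s) (V Y Y' s) (V Z Z' s) \<noteq> 0" if "s \<notin> F" for s
    using that unfolding F_def by blast
  have comp: "compatible A B S (a s) (b s)" if s: "s \<notin> F" for s
  proof -
    have "inj_on (a s) A" "inj_on (b s) B"
      using s unfolding F_def by (auto intro!: inj_onI)
    moreover have "b s v = w * a s u \<longleftrightarrow> v = w * u" if "w \<in> S" "u \<in> A" "v
        \<in> B" for u v w
    proof
      assume "v = w * u"
      then show "b s v = w * a s u" using S[of w u] that by (simp add: a_def b_def algebra_simps)
    next
      assume "b s v = w * a s u"
      then show "v = w * u" using s that by (simp add: F_def) blast
    qed
    ultimately show ?thesis using z unfolding compatible_def by (simp add: a_def b_def)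
  qed
  have pr: "cross (\<beta> i s) (\<beta> j s) \<noteq> 0"
    if "i \<in> index_set A B S" "j \<in> index_set A B S" "i \<noteq> j" "s \<notin> F" for i j s
    unfolding \<beta>_def frm_def
    by (rule cross_comb[OF cross_coords[OF comp] dV]) (use that in auto)
  have "lattice_isotopic ((\<lambda>i. form_kernel (\<beta> i 0)) ` index_set A B S) ((\<lambda>i.
      form_kernel (\<beta> i 1)) ` index_set A B S)"
  proof (rule lattice_isotopicI[OF _ _ F F0 F1])
    show "finite (index_set A B S)" using fin by (simp add: index_set_def)
    show "\<exists>p. \<forall>s. \<beta> i s $ j = poly p s" for i j
    proof -
      have "polynomial_fun (\<lambda>s. \<beta> i s $ j)"
        by (cases i) (simp_all add: \<beta>_def pf pV pa pb)
      then show ?thesis by (simp add: polynomial_fun_def)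
    qed
    show "\<beta> i s \<noteq> 0" if i: "i \<in> index_set A B S" and s: "s \<notin> F" for i s
    proof -
      have "Base \<in> index_set A B S" "First 0 \<in> index_set A B S" using z by (auto simp:
          index_set_def)
      then obtain j where "j \<in> index_set A B S" "i \<noteq> j" by (cases i) auto
      then show ?thesis using pr[OF i _ _ s] cross_nonzero_imp by blast
    qed
    show "det3 (\<beta> i s) (\<beta> j s) (\<beta> k s) = 0 \<longleftrightarrow> det3 (\<beta> i
        s') (\<beta> j s') (\<beta> k s') = 0"
      if "i \<in> index_set A B S" "j \<in> index_set A B S" "k \<in> index_set A B S" "s \<notin>
          F" "s' \<notin> F" for i j k s s'
      using det3_coords_zero_iff[OF comp[OF that(4)] that(1-3)] det3_coords_zero_iff[OF comp[OF
          that(5)] that(1-3)]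
        dV[OF that(4)] dV[OF that(5)]
      unfolding \<beta>_def frm_def det3_comb by simp
  qed (use pr in auto)
  then show ?thesis unfolding \<beta>_def image_frm V0 a0 by (simp add: a0)
qed

section \<open>Stabilisers and equivariant bijections\<close>

lemma root_of_unity_if_stabilizes:
  fixes P :: "complex set"
  assumes "finite P" "0 \<notin> P" "(*) h ` P = P" shows "h ^ card P = 1"
proof (cases "P = {}")
  case False
  then have h: "h \<noteq> 0" using assms by auto
  \<comment> \<open>Multiplication by \<open>h\<close> permutes \<open>P\<close>, so it leaves the
    product of all its elements unchanged.\<close>
  have "prod id P = prod id ((*) h ` P)" using assms(3) by simp
  also have "\<dots> = (\<Prod>x\<in>P. h * x)" using h by (subst prod.reindex) (auto simp: inj_on_def)
  also have "\<dots> = h ^ card P * prod id P" by (simp add: prod.distrib)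
  finally show ?thesis using assms by simp
qed simp

text \<open>\<open>H\<close> is a group acting freely on nonzero numbers, so all orbits have the
  same size. One orbit of \<open>P\<close> is matched with one orbit of \<open>Q\<close>, and the
  induction treats the rest.\<close>

lemma equivariant_bijection:
  fixes H P Q :: "complex set"
  assumes H: "1 \<in> H" "0 \<notin> H" "\<And>g h. g \<in> H \<Longrightarrow> h \<in> H
      \<Longrightarrow> g * h \<in> H" "\<And>h. h \<in> H \<Longrightarrow> inverse h \<in> H"
    and "finite P" "finite Q" "card P = card Q" "0 \<notin> P" "0 \<notin> Q"
    and "\<And>h x. h \<in> H \<Longrightarrow> x \<in> P \<Longrightarrow> h * x \<in> P" "\<And>h
        x. h \<in> H \<Longrightarrow> x \<in> Q \<Longrightarrow> h * x \<in> Q"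
  shows "\<exists>f. bij_betw f P Q \<and> (\<forall>h\<in>H. \<forall>x\<in>P. f (h * x) = h * f x)"
  using assms(5-)
proof (induction "card P" arbitrary: P Q rule: less_induct)
  case less
  show ?case
  proof (cases "P = {}")
    case True
    then have "Q = {}" using less.prems by simp
    then show ?thesis using True by auto
  next
    case False
    then obtain x y where x: "x \<in> P" and y: "y \<in> Q" using less.prems by (metis card.empty
        card_0_eq equals0I)
    have nz: "x \<noteq> 0" "y \<noteq> 0" using x y less.prems by auto
    define O1 where "O1 = (\<lambda>h. h * x) ` H"
    define O2 where "O2 = (\<lambda>h. h * y) ` H"
    have sub: "O1 \<subseteq> P" "O2 \<subseteq> Q" using less.prems x y by (auto simp: O1_def O2_def)
    have inj: "inj_on (\<lambda>h. h * x) H" "inj_on (\<lambda>h. h * y) H" using nz by (auto simp: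
        inj_on_def)
    have card: "card O1 = card O2" unfolding O1_def O2_def using inj by (simp add: card_image)
    have xO: "x \<in> O1" using H(1) unfolding O1_def by force
    have fin: "finite O1" "finite O2" using sub less.prems finite_subset by blast+
    have inv: "h * z \<in> (\<lambda>h. h * r) ` H \<longleftrightarrow> z \<in> (\<lambda>h. h *
        r) ` H" if h: "h \<in> H" for h z r
    proof
      have "h \<noteq> 0" using h H(2) by auto
      assume "h * z \<in> (\<lambda>h. h * r) ` H"
      then obtain g where g: "g \<in> H" "h * z = g * r" by blast
      have "z = (inverse h * g) * r" using g(2) \<open>h \<noteq> 0\<close> by (simp add: field_simps)
      then show "z \<in> (\<lambda>h. h * r) ` H" using H(3)[OF H(4)[OF h] g(1)] by blast
    next
      assume "z \<in> (\<lambda>h. h * r) ` H"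
      then obtain g where "g \<in> H" "z = g * r" by blast
      then show "h * z \<in> (\<lambda>h. h * r) ` H" using H(3)[OF h, of g] by (auto simp:
          mult.assoc intro!: image_eqI[of _ _ "h * g"])
    qed
    have "\<exists>f. bij_betw f (P - O1) (Q - O2) \<and> (\<forall>h\<in>H. \<forall>x\<in>P - O1.
        f (h * x) = h * f x)"
    proof (rule less.hyps)
      show "card (P - O1) < card P"
        using x xO less.prems by (intro psubset_card_mono) auto
      show "card (P - O1) = card (Q - O2)"
        using sub fin card less.prems by (simp add: card_Diff_subset)
      show "h * z \<in> P - O1" if "h \<in> H" "z \<in> P - O1" for h z
        using that less.prems(6) inv[of h z x] by (simp add: O1_def)
      show "h * z \<in> Q - O2" if "h \<in> H" "z \<in> Q - O2" for h z
        using that less.prems(7) inv[of h z y] by (simp add: O2_def)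
    qed (use less.prems in auto)
    then obtain f where f: "bij_betw f (P - O1) (Q - O2)" "\<And>h x. h \<in> H \<Longrightarrow> x
        \<in> P - O1 \<Longrightarrow> f (h * x) = h * f x"
      by blast
    \<comment> \<open>On the orbit of \<open>x\<close> this sends \<open>h * x\<close> to
      \<open>h * y\<close>.\<close>
    define f' where "f' z = (if z \<in> O1 then z / x * y else f z)" for z
    have "bij_betw f' (O1 \<union> (P - O1)) (O2 \<union> (Q - O2))"
    proof (rule bij_betw_combine)
      have "f' ` O1 = O2" using nz by (simp add: f'_def O1_def O2_def image_image)
      moreover have "inj_on f' O1" using nz by (auto simp: inj_on_def f'_def)
      ultimately show "bij_betw f' O1 O2" by (simp add: bij_betw_def)
      show "bij_betw f' (P - O1) (Q - O2)"
        using f(1) by (rule bij_betw_cong[THEN iffD1, rotated]) (simp add: f'_def)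
    qed auto
    then have "bij_betw f' P Q" using sub by (simp add: Un_absorb1)
    moreover have "f' (h * z) = h * f' z" if "h \<in> H" "z \<in> P" for h z
      using inv[OF that(1), of z x] f(2)[OF that(1), of z] that
      by (auto simp: f'_def O1_def[symmetric])
    ultimately show ?thesis by blast
  qed
qed

lemma finite_mu: "n \<ge> 1 \<Longrightarrow> finite (mu n)"
  and card_mu: "n \<ge> 1 \<Longrightarrow> card (mu n) = n"
  unfolding mu_def using finite_roots_unity[of n, where 'a = complex] card_roots_unity_eq[of n] by
      simp_all

lemma zero_notin_mu: "n \<ge> 1 \<Longrightarrow> 0 \<notin> mu n"
  by (simp add: mu_def power_0_left)

lemma mu_closed: "a \<in> mu n \<Longrightarrow> b \<in> mu n \<Longrightarrow> a * b \<in> mu n"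
    "a \<in> mu n \<Longrightarrow> inverse a \<in> mu n"
  "a \<in> mu n \<Longrightarrow> b \<in> mu n \<Longrightarrow> a / b \<in> mu n" "1 \<in> mu n"
  by (simp_all add: mu_def power_mult_distrib power_inverse power_divide)

text \<open>Removing 0 leaves \<open>n\<close> elements, and the factor permutes them; this is the
  origin of the exponent \<open>m - 2\<close>.\<close>

lemma stabilizer_subset_mu:
  assumes "finite A" "0 \<in> A" "card A = n + 1" "h \<noteq> 0" "(*) h ` A = A" shows "h \<in> mu n"
proof -
  have "(*) h ` (A - {0}) = A - {0}"
  proof -
    have "(*) h ` (A - {0}) = (*) h ` A - (*) h ` {0}" using assms(4) by (intro image_set_diff)
        (auto simp: inj_on_def)
    then show ?thesis using assms by simp
  qed
  then show ?thesis using root_of_unity_if_stabilizes[of "A - {0}" h] assms by (simp add: mu_def)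
qed

text \<open>\<open>f\<close> is made equivariant under the whole stabiliser of \<open>A\<close>.
  Then \<open>g\<close> is transported from \<open>f\<close> along one slope \<open>s0\<close>, and
  any other slope \<open>s\<close> fits because \<open>s / s0\<close> stabilises \<open>A\<close>.
  Without slopes, \<open>f\<close> and \<open>g\<close> are unrelated.\<close>

lemma equivariant_extensions:
  assumes n: "n \<ge> 1" and fin: "finite A" "finite B" and z: "0 \<in> A" "0 \<in> B"
    and card: "card A = n + 1" "card B = n + 1"
    and S: "S \<subseteq> mu n" "\<And>s. s \<in> S \<Longrightarrow> (*) s ` A = B"
  shows "\<exists>f g. f 0 = 0 \<and> g 0 = 0 \<and> bij_betw f A (insert 0 (mu n)) \<and> bij_betw
      g B (insert 0 (mu n)) \<and>
    (\<forall>s\<in>S. \<forall>a\<in>A. g (s * a) = s * f a)"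
proof -
  have ext: "\<exists>f. f 0 = 0 \<and> bij_betw f C (insert 0 (mu n)) \<and>
      (\<forall>h x. h \<noteq> 0 \<longrightarrow> (*) h ` C = C \<longrightarrow> x \<in> C
          \<longrightarrow> f (h * x) = h * f x)"
    if C: "finite C" "0 \<in> C" "card C = n + 1" for C
  proof -
    define H where "H = {h. h \<noteq> 0 \<and> (*) h ` C = C}"
    have Hmu: "H \<subseteq> mu n" using stabilizer_subset_mu C by (auto simp: H_def)
    have img: "(*) (g * h) ` C = (*) g ` (*) h ` C" for g h :: complex
      by (simp add: image_image mult.assoc)
    have "\<exists>f. bij_betw f (C - {0}) (mu n) \<and> (\<forall>h\<in>H. \<forall>x\<in>C - {0}.
        f (h * x) = h * f x)"
    proof (rule equivariant_bijection)
      show "g * h \<in> H" if "g \<in> H" "h \<in> H" for g h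
        using that by (simp add: H_def img)
      show "inverse h \<in> H" if "h \<in> H" for h
        using that img[of "inverse h" h] by (simp add: H_def)
      show "card (C - {0}) = card (mu n)" using C n by (simp add: card_mu)
      show "h * x \<in> C - {0}" if "h \<in> H" "x \<in> C - {0}" for h x
        using that by (auto simp: H_def)
      show "h * x \<in> mu n" if "h \<in> H" "x \<in> mu n" for h x
        using that Hmu mu_closed(1) by blast
    qed (use C n in \<open>auto simp: H_def finite_mu zero_notin_mu\<close>)
    then obtain f where f: "bij_betw f (C - {0}) (mu n)" "\<And>h x. h \<in> H \<Longrightarrow> x
        \<in> C - {0} \<Longrightarrow> f (h * x) = h * f x"
      by blast
    define f' where "f' x = (if x = 0 then 0 else f x)" for x
    have "bij_betw f' (C - {0}) (mu n)"
      using f(1) by (rule bij_betw_cong[THEN iffD1, rotated]) (simp add: f'_def)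
    then have "bij_betw f' (insert 0 (C - {0})) (insert (f' 0) (mu n))"
      using zero_notin_mu[OF n] by (subst notIn_Un_bij_betw3[symmetric, of 0, simplified]) (auto
          simp: f'_def)
    then have "bij_betw f' C (insert 0 (mu n))" using C by (simp add: insert_absorb f'_def)
    moreover have "f' (h * x) = h * f' x" if "h \<noteq> 0" "(*) h ` C = C" "x \<in> C" for h x
      using f(2)[of h x] that by (auto simp: f'_def H_def)
    ultimately show ?thesis by (intro exI[of _ f']) (auto simp: f'_def)
  qed
  obtain f where f: "f 0 = 0" "bij_betw f A (insert 0 (mu n))"
    "\<And>h x. h \<noteq> 0 \<Longrightarrow> (*) h ` A = A \<Longrightarrow> x \<in> A
        \<Longrightarrow> f (h * x) = h * f x"
    using ext[OF fin(1) z(1) card(1)] by blast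
  show ?thesis
  proof (cases "S = {}")
    case True
    then show ?thesis using f ext[OF fin(2) z(2) card(2)] by blast
  next
    case False
    then obtain s0 where s0: "s0 \<in> S" by blast
    then have s0n: "s0 \<noteq> 0" "s0 \<in> mu n" using S(1) zero_notin_mu[OF n] by auto
    define g where "g b = s0 * f (b / s0)" for b
    have "bij_betw (\<lambda>b. b / s0) B A"
      unfolding S(2)[OF s0, symmetric] using s0n by (auto simp: bij_betw_def inj_on_def image_image)
    moreover have "bij_betw ((*) s0) (insert 0 (mu n)) (insert 0 (mu n))"
    proof -
      have "(*) s0 ` mu n = mu n"
      proof
        show "mu n \<subseteq> (*) s0 ` mu n"
          using mu_closed(3)[OF _ s0n(2)] s0n(1) by (auto intro!: image_eqI[of _ _ "_ / s0"])
      qed (use mu_closed(1) s0n in auto)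
      then show ?thesis using s0n by (auto simp: bij_betw_def inj_on_def)
    qed
    ultimately have "bij_betw ((*) s0 \<circ> (f \<circ> (\<lambda>b. b / s0))) B (insert 0 (mu n))"
      using f(2) by (intro bij_betw_trans)
    then have "bij_betw g B (insert 0 (mu n))" by (simp add: g_def[abs_def] comp_def)
    moreover have "g (s * a) = s * f a" if "s \<in> S" "a \<in> A" for s a
    proof -
      have "(*) (s / s0) ` A = (\<lambda>b. b / s0) ` (*) s ` A" by (simp add: image_image)
      also have "\<dots> = A" unfolding S(2)[OF that(1)] S(2)[OF s0, symmetric] using s0n by (simp
          add: image_image)
      finally have "f (s / s0 * a) = s / s0 * f a"
        using f(3)[of "s / s0" a] that s0n S(1) zero_notin_mu[OF n] by auto
      then show ?thesis using s0n by (simp add: g_def)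
    qed
    ultimately show ?thesis using f by (intro exI[of _ f] exI[of _ g]) (auto simp: g_def)
  qed
qed

section \<open>The lines of the arrangements A(w) and A(n,1,3)\<close>

lemma proj_line_in_union:
  assumes l: "proj_line l" and "finite \<Phi>" and cov: "\<And>v. v \<in> l \<Longrightarrow>
      \<exists>a\<in>\<Phi>. ev a v = 0"
  shows "\<exists>a\<in>\<Phi>. l \<subseteq> form_kernel a"
proof -
  obtain u v where uv: "u \<in> l" "v \<in> l" "cross u v \<noteq> 0" using proj_line_spanned[OF l]
      by blast
  have sub: "u + t *s v \<in> l" for t
    using uv l unfolding proj_line_def by (intro vec.subspace_add vec.subspace_scale) auto
  have "\<forall>t. \<exists>a\<in>\<Phi>. ev a (u + t *s v) = 0" using cov sub by blast
  then obtain h where h: "\<And>t. h t \<in> \<Phi>" "\<And>t. ev (h t) (u + t *s v) = 0" by metis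
  \<comment> \<open>Pigeonhole: infinitely many parameters, finitely many forms. A form that
    vanishes at two of these points vanishes on the whole line.\<close>
  have "\<not> inj h"
    using h(1) \<open>finite \<Phi>\<close> infinite_UNIV_char_0[where 'a = complex]
    by (metis finite_imageD finite_subset image_subsetI)
  then obtain s t where st: "s \<noteq> t" "h s = h t" unfolding inj_def by blast
  have "(s - t) * ev (h s) v = ev (h s) (u + s *s v) - ev (h s) (u + t *s v)"
    by (simp add: algebra_simps)
  moreover have "ev (h s) (u + t *s v) = 0" unfolding st(2) by (rule h(2))
  ultimately have "(s - t) * ev (h s) v = 0"
    using h(2)[of s] by (simp del: ev_linear)
  then have "ev (h s) v = 0" using st by simp
  moreover from this have "ev (h s) u = 0" using h(2)[of s] by simp
  ultimately have "vec.span {u, v} \<subseteq> form_kernel (h s)"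
    by (intro vec.span_minimal subspace_form_kernel) (simp add: form_kernel_eq)
  then show ?thesis
    using proj_line_through[OF l uv] form_kernel_cross[OF uv(3)] h(1) by blast
qed

lemma arrangement_of_eq:
  assumes "finite \<Phi>" "0 \<notin> \<Phi>" "\<And>v. f v = 0 \<longleftrightarrow>
      (\<exists>a\<in>\<Phi>. ev a v = 0)"
  shows "arrangement_of f = form_kernel ` \<Phi>"
proof (rule subset_antisym)
  show "arrangement_of f \<subseteq> form_kernel ` \<Phi>"
  proof
    fix l assume "l \<in> arrangement_of f"
    then have l: "proj_line l" "\<And>v. v \<in> l \<Longrightarrow> f v = 0" by (auto simp:
        arrangement_of_def)
    then obtain a where a: "a \<in> \<Phi>" "l \<subseteq> form_kernel a"
      using proj_line_in_union[OF l(1) assms(1)] assms(3) by blast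
    then have "a \<noteq> 0" using assms(2) by blast
    then have "l = form_kernel a"
      using proj_line_subset_eq[OF l(1) proj_line_form_kernel a(2)] by blast
    then show "l \<in> form_kernel ` \<Phi>" using a by blast
  qed
  show "form_kernel ` \<Phi> \<subseteq> arrangement_of f"
  proof
    fix l assume "l \<in> form_kernel ` \<Phi>"
    then obtain a where a: "a \<in> \<Phi>" "l = form_kernel a" by blast
    then have "a \<noteq> 0" using assms(2) by blast
    then have "proj_line l" using a proj_line_form_kernel by simp
    moreover have "f v = 0" if "v \<in> l" for v
      using that a unfolding assms(3)[of v] in_form_kernel by (simp add: in_form_kernel) blast
    ultimately show "l \<in> arrangement_of f" by (simp add: arrangement_of_def)
  qed
qed

lemma power_eq_iff_mu:
  assumes "n \<ge> 1" shows "x ^ n = y ^ n \<longleftrightarrow> (\<exists>a\<in>mu n. y = a * x)"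
proof
  assume e: "x ^ n = y ^ n"
  show "\<exists>a\<in>mu n. y = a * x"
  proof (cases "x = 0")
    case True
    then have "y = 0" using e assms by (simp add: power_0_left)
    then show ?thesis using True mu_closed(4) by (intro bexI[of _ 1]) auto
  next
    case False
    then have "y / x \<in> mu n" using e by (simp add: mu_def power_divide flip: e)
    then show ?thesis using False by (intro bexI[of _ "y / x"]) auto
  qed
qed (auto simp: mu_def power_mult_distrib)

abbreviation e1 :: "complex^3" where "e1 \<equiv> axis 1 1"
abbreviation e2 :: "complex^3" where "e2 \<equiv> axis 2 1"
abbreviation e3 :: "complex^3" where "e3 \<equiv> axis 3 1"

lemma ev_axis: "ev e1 v = v$1" "ev e2 v = v$2" "ev e3 v = v$3"
  by (simp_all add: ev_3 axis_def)

lemma det3_axis: "det3 e1 e2 e3 = 1"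
  by (simp add: vec3_simps axis_def)

text \<open>One computation for both families of arrangements, which differ only in the lines
  \<open>z = s y\<close>; for this reason the equation enters through its zero set alone.\<close>

lemma arr_axis_eq_arrangement_of:
  assumes n: "n \<ge> 1" and "finite S" and
    f: "\<And>v. f v = 0 \<longleftrightarrow> v$1 = 0 \<or> v$2 = 0 \<or> v$3 = 0 \<or> (v$1)^n =
        (v$2)^n \<or> (v$1)^n = (v$3)^n \<or>
      (\<exists>s\<in>S. v$3 = s * v$2)"
  shows "arrangement_of f = arr e1 e2 e3 (insert 0 (mu n)) (insert 0 (mu n)) S"
proof -
  define \<Phi> where "\<Phi> = insert e1 ((\<lambda>u. e2 - u *s e1) ` insert 0 (mu n) \<union>
    (\<lambda>u. e3 - u *s e1) ` insert 0 (mu n) \<union> (\<lambda>s. e3 - s *s e2) ` S)"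
  have "arrangement_of f = form_kernel ` \<Phi>"
  proof (rule arrangement_of_eq)
    show "finite \<Phi>" unfolding \<Phi>_def using n assms(2) by (simp add: finite_mu)
    show "0 \<notin> \<Phi>" unfolding \<Phi>_def by (auto simp: vec3_eq_iff axis_def)
    show "f v = 0 \<longleftrightarrow> (\<exists>a\<in>\<Phi>. ev a v = 0)" for v
      unfolding \<Phi>_def f power_eq_iff_mu[OF n] by (simp add: ev_axis bex_Un) blast
  qed
  also have "form_kernel ` \<Phi> = arr e1 e2 e3 (insert 0 (mu n)) (insert 0 (mu n)) S"
    unfolding \<Phi>_def arr_def by (simp only: image_insert image_Un image_image)
  finally show ?thesis .
qed

lemma tuple_arrangement_eq:
  assumes "n \<ge> 1"
  shows "tuple_arrangement n w = arr e1 e2 e3 (insert 0 (mu n)) (insert 0 (mu n)) (set w)"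
  unfolding tuple_arrangement_def
  by (rule arr_axis_eq_arrangement_of[OF assms])
    (auto simp: Let_def in_set_conv_nth)

lemma full_monomial_eq:
  assumes "n \<ge> 1"
  shows "full_monomial n = arr e1 e2 e3 (insert 0 (mu n)) (insert 0 (mu n)) (mu n)"
  unfolding full_monomial_def
  by (rule arr_axis_eq_arrangement_of[OF assms finite_mu[OF assms]])
    (auto simp: Let_def power_eq_iff_mu[OF assms])

section \<open>Changes of coordinates and the normal form\<close>

lemma arr_rescale:
  assumes "c \<noteq> 0" "d \<noteq> 0"
  shows "arr X (c *s Y) (d *s Z) ((*) c ` A) ((*) d ` B) ((*) (d / c) ` S) = arr X Y Z A B S"
proof -
  have "c *s Y - (c * u) *s X = c *s (Y - u *s X)" "d *s Z - (d * u) *s X = d *s (Z - u *s X)"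
    "d *s Z - (d / c * u) *s (c *s Y) = d *s (Z - u *s Y)" for u
    using assms by (simp_all add: vec3_eq_iff algebra_simps)
  then show ?thesis using assms
    unfolding arr_def image_image by (simp only: form_kernel_scale not_False_eq_True)
qed

text \<open>Exchanging the two pencils inverts the slopes. This is the inversion in
  \<open>G\<close>, just as rescaling the pencils yields the translations.\<close>

lemma arr_swap:
  assumes "0 \<notin> S"
  shows "arr X Z Y B A (inverse ` S) = arr X Y Z A B S"
proof -
  have "form_kernel (Y - inverse s *s Z) = form_kernel (Z - s *s Y)" if "s \<in> S" for s
  proof -
    have s: "s \<noteq> 0" using that assms by auto
    then have eq: "Y - inverse s *s Z = (- inverse s) *s (Z - s *s Y)"
      by (simp add: vec3_eq_iff algebra_simps)
    show ?thesis unfolding eq by (rule form_kernel_scale) (use s in simp)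
  qed
  then have "(\<lambda>s. form_kernel (Y - inverse s *s Z)) ` S = (\<lambda>s. form_kernel (Z - s
      *s Y)) ` S"
    by (intro image_cong) auto
  then show ?thesis unfolding arr_def image_image by (simp add: Un_commute)
qed

lemma arr_translate:
  assumes "\<And>s. s \<in> S \<Longrightarrow> s * a = b"
  shows "arr X (Y - a *s X) (Z - b *s X) ((\<lambda>u. u - a) ` A) ((\<lambda>u. u - b) ` B) S =
      arr X Y Z A B S"
proof -
  have "Y - a *s X - (u - a) *s X = Y - u *s X" "Z - b *s X - (u - b) *s X = Z - u *s X" for u
    by (simp_all add: vec3_eq_iff algebra_simps)
  moreover have "Z - b *s X - s *s (Y - a *s X) = Z - s *s Y" if "s \<in> S" for s
    unfolding assms[OF that, symmetric] by (simp add: vec3_eq_iff algebra_simps)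
  then have "(\<lambda>s. form_kernel (Z - b *s X - s *s (Y - a *s X))) ` S = (\<lambda>s.
      form_kernel (Z - s *s Y)) ` S"
    by (intro image_cong) (simp_all only:)
  ultimately show ?thesis unfolding arr_def image_image by (simp only:)
qed

text \<open>The arrangement seen from two points on the line \<open>X\<close>, each of multiplicity
  \<open>n + 2\<close> with \<open>X\<close> included. The condition \<open>slopes\<close> is what
  modularity of both points yields for a line \<open>z = s y\<close>, and 0 in \<open>A\<close> and
  \<open>B\<close> says that the common point of these lines lies on the grid.\<close>

locale normal_form =
  fixes X Y Z :: "complex^3" and A B S :: "complex set" and n :: nat
  assumes basis: "det3 X Y Z \<noteq> 0" and n_pos: "n \<ge> 1"
    and fin: "finite A" "finite B" "finite S"
    and zero: "0 \<in> A" "0 \<in> B" "0 \<notin> S"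
    and card: "card A = n + 1" "card B = n + 1"
    and slopes: "\<And>s. s \<in> S \<Longrightarrow> (*) s ` A = B"
begin

lemma rescale:
  assumes "c \<noteq> 0" "d \<noteq> 0"
  shows "normal_form X (c *s Y) (d *s Z) ((*) c ` A) ((*) d ` B) ((*) (d / c) ` S) n"
proof
  have inj: "inj_on ((*) e) T" if "e \<noteq> 0" for e :: complex and T using that by (auto simp:
      inj_on_def)
  show "det3 X (c *s Y) (d *s Z) \<noteq> 0" using basis assms by (simp add: det3_linear)
  show "card ((*) c ` A) = n + 1" "card ((*) d ` B) = n + 1"
    using card inj assms by (simp_all add: card_image)
  show "(*) s ` (*) c ` A = (*) d ` B" if "s \<in> (*) (d / c) ` S" for s
  proof -
    obtain r where r: "r \<in> S" "s = d / c * r" using \<open>s \<in> _\<close> by blast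
    show ?thesis unfolding slopes[OF r(1), symmetric] r(2) image_image
      using assms by (intro image_cong) auto
  qed
qed (use n_pos fin zero assms in \<open>auto intro!: image_eqI[of 0 _ 0]\<close>)

lemma swap: "normal_form X Z Y B A (inverse ` S) n"
proof
  show "det3 X Z Y \<noteq> 0" using basis det3_swap(2)[of X Z Y] by simp
  show "(*) s ` B = A" if s: "s \<in> inverse ` S" for s
  proof -
    obtain r where r: "r \<in> S" "s = inverse r" using s by blast
    have "r \<noteq> 0" using r zero by auto
    then show ?thesis unfolding slopes[OF r(1), symmetric] r(2) image_image by (simp flip: mult.assoc)
  qed
qed (use n_pos fin zero card in auto)

lemma slope_ratio_in_mu:
  assumes "s \<in> S" "t \<in> S" shows "s / t \<in> mu n"
proof (rule stabilizer_subset_mu)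
  have "s \<noteq> 0" "t \<noteq> 0" using assms zero by auto
  then show "s / t \<noteq> 0" by simp
  have "(*) (s / t) ` A = (\<lambda>b. b / t) ` (*) s ` A" by (simp add: image_image)
  also have "\<dots> = A"
    unfolding slopes[OF assms(1)] slopes[OF assms(2), symmetric] using \<open>t \<noteq> 0\<close>
        by (simp add: image_image)
  finally show "(*) (s / t) ` A = A" .
qed (use fin zero card in auto)

text \<open>Dividing by one slope embeds \<open>S\<close> into the \<open>n\<close>-th roots of
  unity; this is the bound on \<open>k\<close> in the theorem.\<close>

lemma card_slopes_le: "card S \<le> n"
proof (cases "S = {}")
  case False
  then obtain t where t: "t \<in> S" by blast
  then have "t \<noteq> 0" using zero by auto
  then have "card S = card ((\<lambda>s. s / t) ` S)" by (subst card_image) (auto simp: inj_on_def)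
  also have "\<dots> \<le> card (mu n)"
    using slope_ratio_in_mu[OF _ t] finite_mu[OF n_pos] by (intro card_mono) auto
  finally show ?thesis using card_mu[OF n_pos] by simp
qed simp

lemma isotopic_standard:
  assumes "S \<subseteq> mu n"
  shows "lattice_isotopic (arr X Y Z A B S) (arr e1 e2 e3 (insert 0 (mu n)) (insert 0 (mu n)) S)"
proof -
  obtain f g where fg: "f 0 = 0" "g 0 = 0" "bij_betw f A (insert 0 (mu n))" "bij_betw g B (insert 0
      (mu n))"
    "\<And>s a. s \<in> S \<Longrightarrow> a \<in> A \<Longrightarrow> g (s * a) = s * f a"
    using equivariant_extensions[OF n_pos fin(1,2) zero(1,2) card assms slopes] by blast
  have "s * a \<in> B" if "s \<in> S" "a \<in> A" for s a
    using slopes[OF that(1)] that(2) by blast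
  then have "lattice_isotopic (arr X Y Z A B S) (arr e1 e2 e3 (f ` A) (g ` B) S)"
    using basis fin zero fg slopes by (intro arr_lattice_isotopic) (auto simp: bij_betw_def det3_axis)
  then show ?thesis using fg by (simp add: bij_betw_def)
qed

lemma frm_inj: "inj_on (\<lambda>i. form_kernel (frm X Y Z id id i)) (index_set A B S)"
  using form_kernel_eq_imp_cross cross_comb[OF cross_coords[OF compatible_id[OF zero]] basis]
  unfolding frm_def by (intro inj_onI) blast

lemma arr_eq_image: "arr X Y Z A B S = (\<lambda>i. form_kernel (frm X Y Z id id i)) ` index_set A B S"
  by (simp add: image_frm)

lemma finite_index: "finite (index_set A B S)"
  using fin by (simp add: index_set_def)

text \<open>One line \<open>X\<close>, two pencils of \<open>n + 1\<close> further lines, and the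
  rest. The number of lines thus recovers the number of slopes, which an isotopy must
  preserve.\<close>

lemma card_arr: "card (arr X Y Z A B S) = 2 * n + 3 + card S"
proof -
  have "card (index_set A B S) = Suc (card (First ` A \<union> Second ` B \<union> Third ` S))"
    unfolding index_set_def using fin by (subst card_insert_disjoint) auto
  also have "card (First ` A \<union> Second ` B \<union> Third ` S) = card (First ` A) + card
      (Second ` B) + card (Third ` S)"
    using fin by (subst card_Un_disjoint; auto)+
  also have "\<dots> = 2 * n + 2 + card S"
    using card by (simp add: card_image inj_on_def)
  finally show ?thesis unfolding arr_eq_image using frm_inj by (simp add: card_image)
qed

lemma frm_nonzero: "i \<in> index_set A B S \<Longrightarrow> frm X Y Z id id i \<noteq> 0"
proof -
  assume i: "i \<in> index_set A B S"
  have "Base \<in> index_set A B S" "First 0 \<in> index_set A B S" using zero by (auto simp: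
      index_set_def)
  then obtain j where "j \<in> index_set A B S" "i \<noteq> j" by (cases i) auto
  then show "frm X Y Z id id i \<noteq> 0"
    using cross_comb[OF cross_coords[OF compatible_id[OF zero] i] basis] cross_nonzero_imp(1)
    unfolding frm_def by blast
qed

lemma line_arrangement_arr: "line_arrangement (arr X Y Z A B S)"
  unfolding line_arrangement_def arr_eq_image
  using finite_index frm_nonzero proj_line_form_kernel by auto

lemma card_lines_through:
  "card {l \<in> arr X Y Z A B S. v \<in> l} = card {i \<in> index_set A B S. ev (frm X Y Z id id
      i) v = 0}"
proof -
  have "{l \<in> arr X Y Z A B S. v \<in> l} =
    (\<lambda>i. form_kernel (frm X Y Z id id i)) ` {i \<in> index_set A B S. ev (frm X Y Z id id
        i) v = 0}"
    unfolding arr_eq_image by (auto simp: in_form_kernel)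
  then show ?thesis
    using card_image[OF inj_on_subset[OF frm_inj]] by (metis (no_types, lifting) mem_Collect_eq subsetI)
qed

text \<open>Away from the vertices of the triangle \<open>X\<close>, \<open>Y\<close>,
  \<open>Z\<close>, at most one line of each family passes through a point; on \<open>X\<close>
  these are at most \<open>X\<close> itself and one \<open>Third\<close> line.\<close>

lemma multiplicity_off_vertices:
  assumes "\<not> (ev X v = 0 \<and> ev Y v = 0)" "\<not> (ev X v = 0 \<and> ev Z v = 0)" "\<not>
      (ev Y v = 0 \<and> ev Z v = 0)"
  shows "card {l \<in> arr X Y Z A B S. v \<in> l} \<le> (if ev X v = 0 then 2 else 3)"
proof (cases "ev X v = 0")
  case True
  have "{i \<in> index_set A B S. ev (frm X Y Z id id i) v = 0} \<subseteq> {Base, Third (ev Z v /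
      ev Y v)}"
    using assms True by (auto simp: index_set_def field_simps)
  then have "card {i \<in> index_set A B S. ev (frm X Y Z id id i) v = 0} \<le> card {Base, Third
      (ev Z v / ev Y v)}"
    by (intro card_mono) auto
  then show ?thesis using True by (simp add: card_lines_through)
next
  case False
  \<comment> \<open>If \<open>ev Y v = 0\<close>, the last quotient is 0 by convention; no
    \<open>Third\<close> line passes through \<open>v\<close> in that case.\<close>
  let ?T = "{First (ev Y v / ev X v), Second (ev Z v / ev X v), Third (ev Z v / ev Y v)}"
  have "{i \<in> index_set A B S. ev (frm X Y Z id id i) v = 0} \<subseteq> ?T"
    using assms False by (auto simp: index_set_def field_simps)
  then have "card {i \<in> index_set A B S. ev (frm X Y Z id id i) v = 0} \<le> card ?T"
    by (intro card_mono) auto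
  then show ?thesis using False by (simp add: card_lines_through)
qed

lemma multiplicity_centre:
  assumes "ev X v \<noteq> 0" "ev Y v = 0" "ev Z v = 0"
  shows "card {l \<in> arr X Y Z A B S. v \<in> l} = card S + 2"
proof -
  have "{i \<in> index_set A B S. ev (frm X Y Z id id i) v = 0} = insert (First 0) (insert (Second
      0) (Third ` S))"
    using assms zero by (auto simp: index_set_def)
  moreover have "card (insert (First 0) (insert (Second 0) (Third ` S))) = card S + 2"
    using fin by (simp add: card_insert_disjoint image_iff card_image inj_on_def)
  ultimately show ?thesis by (simp add: card_lines_through)
qed

end

section \<open>Modular points\<close>

lemma multiplicity_at_span:
  assumes "line_arrangement A" shows "multiplicity_at A (vec.span {u}) = card {l \<in> A. u \<in> l}"
proof -
  have "{l \<in> A. vec.span {u} \<subseteq> l} = {l \<in> A. u \<in> l}"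
    using assms span_subset_line unfolding line_arrangement_def by blast
  then show ?thesis by (simp add: multiplicity_at_def)
qed

lemma intersection_points_span_iff:
  assumes "line_arrangement A" "u \<noteq> 0"
  shows "vec.span {u} \<in> intersection_points A \<longleftrightarrow> 2 \<le> card {l \<in> A. u
      \<in> l}"
proof -
  have "proj_point (vec.span {u})" using assms(2) unfolding proj_point_iff by blast
  then show ?thesis using multiplicity_at_span[OF assms(1)] by (simp add: intersection_points_def)
qed

lemma span_two_points: "vec.span (vec.span {u} \<union> vec.span {v}) = vec.span {u, v :: complex^3}"
proof (rule subset_antisym)
  have "vec.span {u} \<union> vec.span {v} \<subseteq> vec.span {u, v}"
    using vec.span_mono[of "{u}" "{u, v}"] vec.span_mono[of "{v}" "{u, v}"] by simp
  then show "vec.span (vec.span {u} \<union> vec.span {v}) \<subseteq> vec.span {u, v}"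
    by (intro vec.span_minimal vec.subspace_span)
  have "u \<in> vec.span {u}" "v \<in> vec.span {v}" by (simp_all add: vec.span_base)
  then show "vec.span {u, v} \<subseteq> vec.span (vec.span {u} \<union> vec.span {v})"
    by (intro vec.span_mono) simp
qed

text \<open>Asking for some line of the arrangement through both points, instead of for their span,
  also covers a point that coincides with \<open>u\<close>: being an intersection point, it lies on
  lines of the arrangement anyway.\<close>

lemma modular_points_span_iff:
  assumes A: "line_arrangement A" and u: "u \<noteq> 0"
  shows "vec.span {u} \<in> modular_points A \<longleftrightarrow> 2 \<le> card {l \<in> A. u \<in>
      l} \<and>
    (\<forall>v. v \<noteq> 0 \<longrightarrow> 2 \<le> card {l \<in> A. v \<in> l}
        \<longrightarrow> (\<exists>l\<in>A. u \<in> l \<and> v \<in> l))"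
proof -
  have join: "(vec.span {v} \<noteq> vec.span {u} \<longrightarrow> vec.span (vec.span {u} \<union>
      vec.span {v}) \<in> A) \<longleftrightarrow>
      (\<exists>l\<in>A. u \<in> l \<and> v \<in> l)" if v: "v \<noteq> 0" and m: "2 \<le> card {l
          \<in> A. v \<in> l}" for v
  proof (cases "cross u v = 0")
    case True
    then have eq: "vec.span {u} = vec.span {v}" using span_singleton_eq_iff[OF u v] by simp
    have "{l \<in> A. v \<in> l} \<noteq> {}" using m by force
    then obtain l where l: "l \<in> A" "v \<in> l" by blast
    then have "proj_line l" using A by (simp add: line_arrangement_def)
    then have "u \<in> l" using l span_subset_line[of l u] span_subset_line[of l v] eq by simp
    then show ?thesis using eq l by auto
  next
    case False
    then have ne: "vec.span {v} \<noteq> vec.span {u}" using span_singleton_eq_iff[OF u v] by auto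
    have k: "vec.span (vec.span {u} \<union> vec.span {v}) = form_kernel (cross u v)"
      unfolding span_two_points using form_kernel_cross[OF False] by simp
    show ?thesis
    proof
      assume "vec.span {v} \<noteq> vec.span {u} \<longrightarrow> vec.span (vec.span {u} \<union>
          vec.span {v}) \<in> A"
      then have "form_kernel (cross u v) \<in> A" using ne k by simp
      then show "\<exists>l\<in>A. u \<in> l \<and> v \<in> l" by (rule bexI[rotated]) (simp add:
          in_form_kernel)
    next
      assume "\<exists>l\<in>A. u \<in> l \<and> v \<in> l"
      then obtain l where l: "l \<in> A" "u \<in> l" "v \<in> l" by blast
      then have "l = form_kernel (cross u v)"
        using A False by (intro proj_line_through) (auto simp: line_arrangement_def)
      then show "vec.span {v} \<noteq> vec.span {u} \<longrightarrow> vec.span (vec.span {u}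
          \<union> vec.span {v}) \<in> A"
        using k l by simp
    qed
  qed
  have all: "(\<forall>q\<in>intersection_points A. q \<noteq> vec.span {u} \<longrightarrow>
      vec.span (vec.span {u} \<union> q) \<in> A) \<longleftrightarrow>
     (\<forall>v. v \<noteq> 0 \<longrightarrow> 2 \<le> card {l \<in> A. v \<in> l}
         \<longrightarrow> (\<exists>l\<in>A. u \<in> l \<and> v \<in> l))"
  proof (intro iffI allI impI ballI)
    fix v assume "\<forall>q\<in>intersection_points A. q \<noteq> vec.span {u} \<longrightarrow>
        vec.span (vec.span {u} \<union> q) \<in> A"
      and v: "v \<noteq> 0" "2 \<le> card {l \<in> A. v \<in> l}"
    then have "vec.span {v} \<noteq> vec.span {u} \<longrightarrow> vec.span (vec.span {u} \<union>
        vec.span {v}) \<in> A"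
      using intersection_points_span_iff[OF A v(1)] by blast
    then show "\<exists>l\<in>A. u \<in> l \<and> v \<in> l" using join[OF v] by blast
  next
    fix q assume r: "\<forall>v. v \<noteq> 0 \<longrightarrow> 2 \<le> card {l \<in> A. v \<in> l}
        \<longrightarrow> (\<exists>l\<in>A. u \<in> l \<and> v \<in> l)"
      and q: "q \<in> intersection_points A" "q \<noteq> vec.span {u}"
    then have "proj_point q" by (simp add: intersection_points_def)
    then obtain v where v: "v \<noteq> 0" "q = vec.span {v}" unfolding proj_point_iff by blast
    then have m: "2 \<le> card {l \<in> A. v \<in> l}" using q(1) intersection_points_span_iff[OF A
        v(1)] by simp
    then show "vec.span (vec.span {u} \<union> q) \<in> A" using join[OF v(1) m] r v q(2) by blast
  qed
  show ?thesis
    using all intersection_points_span_iff[OF A u] unfolding modular_points_def by simp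
qed

lemma modular_point_obtain:
  assumes "p \<in> modular_points A" obtains u where "u \<noteq> 0" "p = vec.span {u}"
  using assms unfolding modular_points_def intersection_points_def proj_point_iff by blast

lemma span_cross_eq:
  assumes "cross X Y \<noteq> 0" "u \<noteq> 0" "ev X u = 0" "ev Y u = 0"
  shows "vec.span {u} = vec.span {cross X Y}"
proof -
  have "cross u (cross X Y) = ev Y u *s X - ev X u *s Y"
    by (simp add: vec3_simps algebra_simps)
  then show ?thesis using assms span_singleton_eq_iff by simp
qed

text \<open>Injectivity and equal cardinality make the affine map a bijection. The last equation is
  the barycentre relation cleared of denominators.\<close>

lemma affine_image_sum:
  fixes s t :: complex
  assumes "finite A" "card A = card B" "finite B" "s \<noteq> 0" "\<And>a. a \<in> A
      \<Longrightarrow> s * a + t \<in> B"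
  shows "(\<lambda>a. s * a + t) ` A = B" "s * \<Sum>A + of_nat (card A) * t = \<Sum>B"
proof -
  have inj: "inj_on (\<lambda>a. s * a + t) A" using assms(4) by (auto simp: inj_on_def)
  show im: "(\<lambda>a. s * a + t) ` A = B"
    using assms inj by (intro card_subset_eq) (auto simp: card_image)
  have "\<Sum>B = (\<Sum>a\<in>A. s * a + t)" unfolding im[symmetric] using inj by (simp add:
      sum.reindex)
  then show "s * \<Sum>A + of_nat (card A) * t = \<Sum>B" by (simp add: sum.distrib sum_distrib_left)
qed

lemma pencil_inj:
  assumes "cross X U \<noteq> 0"
  shows "inj (\<lambda>a. form_kernel (U - a *s X))" "form_kernel X \<noteq> form_kernel (U - a *s X)"
proof -
  show "inj (\<lambda>a. form_kernel (U - a *s X))"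
  proof (rule injI)
    fix a b assume "form_kernel (U - a *s X) = form_kernel (U - b *s X)"
    then have "cross (U - a *s X) (U - b *s X) = 0" by (rule form_kernel_eq_imp_cross)
    moreover have "cross (U - a *s X) (U - b *s X) = (b - a) *s cross X U"
      by (simp add: vec3_simps algebra_simps)
    ultimately show "a = b" using assms by simp
  qed
  have "cross X (U - a *s X) = cross X U" by (simp add: vec3_simps algebra_simps)
  then show "form_kernel X \<noteq> form_kernel (U - a *s X)"
    using form_kernel_eq_imp_cross[of X "U - a *s X"] assms by auto
qed

lemma normal_form_exists:
  assumes A: "line_arrangement A" and n: "n \<ge> 1"
    and p: "p \<in> modular_points A" and q: "q \<in> modular_points A" and pq: "p \<noteq> q"
    and mp: "multiplicity_at A p = n + 2" and mq: "multiplicity_at A q = n + 2"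
  shows "\<exists>X Y Z P Q S. normal_form X Y Z P Q S n \<and> A = arr X Y Z P Q S \<and>
    p = vec.span {cross X Y} \<and> q = vec.span {cross X Z}"
proof -
  obtain u where u: "u \<noteq> 0" "p = vec.span {u}" using modular_point_obtain[OF p] .
  obtain v where v: "v \<noteq> 0" "q = vec.span {v}" using modular_point_obtain[OF q] .
  have finA: "finite A" and linA: "\<And>l. l \<in> A \<Longrightarrow> proj_line l" using A by
      (auto simp: line_arrangement_def)
  have cu: "card {l \<in> A. u \<in> l} = n + 2" using mp multiplicity_at_span[OF A] u by simp
  have cv: "card {l \<in> A. v \<in> l} = n + 2" using mq multiplicity_at_span[OF A] v by simp
  have two: "2 \<le> card {l \<in> A. w \<in> l}" if "l1 \<in> A" "l2 \<in> A" "l1 \<noteq> l2" "w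
      \<in> l1" "w \<in> l2" for w l1 l2
  proof -
    have "card {l1, l2} \<le> card {l \<in> A. w \<in> l}" using that finA by (intro card_mono) auto
    then show ?thesis using that by simp
  qed
  have mu: "\<exists>l\<in>A. u \<in> l \<and> w \<in> l" if "w \<noteq> 0" "2 \<le> card {l \<in>
      A. w \<in> l}" for w
    using p modular_points_span_iff[OF A u(1)] that unfolding u(2) by blast
  have mv: "\<exists>l\<in>A. v \<in> l \<and> w \<in> l" if "w \<noteq> 0" "2 \<le> card {l \<in>
      A. w \<in> l}" for w
    using q modular_points_span_iff[OF A v(1)] that unfolding v(2) by blast
  have uv: "cross u v \<noteq> 0" using pq u v span_singleton_eq_iff by metis
  define X where "X = cross u v"
  \<comment> \<open>\<open>e\<close> is a point off the line \<open>X\<close>, and \<open>Y\<close>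
    and \<open>Z\<close> join it to the two modular points. The scaling \<open>ev X e = 1\<close>
    gives \<open>ev Y v\<close> and \<open>ev Z u\<close> the value 1.\<close>
  obtain e where e: "ev X e = 1" using ev_nondegenerate[OF uv] unfolding X_def by blast
  define Y where "Y = cross e u"
  define Z where "Z = cross v e"
  have e': "ev Y v = ev X e" "ev Z u = ev X e"
    unfolding X_def Y_def Z_def by (simp_all add: vec3_simps algebra_simps)
  have XYZ: "ev X u = 0" "ev X v = 0" "ev Y u = 0" "ev Z v = 0" "ev Y v = 1" "ev Z u = 1"
    using e e' by (simp_all add: X_def Y_def Z_def)
  have "cross Y Z = - (ev X e) *s e"
    unfolding X_def Y_def Z_def by (simp add: vec3_simps algebra_simps)
  then have d: "det3 X Y Z = -1" unfolding det3_def by (simp only: ev_linear e) simp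
  then have d0: "det3 X Y Z \<noteq> 0" by simp
  have ker: "form_kernel (c *s b) = form_kernel b" if "c \<noteq> 0" for b c by (rule
      form_kernel_scale[OF that])
  \<comment> \<open>Sorts the lines by the coefficients of their form in the basis \<open>X\<close>,
    \<open>Y\<close>, \<open>Z\<close>.\<close>
  have class0: "(l = form_kernel X \<and> u \<in> l \<and> v \<in> l) \<or> (\<exists>a. l =
      form_kernel (Y - a *s X) \<and> u \<in> l \<and> v \<notin> l) \<or>
      (\<exists>s t. l = form_kernel (Z - s *s Y - t *s X) \<and> u \<notin> l \<and> (v \<in> l
          \<longleftrightarrow> s = 0))" if lA: "l \<in> A" for l
  proof -
    obtain b where b: "b \<noteq> 0" "l = form_kernel b" using linA[OF lA] proj_line_iff by blast
    obtain x y z where xyz: "b = x *s X + y *s Y + z *s Z" using basis_combination[OF d0] by blast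
    consider "z = 0" "y = 0" | "z = 0" "y \<noteq> 0" | "z \<noteq> 0" by blast
    then show ?thesis
    proof cases
      case 1
      then have "b = x *s X" "x \<noteq> 0" using xyz b by auto
      then show ?thesis using b ker XYZ by (simp add: in_form_kernel)
    next
      case 2
      then have "b = y *s (Y - (- x / y) *s X)" using xyz by (simp add: vec3_eq_iff field_simps)
      then have "l = form_kernel (Y - (- x / y) *s X)" using b(2) ker[OF 2(2)] by (simp only:)
      moreover from this have "u \<in> l" "v \<notin> l" using XYZ by (simp_all add: in_form_kernel)
      ultimately show ?thesis by blast
    next
      case 3
      then have "b = z *s (Z - (- y / z) *s Y - (- x / z) *s X)" using xyz by (simp add:
          vec3_eq_iff field_simps)
      then have "l = form_kernel (Z - (- y / z) *s Y - (- x / z) *s X)" using b(2) ker[OF 3] by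
          (simp only:)
      moreover from this have "u \<notin> l" "v \<in> l \<longleftrightarrow> - y / z = 0" using
          XYZ by (simp_all add: in_form_kernel)
      ultimately show ?thesis by blast
    qed
  qed
  have XA: "form_kernel X \<in> A"
  proof -
    obtain l where "l \<in> A" "u \<in> l" "v \<in> l" using mu[of v] v cv by auto
    then show ?thesis using proj_line_through[OF linA _ _ uv] by (simp add: X_def)
  qed
  define P where "P = {a. form_kernel (Y - a *s X) \<in> A}"
  define Q where "Q = {b. form_kernel (Z - b *s X) \<in> A}"
  \<comment> \<open>Slope and intercept of each line through neither modular point; the intercepts
    disappear later, when the origin is moved.\<close>
  define E where "E = {(s, t). s \<noteq> 0 \<and> form_kernel (Z - s *s Y - t *s X) \<in> A}"
  have lu: "{l \<in> A. u \<in> l} = insert (form_kernel X) ((\<lambda>a. form_kernel (Y - a *s X))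
      ` P)"
  proof -
    have "u \<in> form_kernel X" "u \<in> form_kernel (Y - a *s X)" for a using XYZ by (simp_all
        add: in_form_kernel)
    moreover have "l = form_kernel X \<or> (\<exists>a\<in>P. l = form_kernel (Y - a *s X))" if "l
        \<in> A" "u \<in> l" for l
      using class0[OF that(1)] that unfolding P_def by blast
    ultimately show ?thesis using XA unfolding P_def by blast
  qed
  have lv: "{l \<in> A. v \<in> l} = insert (form_kernel X) ((\<lambda>b. form_kernel (Z - b *s X))
      ` Q)"
  proof -
    have "v \<in> form_kernel X" "v \<in> form_kernel (Z - a *s X)" for a using XYZ by (simp_all
        add: in_form_kernel)
    moreover have "l = form_kernel X \<or> (\<exists>b\<in>Q. l = form_kernel (Z - b *s X))" if l:
        "l \<in> A" "v \<in> l" for l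
      using class0[OF l(1)] l(2)
    proof (elim disjE exE conjE)
      fix s t assume st: "l = form_kernel (Z - s *s Y - t *s X)" "(v \<in> l) = (s = 0)"
      then have "s = 0" using l(2) by blast
      then have "l = form_kernel (Z - t *s X)" using st(1) by simp
      then show ?thesis using l unfolding Q_def by blast
    qed auto
    ultimately show ?thesis using XA unfolding Q_def by blast
  qed
  have cXY: "cross X Y \<noteq> 0" "cross X Z \<noteq> 0" using det3_nonzero_imp_cross[OF d0] by auto
  note injP = pencil_inj(1)[OF cXY(1)] and nP = pencil_inj(2)[OF cXY(1)]
    and injQ = pencil_inj(1)[OF cXY(2)] and nQ = pencil_inj(2)[OF cXY(2)]
  have finP: "finite P" "finite Q"
    using finite_imageD[OF _ inj_on_subset[OF injP subset_UNIV], of P]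
      finite_imageD[OF _ inj_on_subset[OF injQ subset_UNIV], of Q] finA
    unfolding P_def Q_def by (auto intro: finite_subset[OF _ finA])
  have cardP: "card P = n + 1"
    using cu unfolding lu using finP nP card_image[OF inj_on_subset[OF injP subset_UNIV], of P]
    by (subst (asm) card_insert_disjoint) auto
  have cardQ: "card Q = n + 1"
    using cv unfolding lv using finP nQ card_image[OF inj_on_subset[OF injQ subset_UNIV], of Q]
    by (subst (asm) card_insert_disjoint) auto
  have pt: "\<exists>w. w \<noteq> 0 \<and> ev X w = 1 \<and> ev Y w = y \<and> ev Z w = z" for y z
    using basis_solve[OF d0, of 1 y z] ev_linear(8)[of X] by (metis zero_neq_one)
  \<comment> \<open>Such a line meets a line of the first pencil in an intersection point, which
    modularity of \<open>q\<close> joins to \<open>q\<close> by a line of the arrangement.\<close>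
  have toQ: "s * a + t \<in> Q" if st: "(s, t) \<in> E" and a: "a \<in> P" for s t a
  proof -
    obtain w where w: "w \<noteq> 0" "ev X w = 1" "ev Y w = a" "ev Z w = s * a + t" using pt by blast
    have "u \<in> form_kernel (Y - a *s X)" "u \<notin> form_kernel (Z - s *s Y - t *s X)"
      using XYZ by (simp_all add: in_form_kernel)
    then have ne: "form_kernel (Y - a *s X) \<noteq> form_kernel (Z - s *s Y - t *s X)" by blast
    have "2 \<le> card {l \<in> A. w \<in> l}"
      by (rule two[OF _ _ ne]) (use st a w in \<open>simp_all add: P_def E_def in_form_kernel\<close>)
    then obtain l where "l \<in> A" "v \<in> l" "w \<in> l" using mv[OF w(1)] by blast
    moreover from this have "l \<noteq> form_kernel X" using w by (auto simp: in_form_kernel)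
    ultimately obtain b where "b \<in> Q" "w \<in> form_kernel (Z - b *s X)" using lv by blast
    then show ?thesis using w by (simp add: in_form_kernel)
  qed
  \<comment> \<open>Two lines of different slope meet in an intersection point off \<open>X\<close>,
    which modularity of \<open>p\<close> joins to \<open>p\<close> by a line of the
    arrangement.\<close>
  have toP: "(t' - t) / (s - s') \<in> P" if st: "(s, t) \<in> E" "(s', t') \<in> E" "s \<noteq>
      s'" for s t s' t'
  proof -
    let ?y = "(t' - t) / (s - s')"
    obtain w where w: "w \<noteq> 0" "ev X w = 1" "ev Y w = ?y" "ev Z w = s * ?y + t" using pt by blast
    have y: "s * ?y + t = s' * ?y + t'"
    proof -
      have "(s - s') * ?y = t' - t" using st(3) by simp
      then show ?thesis by (simp only: left_diff_distrib) (simp add: algebra_simps)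
    qed
    obtain r where r: "ev X r = 0" "ev Y r = 1" "ev Z r = s" using basis_solve[OF d0] by blast
    have "r \<in> form_kernel (Z - s *s Y - t *s X)" "r \<notin> form_kernel (Z - s' *s Y - t' *s X)"
      using r st(3) by (simp_all add: in_form_kernel)
    then have ne: "form_kernel (Z - s *s Y - t *s X) \<noteq> form_kernel (Z - s' *s Y - t' *s X)"
        by blast
    have "w \<in> form_kernel (Z - s *s Y - t *s X)" using w by (simp add: in_form_kernel)
    moreover have "w \<in> form_kernel (Z - s' *s Y - t' *s X)" using w(2,3) w(4)[unfolded y] by
        (simp add: in_form_kernel)
    ultimately have "2 \<le> card {l \<in> A. w \<in> l}"
      using st by (intro two[OF _ _ ne]) (simp_all add: E_def)
    then obtain l where "l \<in> A" "u \<in> l" "w \<in> l" using mu[OF w(1)] by blast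
    moreover from this have "l \<noteq> form_kernel X" using w by (auto simp: in_form_kernel)
    ultimately obtain b where "b \<in> P" "w \<in> form_kernel (Y - b *s X)" using lu by blast
    then show ?thesis using w by (simp add: in_form_kernel)
  qed
  have aff: "(\<lambda>a. s * a + t) ` P = Q" "s * \<Sum>P + of_nat (n + 1) * t = \<Sum>Q" if "(s,
      t) \<in> E" for s t
    using affine_image_sum[of P Q s t] finP cardP cardQ toQ[OF that] that by (auto simp: E_def)
  have n1: "(of_nat (n + 1) :: complex) \<noteq> 0" using of_nat_neq_0 by auto
  \<comment> \<open>The barycentre relation determines the intercept from the slope, so no two of
    these lines meet on \<open>X\<close>.\<close>
  have uniq: "t = t'" if "(s, t) \<in> E" "(s, t') \<in> E" for s t t'
  proof -
    have "of_nat (n + 1) * t = of_nat (n + 1) * t'" using aff(2)[OF that(1)] aff(2)[OF that(2)] by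
        (metis add_left_imp_eq)
    then show ?thesis using n1 by simp
  qed
  \<comment> \<open>A grid point common to all lines in \<open>E\<close>. With two lines it is the
    pair of barycentres, on the grid by \<open>toP\<close> and \<open>toQ\<close>; with one line any
    of its grid points will do, and with none any grid point.\<close>
  have "\<exists>a b. a \<in> P \<and> b \<in> Q \<and> (\<forall>s t. (s, t) \<in> E
      \<longrightarrow> b = s * a + t)"
  proof (cases "\<exists>s t s' t'. (s, t) \<in> E \<and> (s', t') \<in> E \<and> (s, t) \<noteq>
      (s', t')")
    case True
    then obtain s t s' t' where st: "(s, t) \<in> E" "(s', t') \<in> E" "(s, t) \<noteq> (s', t')"
        by blast
    then have ne: "s \<noteq> s'" using uniq by blast
    define a where "a = \<Sum>P / of_nat (n + 1)"
    define b where "b = \<Sum>Q / of_nat (n + 1)"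
    have all: "b = s * a + t" if "(s, t) \<in> E" for s t
      using aff(2)[OF that] n1 unfolding a_def b_def by (simp add: field_simps)
    have "(s - s') * a = t' - t" using all[OF st(1)] all[OF st(2)] by (simp add: algebra_simps)
    then have "a = (t' - t) / (s - s')" using ne by (simp add: field_simps)
    then have "a \<in> P" using toP[OF st(1,2) ne] by simp
    moreover have "b \<in> Q" using toQ[OF st(1) \<open>a \<in> P\<close>] all[OF st(1)] by simp
    ultimately show ?thesis using all by (intro exI[of _ a] exI[of _ b]) simp
  next
    case False
    obtain a where a: "a \<in> P" using cardP by fastforce
    show ?thesis
    proof (cases "E = {}")
      case True
      obtain b where "b \<in> Q" using cardQ by fastforce
      then show ?thesis using a True by blast
    next
      case nonempty: False
      then obtain s t where st: "(s, t) \<in> E" by auto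
      then have "E = {(s, t)}" using False by auto
      then show ?thesis using toQ[OF st a] a by (intro exI[of _ a] exI[of _ "s * a + t"]) simp
    qed
  qed
  then obtain a0 b0 where a0: "a0 \<in> P" and b0: "b0 \<in> Q" and E0: "\<And>s t. (s, t) \<in> E
      \<Longrightarrow> b0 = s * a0 + t"
    by blast
  define Y' where "Y' = Y - a0 *s X"
  define Z' where "Z' = Z - b0 *s X"
  define P' where "P' = (\<lambda>a. a - a0) ` P"
  define Q' where "Q' = (\<lambda>b. b - b0) ` Q"
  define S where "S = fst ` E"
  have SE: "s \<in> S \<longleftrightarrow> (s, b0 - s * a0) \<in> E" for s
    using E0[of s] by (force simp: S_def)
  have slopes: "(*) s ` P' = Q'" if "s \<in> S" for s
  proof -
    have "(s, b0 - s * a0) \<in> E" using SE that by blast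
    from aff(1)[OF this] show ?thesis
      unfolding P'_def Q'_def image_image by (auto simp: image_image algebra_simps)
  qed
  have finP': "finite P'" "finite Q'" using finP by (simp_all add: P'_def Q'_def)
  have cardP': "card P' = n + 1" "card Q' = n + 1"
    using cardP cardQ by (simp_all add: P'_def Q'_def card_image inj_on_def)
  have zero: "0 \<in> P'" "0 \<in> Q'" using a0 b0 unfolding P'_def Q'_def by force+
  have finS: "finite S"
  proof -
    \<comment> \<open>A slope is recovered from its value at one nonzero \<open>r\<close> of
      \<open>P'\<close>; positivity of \<open>n\<close> provides such an \<open>r\<close>.\<close>
    have "P' \<noteq> {0}" using cardP' n by auto
    then obtain r where r: "r \<in> P'" "r \<noteq> 0" using zero by blast
    have "(\<lambda>s. s * r) ` S \<subseteq> Q'" using slopes r by blast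
    then have "finite ((\<lambda>s. s * r) ` S)" using finP' finite_subset by blast
    then show ?thesis using r by (rule_tac finite_imageD) (auto simp: inj_on_def)
  qed
  have nf: "normal_form X Y' Z' P' Q' S n"
  proof
    have "det3 X Y' Z' = det3 X Y Z"
      unfolding Y'_def Z'_def by (simp add: vec3_simps algebra_simps)
    then show "det3 X Y' Z' \<noteq> 0" using d0 by simp
    show "0 \<notin> S" by (auto simp: S_def E_def)
  qed (use n finP' finS zero cardP' slopes in auto)
  have lineE: "Z' - s *s Y' = Z - s *s Y - (b0 - s * a0) *s X" for s
    by (simp add: Y'_def Z'_def vec3_eq_iff algebra_simps)
  have lineP: "Y' - (a - a0) *s X = Y - a *s X" "Z' - (b - b0) *s X = Z - b *s X" for a b
    by (simp_all add: Y'_def Z'_def vec3_eq_iff algebra_simps)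
  have "A = arr X Y' Z' P' Q' S"
  proof (rule subset_antisym)
    have "arr X Y' Z' P' Q' S = insert (form_kernel X) ((\<lambda>a. form_kernel (Y - a *s X)) ` P
        \<union>
        (\<lambda>b. form_kernel (Z - b *s X)) ` Q \<union> (\<lambda>s. form_kernel (Z - s *s Y -
            (b0 - s * a0) *s X)) ` S)"
      unfolding arr_def P'_def Q'_def image_image lineE lineP ..
    note arr_eq = this
    show "arr X Y' Z' P' Q' S \<subseteq> A"
      unfolding arr_eq using XA SE by (auto simp: P_def Q_def E_def)
    show "A \<subseteq> arr X Y' Z' P' Q' S"
    proof
      fix l assume l: "l \<in> A"
      show "l \<in> arr X Y' Z' P' Q' S"
      proof (cases "u \<in> l \<or> v \<in> l")
        case True
        then have "l \<in> {l \<in> A. u \<in> l} \<union> {l \<in> A. v \<in> l}" using l by blast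
        then show ?thesis unfolding arr_eq lu lv by blast
      next
        case False
        then obtain s t where st: "l = form_kernel (Z - s *s Y - t *s X)" "s \<noteq> 0"
          using class0[OF l] by blast
        then have "(s, t) \<in> E" using l by (simp add: E_def)
        then have "s \<in> S" "t = b0 - s * a0" using E0[of s t] by (force simp: S_def)+
        then show ?thesis unfolding arr_eq using st by blast
      qed
    qed
  qed
  moreover have "p = vec.span {cross X Y'}" "q = vec.span {cross X Z'}"
  proof -
    have "cross X Y' = cross X Y" "cross X Z' = cross X Z"
      by (simp_all add: Y'_def Z'_def vec3_simps algebra_simps)
    then show "p = vec.span {cross X Y'}" "q = vec.span {cross X Z'}"
      using span_cross_eq[OF cXY(1) u(1)] span_cross_eq[OF cXY(2) v(1)] XYZ u v by simp_all
  qed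
  ultimately show ?thesis using nf by blast
qed

lemma span_eq_imp_ev_zero_iff:
  assumes "vec.span {u} = vec.span {v :: complex^3}" shows "ev b u = 0 \<longleftrightarrow> ev b v = 0"
proof -
  have "u \<in> vec.span {v}" "v \<in> vec.span {u}" using assms vec.span_base[of u "{u}"]
      vec.span_base[of v "{v}"] by auto
  then show ?thesis by (auto simp: vec.span_singleton)
qed

section \<open>Counting the modular points\<close>

context normal_form
begin

lemma translate:
  assumes "a \<in> A" "b \<in> B" "\<And>s. s \<in> S \<Longrightarrow> s * a = b"
  shows "normal_form X (Y - a *s X) (Z - b *s X) ((\<lambda>u. u - a) ` A) ((\<lambda>u. u - b) `
      B) S n"
proof
  have "det3 X (Y - a *s X) (Z - b *s X) = det3 X Y Z" by (simp add: vec3_simps algebra_simps)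
  then show "det3 X (Y - a *s X) (Z - b *s X) \<noteq> 0" using basis by simp
  show "(*) s ` (\<lambda>u. u - a) ` A = (\<lambda>u. u - b) ` B" if s: "s \<in> S" for s
    unfolding slopes[OF s, symmetric] image_image assms(3)[OF s, symmetric] by (simp add: algebra_simps)
  show "card ((\<lambda>u. u - a) ` A) = n + 1" "card ((\<lambda>u. u - b) ` B) = n + 1"
    using card by (simp_all add: card_image inj_on_def)
  show "0 \<in> (\<lambda>u. u - a) ` A" "0 \<in> (\<lambda>u. u - b) ` B" using assms(1,2) by force+
qed (use n_pos fin zero in auto)

lemma vertices_nonzero: "cross X Y \<noteq> 0" "cross X Z \<noteq> 0" "cross Y Z \<noteq> 0"
  using det3_nonzero_imp_cross[OF basis] by auto

lemma ev_vertices: "ev Z (cross X Y) \<noteq> 0" "ev Y (cross X Z) \<noteq> 0" "ev X (cross Y Z)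
    \<noteq> 0"
proof -
  have "ev Z (cross X Y) = det3 X Y Z" "ev Y (cross X Z) = - det3 X Y Z" "ev X (cross Y Z) = det3 X Y Z"
    by (simp_all add: vec3_simps algebra_simps)
  then show "ev Z (cross X Y) \<noteq> 0" "ev Y (cross X Z) \<noteq> 0" "ev X (cross Y Z) \<noteq>
      0" using basis by auto
qed

text \<open>The point to control lies on one line of each pencil, at nonzero positions. The
  \<open>n\<close> slopes send the first position to \<open>n\<close> distinct elements of
  \<open>B - {0}\<close>, hence to all of them, so some \<open>Third\<close> line, which passes
  through the centre, contains the point.\<close>

lemma centre_modular:
  assumes "card S = n" shows "vec.span {cross Y Z} \<in> modular_points (arr X Y Z A B S)"
proof -
  let ?u = "cross Y Z"
  have "card {l \<in> arr X Y Z A B S. ?u \<in> l} = card S + 2"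
    using ev_vertices by (intro multiplicity_centre) simp_all
  moreover have "\<exists>l\<in>arr X Y Z A B S. ?u \<in> l \<and> v \<in> l"
    if v: "2 \<le> card {l \<in> arr X Y Z A B S. v \<in> l}" for v
  proof -
    let ?x = "ev X v" and ?y = "ev Y v" and ?z = "ev Z v"
    define T where "T = {i \<in> index_set A B S. ev (frm X Y Z id id i) v = 0}"
    have T: "2 \<le> card T" using v unfolding card_lines_through T_def .
    have "?y = 0 \<or> ?z = 0 \<or> (\<exists>s\<in>S. ?z = s * ?y)"
    proof (rule ccontr)
      assume "\<not> ?thesis"
      then have yz: "?y \<noteq> 0" "?z \<noteq> 0" and ns: "\<And>s. s \<in> S \<Longrightarrow>
          ?z \<noteq> s * ?y" by auto
      show False
      proof (cases "?x = 0")
        case True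
        then have "T \<subseteq> {Base}" using yz ns by (auto simp: T_def index_set_def)
        then have "card T \<le> card {Base}" by (intro card_mono) auto
        then show False using T by simp
      next
        case False
        let ?a = "?y / ?x" and ?b = "?z / ?x"
        have sub: "T \<subseteq> {First ?a, Second ?b}"
          using False yz ns by (auto simp: T_def index_set_def field_simps)
        then have "T = {First ?a, Second ?b}" using T by (intro card_seteq) auto
        then have ab: "?a \<in> A" "?b \<in> B" by (auto simp: T_def index_set_def)
        have im: "(\<lambda>s. s * ?a) ` S = B - {0}"
        proof (rule card_subset_eq)
          show "(\<lambda>s. s * ?a) ` S \<subseteq> B - {0}"
          proof
            fix r assume "r \<in> (\<lambda>s. s * ?a) ` S"
            then obtain s where s: "s \<in> S" "r = s * ?a" by blast
            then have "s \<noteq> 0" using zero by auto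
            moreover have "s * ?a \<in> B" using slopes[OF s(1)] ab(1) by blast
            ultimately show "r \<in> B - {0}" using s yz False by simp
          qed
          show "card ((\<lambda>s. s * ?a) ` S) = card (B - {0})"
            using yz False assms card zero fin by (subst card_image) (auto simp: inj_on_def)
        qed (use fin in auto)
        have "?b \<in> B - {0}" using ab yz False by simp
        then obtain s where "s \<in> S" "?b = s * ?a" unfolding im[symmetric] by blast
        then show False using ns[of s] False by simp
      qed
    qed
    then consider "?y = 0" | "?z = 0" | s where "s \<in> S" "?z = s * ?y" by blast
    then show ?thesis
    proof cases
      case 1
      then have "?u \<in> form_kernel (Y - 0 *s X)" "v \<in> form_kernel (Y - 0 *s X)" by (simp_all
          add: in_form_kernel)
      then show ?thesis using zero unfolding arr_def by blast
    next
      case 2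
      then have "?u \<in> form_kernel (Z - 0 *s X)" "v \<in> form_kernel (Z - 0 *s X)" by (simp_all
          add: in_form_kernel)
      then show ?thesis using zero unfolding arr_def by blast
    next
      case (3 s)
      then have "?u \<in> form_kernel (Z - s *s Y)" "v \<in> form_kernel (Z - s *s Y)" by (simp_all
          add: in_form_kernel)
      then show ?thesis using 3 unfolding arr_def by blast
    qed
  qed
  ultimately show ?thesis
    unfolding modular_points_span_iff[OF line_arrangement_arr vertices_nonzero(3)] by simp
qed

text \<open>Only the triangle vertices can reach multiplicity \<open>n + 2\<close>, except for
  \<open>n = 1\<close>, where an ordinary triple point already does.\<close>

lemma maximal_multiplicity_cases:
  assumes "v \<noteq> 0" "n + 2 \<le> card {l \<in> arr X Y Z A B S. v \<in> l}"
  obtains "ev X v = 0" "ev Y v = 0" | "ev X v = 0" "ev Z v = 0"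
  | "ev Y v = 0" "ev Z v = 0" "card S = n"
  | "n = 1" "ev X v \<noteq> 0" "ev Y v \<noteq> 0" "ev Y v / ev X v \<in> A" "ev Z v / ev X v
      \<in> B" "ev Z v / ev Y v \<in> S"
proof (cases "ev Y v = 0 \<and> ev Z v = 0")
  case True
  then have "ev X v \<noteq> 0" using basis_eq_0[OF basis] assms(1) by blast
  then have "n + 2 \<le> card S + 2" using multiplicity_centre[of v] True assms(2) by simp
  then show ?thesis using True card_slopes_le that(3) by auto
next
  case False
  show ?thesis
  proof (cases "ev X v = 0 \<and> (ev Y v = 0 \<or> ev Z v = 0)")
    case True
    then show ?thesis using that(1,2) by blast
  next
    case nv: False
    then have "n + 2 \<le> (if ev X v = 0 then 2 else 3)"
      using multiplicity_off_vertices[of v] assms(2) False by auto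
    then have n1: "n = 1" and x: "ev X v \<noteq> 0" using n_pos by (auto split: if_splits)
    let ?T = "{First (ev Y v / ev X v), Second (ev Z v / ev X v), Third (ev Z v / ev Y v)}"
    define T where "T = {i \<in> index_set A B S. ev (frm X Y Z id id i) v = 0}"
    have cT: "3 \<le> card T" using assms(2) n1 unfolding card_lines_through T_def by simp
    have sub: "T \<subseteq> ?T" using False x by (auto simp: T_def index_set_def field_simps)
    then have eq: "T = ?T" using cT by (intro card_seteq) auto
    then have in_T: "First (ev Y v / ev X v) \<in> T" "Second (ev Z v / ev X v) \<in> T" "Third (ev
        Z v / ev Y v) \<in> T"
      by auto
    then have "ev Y v / ev X v \<in> A" "ev Z v / ev X v \<in> B" "ev Z v / ev Y v \<in> S"
      by (auto simp: T_def index_set_def)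
    moreover have "ev Y v \<noteq> 0" using in_T(3) False by (auto simp: T_def)
    ultimately show ?thesis using that(4) n1 x by blast
  qed
qed

text \<open>Homogeneity confines the modular points to the points of multiplicity
  \<open>n + 2\<close>. The centre has this multiplicity exactly when all \<open>n\<close> slopes
  occur.\<close>

lemma card_modular_points:
  assumes hom: "\<And>r. r \<in> modular_points (arr X Y Z A B S) \<Longrightarrow> multiplicity_at
      (arr X Y Z A B S) r = n + 2"
    and p: "vec.span {cross X Y} \<in> modular_points (arr X Y Z A B S)"
    and q: "vec.span {cross X Z} \<in> modular_points (arr X Y Z A B S)"
  shows "card S < n \<Longrightarrow> card (modular_points (arr X Y Z A B S)) = 2"
    and "card S = n \<Longrightarrow> n \<ge> 2 \<Longrightarrow> card (modular_points (arr X Y Z A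
        B S)) = 3"
    and "card S = n \<Longrightarrow> n = 1 \<Longrightarrow> card (modular_points (arr X Y Z A B
        S)) = 4"
proof -
  let ?M = "modular_points (arr X Y Z A B S)"
  let ?p = "vec.span {cross X Y}" and ?q = "vec.span {cross X Z}" and ?o = "vec.span {cross Y Z}"
  note sp = span_eq_imp_ev_zero_iff
  have ne: "?p \<noteq> ?q" "?p \<noteq> ?o" "?q \<noteq> ?o"
    using sp[of "cross X Y" "cross X Z" Y] sp[of "cross X Y" "cross Y Z" X] sp[of "cross X Z"
        "cross Y Z" X]
      ev_vertices by auto
  have cases: "r = ?p \<or> r = ?q \<or> (r = ?o \<and> card S = n) \<or>
      (n = 1 \<and> (\<exists>v. r = vec.span {v} \<and> v \<noteq> 0 \<and> ev X v \<noteq> 0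
          \<and> ev Y v \<noteq> 0 \<and> ev Y v / ev X v \<in> A \<and>
        ev Z v / ev X v \<in> B \<and> ev Z v / ev Y v \<in> S))" if r: "r \<in> ?M" for r
  proof -
    obtain v where v: "v \<noteq> 0" "r = vec.span {v}" using modular_point_obtain[OF r] .
    have "n + 2 \<le> card {l \<in> arr X Y Z A B S. v \<in> l}"
      using hom[OF r] multiplicity_at_span[OF line_arrangement_arr] v(2) by simp
    then show ?thesis
      by (rule maximal_multiplicity_cases[OF v(1)])
        (use span_cross_eq[OF vertices_nonzero(1) v(1)] span_cross_eq[OF vertices_nonzero(2) v(1)]
          span_cross_eq[OF vertices_nonzero(3) v(1)] v in auto)
  qed
  show "card ?M = 2" if "card S < n"
  proof -
    \<comment> \<open>Without slopes the exceptional triple points for \<open>n = 1\<close> do not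
      occur.\<close>
    have "S = {}" if "n = 1" using \<open>card S < n\<close> that fin by simp
    then have "?M = {?p, ?q}" using cases p q that by fastforce
    then show ?thesis using ne by simp
  qed
  show "card ?M = 3" if "card S = n" "n \<ge> 2"
  proof -
    have "?M = {?p, ?q, ?o}" using cases p q centre_modular[OF that(1)] that by fastforce
    then show ?thesis using ne by simp
  qed
  show "card ?M = 4" if c: "card S = n" and n1: "n = 1"
  proof -
    \<comment> \<open>For \<open>n = 1\<close> the fourth point is the grid point at positions
      \<open>a\<close> and \<open>s * a\<close>. Moved to the origin, it becomes the centre of
      another normal form of the same arrangement, so \<open>centre_modular\<close> applies to
      it.\<close>
    obtain s where s: "S = {s}" using c n1 card_1_singletonE by metis
    have "card (A - {0}) = 1" using card n1 fin zero by simp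
    then obtain a where a: "A - {0} = {a}" using card_1_singletonE by metis
    then have a': "a \<in> A" "a \<noteq> 0" by auto
    have sa: "s * a \<in> B" using slopes[of s] s a' by blast
    define Y' where "Y' = Y - a *s X"
    define Z' where "Z' = Z - (s * a) *s X"
    interpret t: normal_form X Y' Z' "(\<lambda>u. u - a) ` A" "(\<lambda>u. u - s * a) ` B" S n
      unfolding Y'_def Z'_def by (rule translate[OF a'(1) sa]) (simp add: s)
    have arr_eq: "arr X Y' Z' ((\<lambda>u. u - a) ` A) ((\<lambda>u. u - s * a) ` B) S = arr X Y Z
        A B S"
      unfolding Y'_def Z'_def by (rule arr_translate) (simp add: s)
    let ?r = "vec.span {cross Y' Z'}"
    have r: "?r \<in> ?M" using t.centre_modular[OF c] unfolding arr_eq .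
    have ev_r: "ev X (cross Y' Z') \<noteq> 0" "ev Y (cross Y' Z') \<noteq> 0"
    proof -
      show x: "ev X (cross Y' Z') \<noteq> 0" by (rule t.ev_vertices)
      have "ev (Y' + a *s X) (cross Y' Z') = a * ev X (cross Y' Z')" by simp
      moreover have "Y' + a *s X = Y" by (simp add: Y'_def)
      ultimately show "ev Y (cross Y' Z') \<noteq> 0" using x a'(2) by simp
    qed
    have ner: "?r \<noteq> ?p" "?r \<noteq> ?q" "?r \<noteq> ?o"
      using sp[of "cross Y' Z'" "cross X Y" X] sp[of "cross Y' Z'" "cross X Z" X] sp[of "cross Y'
          Z'" "cross Y Z" Y]
        ev_r by auto
    have fourth: "x = ?r" if x: "x = vec.span {v}" "v \<noteq> 0" "ev X v \<noteq> 0" "ev Y v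
        \<noteq> 0" "ev Y v / ev X v \<in> A"
       "ev Z v / ev Y v \<in> S" for x v
    proof -
      have "ev Y v / ev X v \<in> A - {0}" using x by simp
      then have y: "ev Y v = a * ev X v" using a x(3) by (simp add: field_simps)
      have z: "ev Z v = s * ev Y v" using s x by (simp add: field_simps)
      have "ev Y' v = 0" "ev Z' v = 0" using y z by (simp_all add: Y'_def Z'_def)
      then show ?thesis using span_cross_eq[OF t.vertices_nonzero(3) x(2)] x(1) by simp
    qed
    have "?M \<subseteq> {?p, ?q, ?o, ?r}"
    proof
      fix x assume "x \<in> ?M"
      from cases[OF this] show "x \<in> {?p, ?q, ?o, ?r}"
        by (elim disjE exE conjE) (use fourth in \<open>simp_all\<close>)
    qed
    then have "?M = {?p, ?q, ?o, ?r}" using p q r centre_modular[OF c] by blast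
    then show ?thesis using ne ner by auto
  qed
qed

end

section \<open>Rigidity of the slope ratios\<close>

text \<open>Both maps send the barycentre \<open>c\<close> of \<open>P\<close> to the same point, so
  after centring at \<open>c\<close> the quotient of their slopes permutes the nonzero elements.
  Their number depends on whether \<open>c\<close> lies in \<open>P\<close>; only the bound on
  \<open>N\<close> matters later.\<close>

lemma affine_ratio_root_of_unity:
  fixes P :: "complex set"
  assumes P: "finite P" "2 \<le> card P" and nz: "\<sigma> \<noteq> 0" "\<sigma>' \<noteq> 0"
    and im: "(\<lambda>u. \<sigma> * u + \<tau>) ` P = Q" "(\<lambda>u. \<sigma>' * u + \<tau>') `
        P = Q"
  shows "\<exists>N\<in>{1..card P}. (\<sigma>' / \<sigma>) ^ N = 1"
proof -
  have finQ: "finite Q" using im(1) P by auto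
  have cardQ: "card P = card Q"
    unfolding im(1)[symmetric] using nz by (subst card_image) (auto simp: inj_on_def)
  have n0: "(of_nat (card P) :: complex) \<noteq> 0" using P(2) by auto
  define c where "c = \<Sum>P / of_nat (card P)"
  have "\<sigma> * \<Sum>P + of_nat (card P) * \<tau> = \<Sum>Q" "\<sigma>' * \<Sum>P + of_nat
      (card P) * \<tau>' = \<Sum>Q"
    using affine_image_sum(2)[OF P(1) cardQ finQ nz(1), of \<tau>] affine_image_sum(2)[OF P(1)
        cardQ finQ nz(2), of \<tau>'] im
    by auto
  then have c: "\<sigma> * c + \<tau> = \<sigma>' * c + \<tau>'"
    unfolding c_def using n0 by (simp add: field_simps)
  define R where "R = (\<lambda>u. u - c) ` P - {0}"
  have finR: "finite R" using P(1) by (simp add: R_def)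
  have "(*) (\<sigma>' / \<sigma>) ` R \<subseteq> R"
  proof
    fix x assume "x \<in> (*) (\<sigma>' / \<sigma>) ` R"
    then obtain v where v: "v \<in> R" "x = \<sigma>' / \<sigma> * v" by blast
    then obtain u where u: "u \<in> P" "u - c \<noteq> 0" "x = \<sigma>' / \<sigma> * (u - c)"
        unfolding R_def by blast
    then have "\<sigma>' * u + \<tau>' \<in> (\<lambda>u. \<sigma> * u + \<tau>) ` P" using im by blast
    then obtain w where w: "w \<in> P" "\<sigma>' * u + \<tau>' = \<sigma> * w + \<tau>" by blast
    have "\<sigma>' * (u - c) = (\<sigma>' * u + \<tau>') - (\<sigma>' * c + \<tau>')" by (simp
        add: algebra_simps)
    also have "\<dots> = \<sigma> * (w - c)" unfolding w(2) c[symmetric] by (simp add: algebra_simps)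
    finally have eq: "\<sigma>' * (u - c) = \<sigma> * (w - c)" .
    have "x = \<sigma>' * (u - c) / \<sigma>" using u(3) by simp
    then have "x = w - c" unfolding eq using nz by simp
    moreover have "x \<noteq> 0" using u nz by simp
    ultimately show "x \<in> R" using w(1) by (simp add: R_def)
  qed
  then have "(*) (\<sigma>' / \<sigma>) ` R = R"
    using nz finR by (intro card_subset_eq) (auto simp: card_image inj_on_def)
  then have "(\<sigma>' / \<sigma>) ^ card R = 1"
    using finR by (intro root_of_unity_if_stabilizes) (auto simp: R_def)
  moreover have "card R \<le> card P"
    unfolding R_def using P(1) by (meson Diff_subset card_image_le card_mono finite_imageI le_trans)
  moreover have "R \<noteq> {}"
  proof
    assume "R = {}"
    then have "P \<subseteq> {c}" unfolding R_def by auto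
    then have "card P \<le> card {c}" by (intro card_mono) auto
    then show False using P(2) by simp
  qed
  then have "1 \<le> card R" using finR by (simp add: Suc_le_eq card_gt_0_iff)
  ultimately show ?thesis by (intro bexI[of _ "card R"]) auto
qed

text \<open>
  The cross ratio, on the line \<open>X = 0\<close>, of its intersections with \<open>Y\<close>,
      \<open>Z\<close>, \<open>T\<close> and \<open>T'\<close>.
\<close>

definition slope_ratio :: "complex^3 \<Rightarrow> complex^3 \<Rightarrow> complex^3 \<Rightarrow>
    complex^3 \<Rightarrow> complex^3 \<Rightarrow> complex" where
  "slope_ratio X Y Z T T' = (det3 T' X Z * det3 T X Y) / (det3 T' X Y * det3 T X Z)"

text \<open>A plane fixes its form only up to a scalar, so the ratio must not see these
  scalars.\<close>

lemma slope_ratio_scale: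
  assumes "x \<noteq> 0" "y \<noteq> 0" "z \<noteq> 0" "p \<noteq> 0" "q \<noteq> 0"
  shows "slope_ratio (x *s X) (y *s Y) (z *s Z) (p *s T) (q *s T') = slope_ratio X Y Z T T'"
  using assms by (simp add: slope_ratio_def det3_linear)

lemma slope_ratio_eq:
  assumes "det3 X Y Z \<noteq> 0" "\<sigma> \<noteq> 0"
  shows "slope_ratio X Y Z (Z - \<sigma> *s Y - \<tau> *s X) (Z - \<sigma>' *s Y - \<tau>' *s X) =
      \<sigma>' / \<sigma>"
proof -
  have "det3 (Z - s *s Y - t *s X) X Z = s * det3 X Y Z" "det3 (Z - s *s Y - t *s X) X Y = det3 X Y
      Z" for s t
    by (simp_all add: vec3_simps algebra_simps)
  then show ?thesis using assms by (simp add: slope_ratio_def)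
qed

lemma det3_zero_scale:
  assumes "a \<noteq> 0" "a' \<noteq> 0" "form_kernel a = form_kernel a'" "b \<noteq> 0" "b'
      \<noteq> 0" "form_kernel b = form_kernel b'"
    "c \<noteq> 0" "c' \<noteq> 0" "form_kernel c = form_kernel c'"
  shows "det3 a b c = 0 \<longleftrightarrow> det3 a' b' c' = 0"
proof -
  obtain x y z where "x \<noteq> 0" "a' = x *s a" "y \<noteq> 0" "b' = y *s b" "z \<noteq> 0" "c' =
      z *s c"
    using assms form_kernel_eq_iff by metis
  then show ?thesis by (simp add: det3_linear)
qed

section \<open>Slope quotients along an isotopy\<close>

lemma continuous_det3:
  assumes "continuous_on T f" "continuous_on T g" "continuous_on T h"
  shows "continuous_on T (\<lambda>t. det3 (f t) (g t) (h t))"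
  unfolding det3_def ev_3 cross_nth by (intro continuous_intros assms)

lemma pencil_coordinate:
  assumes "cross U V \<noteq> 0" "cross U V' \<noteq> 0" "det3 U V V' = 0"
  shows "\<exists>y a. y \<noteq> 0 \<and> V' = y *s (V - a *s U)"
proof -
  obtain x y where xy: "V' = x *s U + y *s V"
    using assms(3) det3_zero_iff_span[OF assms(1)] span_insert_iff by blast
  have "y \<noteq> 0"
  proof
    assume "y = 0"
    then have "cross U V' = 0" unfolding xy by (simp add: vec3_simps algebra_simps)
    then show False using assms by blast
  qed
  moreover from this have "V' = y *s (V - (- x / y) *s U)" using xy by (simp add: vec3_eq_iff
      field_simps)
  ultimately show ?thesis by blast
qed

text \<open>An isotopy viewed from a normal form at time 0. \<open>start\<close> compares kernels,
  as the forms are fixed only up to scalars; constancy of ranks enters through pairs and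
  triples.\<close>

locale normal_form_family = normal_form X Y Z A B S n
  for X Y Z :: "complex^3" and A B S :: "complex set" and n :: nat +
  fixes \<gamma> :: "line_index \<Rightarrow> real \<Rightarrow> complex^3"
  assumes cont: "\<And>x. x \<in> index_set A B S \<Longrightarrow> continuous_on {0..1} (\<gamma> x)"
    and start: "\<And>x. x \<in> index_set A B S \<Longrightarrow> form_kernel (\<gamma> x 0) =
        form_kernel (frm X Y Z id id x)"
    and indep: "\<And>x y t. x \<in> index_set A B S \<Longrightarrow> y \<in> index_set A B S
        \<Longrightarrow> x \<noteq> y \<Longrightarrow> t \<in> {0..1} \<Longrightarrow>
      cross (\<gamma> x t) (\<gamma> y t) \<noteq> 0"
    and det_const: "\<And>x y z t. x \<in> index_set A B S \<Longrightarrow> y \<in> index_set A B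
        S \<Longrightarrow> z \<in> index_set A B S \<Longrightarrow>
      t \<in> {0..1} \<Longrightarrow>
      det3 (\<gamma> x t) (\<gamma> y t) (\<gamma> z t) = 0 \<longleftrightarrow> det3 (\<gamma> x
          0) (\<gamma> y 0) (\<gamma> z 0) = 0"
begin

abbreviation "K \<equiv> index_set A B S"

lemma in_K [simp]: "Base \<in> K" "First a \<in> K \<longleftrightarrow> a \<in> A" "Second a \<in>
    K \<longleftrightarrow> a \<in> B" "Third a \<in> K \<longleftrightarrow> a \<in> S"
  by (auto simp: index_set_def)

lemma nonzero: "x \<in> K \<Longrightarrow> t \<in> {0..1} \<Longrightarrow> \<gamma> x t \<noteq> 0"
proof -
  assume x: "x \<in> K" and t: "t \<in> {0..1}"
  have "Base \<in> K" "First 0 \<in> K" using zero by simp_all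
  then obtain j where "j \<in> K" "x \<noteq> j" by (metis line_index.distinct(1))
  then show "\<gamma> x t \<noteq> 0" using indep[OF x _ _ t] cross_nonzero_imp(1) by blast
qed

lemma det_zero_iff:
  assumes "x \<in> K" "y \<in> K" "z \<in> K" "t \<in> {0..1}"
  shows "det3 (\<gamma> x t) (\<gamma> y t) (\<gamma> z t) = 0 \<longleftrightarrow>
    det3 (coords id id x) (coords id id y) (coords id id z) = 0"
proof -
  have "det3 (\<gamma> x 0) (\<gamma> y 0) (\<gamma> z 0) = 0 \<longleftrightarrow>
    det3 (frm X Y Z id id x) (frm X Y Z id id y) (frm X Y Z id id z) = 0"
    using assms by (intro det3_zero_scale nonzero frm_nonzero start) auto
  then show ?thesis unfolding det_const[OF assms] frm_def det3_comb using basis by simp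
qed

definition \<rho> :: "complex \<Rightarrow> complex \<Rightarrow> real \<Rightarrow> complex" where
  "\<rho> s s' t = slope_ratio (\<gamma> Base t) (\<gamma> (First 0) t) (\<gamma> (Second 0) t)
      (\<gamma> (Third s) t) (\<gamma> (Third s') t)"

lemma third_dets:
  assumes "s \<in> S" "t \<in> {0..1}"
  shows "det3 (\<gamma> (Third s) t) (\<gamma> Base t) (\<gamma> (First 0) t) \<noteq> 0"
    "det3 (\<gamma> (Third s) t) (\<gamma> Base t) (\<gamma> (Second 0) t) \<noteq> 0"
  using assms zero by (subst det_zero_iff; auto simp: det3_def ev_3)+

lemma continuous_ratio:
  assumes "s \<in> S" "s' \<in> S" shows "continuous_on {0..1} (\<rho> s s')"
proof -
  have "continuous_on {0..1} (\<lambda>t. slope_ratio (\<gamma> Base t) (\<gamma> (First 0) t)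
      (\<gamma> (Second 0) t) (\<gamma> (Third s) t) (\<gamma> (Third s') t))"
    unfolding slope_ratio_def using assms zero third_dets
    by (intro continuous_on_divide continuous_on_mult continuous_det3 cont) auto
  then show ?thesis by (simp add: \<rho>_def[abs_def])
qed

text \<open>Relative to the basis of the moved lines \<open>Base\<close>, \<open>First 0\<close> and
  \<open>Second 0\<close>, the persisting triple points say that each \<open>Third\<close> line maps
  the positions of the first pencil affinely onto those of the second. So
  \<open>affine_ratio_root_of_unity\<close> applies at every time.\<close>

lemma ratio_root_of_unity:
  assumes s: "s \<in> S" "s' \<in> S" and t: "t \<in> {0..1}"
  shows "\<exists>N\<in>{1..n+1}. \<rho> s s' t ^ N = 1"
proof -
  define U where "U = \<gamma> Base t"
  define V where "V = \<gamma> (First 0) t"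
  define V' where "V' = \<gamma> (Second 0) t"
  have UVW: "det3 U V V' \<noteq> 0"
    unfolding U_def V_def V'_def using zero t by (subst det_zero_iff) (auto simp: det3_def ev_3)
  have cr: "cross U V \<noteq> 0" "cross U V' \<noteq> 0" using det3_nonzero_imp_cross[OF UVW] by auto
  have "\<forall>a\<in>A. \<exists>y f. y \<noteq> 0 \<and> \<gamma> (First a) t = y *s (V - f *s U)"
  proof
    fix a assume a: "a \<in> A"
    have "det3 U V (\<gamma> (First a) t) = 0"
      unfolding U_def V_def using zero a t by (subst det_zero_iff) (auto simp: det3_def ev_3)
    moreover have "cross U (\<gamma> (First a) t) \<noteq> 0" unfolding U_def using a t by (intro
        indep) auto
    ultimately show "\<exists>y f. y \<noteq> 0 \<and> \<gamma> (First a) t = y *s (V - f *s U)"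
      by (intro pencil_coordinate cr)
  qed
  then obtain yf f where f: "\<And>a. a \<in> A \<Longrightarrow> yf a \<noteq> 0 \<and> \<gamma>
      (First a) t = yf a *s (V - f a *s U)" by metis
  have "\<forall>b\<in>B. \<exists>z g. z \<noteq> 0 \<and> \<gamma> (Second b) t = z *s (V' - g *s U)"
  proof
    fix b assume b: "b \<in> B"
    have "det3 U V' (\<gamma> (Second b) t) = 0"
      unfolding U_def V'_def using zero b t by (subst det_zero_iff) (auto simp: det3_def ev_3)
    moreover have "cross U (\<gamma> (Second b) t) \<noteq> 0" unfolding U_def using b t by (intro
        indep) auto
    ultimately show "\<exists>z g. z \<noteq> 0 \<and> \<gamma> (Second b) t = z *s (V' - g *s U)"
      by (intro pencil_coordinate cr)
  qed
  then obtain zg g where g: "\<And>b. b \<in> B \<Longrightarrow> zg b \<noteq> 0 \<and> \<gamma>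
      (Second b) t = zg b *s (V' - g b *s U)" by metis
  have "\<forall>r\<in>S. \<exists>z \<sigma> \<tau>. z \<noteq> 0 \<and> \<sigma> \<noteq> 0
      \<and> \<gamma> (Third r) t = z *s (V' - \<sigma> *s V - \<tau> *s U)"
  proof
    fix r assume r: "r \<in> S"
    obtain x y z where xyz: "\<gamma> (Third r) t = x *s U + y *s V + z *s V'" using
        basis_combination[OF UVW] by blast
    have "det3 (x *s U + y *s V + z *s V') U V = z * det3 U V V'" "det3 (x *s U + y *s V + z *s V')
        U V' = - y * det3 U V V'"
      by (simp_all add: vec3_simps algebra_simps)
    then have yz: "z \<noteq> 0" "y \<noteq> 0"
      using third_dets[OF r t] unfolding xyz U_def[symmetric] V_def[symmetric] V'_def[symmetric] by auto
    have "\<gamma> (Third r) t = z *s (V' - (- y / z) *s V - (- x / z) *s U)"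
      using xyz yz by (simp add: vec3_eq_iff field_simps)
    then show "\<exists>z \<sigma> \<tau>. z \<noteq> 0 \<and> \<sigma> \<noteq> 0 \<and> \<gamma>
        (Third r) t = z *s (V' - \<sigma> *s V - \<tau> *s U)"
      using yz by (intro exI[of _ z] exI[of _ "- y / z"] exI[of _ "- x / z"]) simp
  qed
  then obtain zh \<sigma> \<tau> where h: "\<And>r. r \<in> S \<Longrightarrow> zh r \<noteq> 0
      \<and> \<sigma> r \<noteq> 0 \<and> \<gamma> (Third r) t = zh r *s (V' - \<sigma> r *s V -
      \<tau> r *s U)"
    by metis
  have inj_f: "inj_on f A"
  proof (rule inj_onI, rule ccontr)
    fix a a' assume a: "a \<in> A" "a' \<in> A" "f a = f a'" "a \<noteq> a'"
    then have "cross (\<gamma> (First a) t) (\<gamma> (First a') t) \<noteq> 0" using t by (intro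
        indep) auto
    then show False using f[of a] f[of a'] a by (simp add: vec3_simps algebra_simps)
  qed
  have inj_g: "inj_on g B"
  proof (rule inj_onI, rule ccontr)
    fix a a' assume a: "a \<in> B" "a' \<in> B" "g a = g a'" "a \<noteq> a'"
    then have "cross (\<gamma> (Second a) t) (\<gamma> (Second a') t) \<noteq> 0" using t by (intro
        indep) auto
    then show False using g[of a] g[of a'] a by (simp add: vec3_simps algebra_simps)
  qed
  \<comment> \<open>The lines \<open>First a\<close>, \<open>Second (r * a)\<close> and
    \<open>Third r\<close> are concurrent at time 0 and hence at time \<open>t\<close>.\<close>
  have "\<sigma> r * f a + \<tau> r = g (r * a)" if r: "r \<in> S" and a: "a \<in> A" for r a
  proof -
    have ra: "r * a \<in> B" using slopes[OF r] a by blast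
    have "det3 (\<gamma> (First a) t) (\<gamma> (Second (r * a)) t) (\<gamma> (Third r) t) = 0"
      using r a ra t by (subst det_zero_iff) (auto simp: det3_def ev_3)
    then have "det3 (V - f a *s U) (V' - g (r * a) *s U) (V' - \<sigma> r *s V - \<tau> r *s U) = 0"
      unfolding f[OF a, THEN conjunct2] g[OF ra, THEN conjunct2] h[OF r, THEN conjunct2, THEN conjunct2]
        det3_linear(2,4,6)
      using f[OF a, THEN conjunct1] g[OF ra, THEN conjunct1] h[OF r, THEN conjunct1] by simp
    moreover have "det3 (V - f a *s U) (V' - g (r * a) *s U) (V' - \<sigma> r *s V - \<tau> r *s U) =
        (g (r * a) - \<sigma> r * f a - \<tau> r) * det3 U V V'"
      by (simp add: vec3_simps algebra_simps)
    ultimately have "(g (r * a) - \<sigma> r * f a - \<tau> r) * det3 U V V' = 0" by (simp only:)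
    then have "g (r * a) - \<sigma> r * f a - \<tau> r = 0" using UVW by simp
    then show ?thesis by (simp add: algebra_simps)
  qed
  then have "\<sigma> r * u + \<tau> r \<in> g ` B" if "r \<in> S" "u \<in> f ` A" for r u
    using that slopes[OF that(1)] by (metis (no_types, lifting) imageE imageI)
  then have im: "(\<lambda>u. \<sigma> r * u + \<tau> r) ` f ` A = g ` B" if "r \<in> S" for r
    using that h fin card inj_f inj_g by (intro affine_image_sum(1)) (auto simp: card_image)
  have "\<exists>N\<in>{1..card (f ` A)}. (\<sigma> s' / \<sigma> s) ^ N = 1"
    using h s fin card n_pos inj_f by (intro affine_ratio_root_of_unity[OF _ _ _ _ im im]) (auto
        simp: card_image)
  moreover have "\<rho> s s' t = \<sigma> s' / \<sigma> s"
  proof -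
    have "\<rho> s s' t = slope_ratio (1 *s U) (1 *s V) (1 *s V') (zh s *s (V' - \<sigma> s *s V -
        \<tau> s *s U)) (zh s' *s (V' - \<sigma> s' *s V - \<tau> s' *s U))"
      unfolding \<rho>_def U_def[symmetric] V_def[symmetric] V'_def[symmetric] vec.scale_one
        h[OF s(1), THEN conjunct2, THEN conjunct2] h[OF s(2), THEN conjunct2, THEN conjunct2] ..
    also have "\<dots> = slope_ratio U V V' (V' - \<sigma> s *s V - \<tau> s *s U) (V' - \<sigma>
        s' *s V - \<tau> s' *s U)"
      by (rule slope_ratio_scale) (use h s in auto)
    also have "\<dots> = \<sigma> s' / \<sigma> s"
      by (rule slope_ratio_eq[OF UVW]) (use h s in auto)
    finally show ?thesis .
  qed
  ultimately show ?thesis using card inj_f by (simp add: card_image)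
qed

lemma ratio_start:
  assumes "s \<in> S" "s' \<in> S" shows "\<rho> s s' 0 = s' / s"
proof -
  have "\<exists>c. c \<noteq> 0 \<and> \<gamma> x 0 = c *s frm X Y Z id id x" if "x \<in> K" for x
    using start[OF that] form_kernel_eq_iff[OF frm_nonzero[OF that] nonzero[OF that, of 0]] by auto
  then obtain c where c: "\<And>x. x \<in> K \<Longrightarrow> c x \<noteq> 0 \<and> \<gamma> x 0 =
      c x *s frm X Y Z id id x" by metis
  have "\<rho> s s' 0 = slope_ratio (c Base *s X) (c (First 0) *s Y) (c (Second 0) *s Z)
     (c (Third s) *s (Z - s *s Y - 0 *s X)) (c (Third s') *s (Z - s' *s Y - 0 *s X))"
    using c[of Base] c[of "First 0"] c[of "Second 0"] c[of "Third s"] c[of "Third s'"] assms zero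
    by (simp add: \<rho>_def)
  also have "\<dots> = slope_ratio X Y Z (Z - s *s Y - 0 *s X) (Z - s' *s Y - 0 *s X)"
    by (rule slope_ratio_scale) (use c assms zero in auto)
  also have "\<dots> = s' / s"
    by (rule slope_ratio_eq[OF basis]) (use assms zero in auto)
  finally show ?thesis .
qed

lemma ratio_end:
  assumes "s \<in> S" "s' \<in> S" shows "\<rho> s s' 1 = s' / s"
proof -
  \<comment> \<open>The order of the root of unity could a priori vary with the time, so all orders
    up to \<open>n + 1\<close> are collected in one finite set.\<close>
  define R where "R = (\<Union>N\<in>{1..n+1}. {z::complex. z ^ N = 1})"
  have "finite R" unfolding R_def by (auto intro!: finite_roots_unity)
  moreover have "\<rho> s s' ` {0..1} \<subseteq> R"
    using ratio_root_of_unity[OF assms] unfolding R_def by blast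
  ultimately have "finite (\<rho> s s' ` {0..1})" by (rule rev_finite_subset)
  then have "\<rho> s s' constant_on {0..1}"
    by (intro continuous_finite_range_constant continuous_ratio assms) auto
  then have "\<rho> s s' 1 = \<rho> s s' 0" unfolding constant_on_def by auto
  then show ?thesis using ratio_start[OF assms] by simp
qed

end

lemma smooth_imp_continuous:
  assumes "smooth_on_unit_interval f" shows "continuous_on {0..1} f"
proof -
  obtain D where D: "\<And>t. t \<in> {0..1} \<Longrightarrow> D (0::nat) t = f t"
    "\<And>t. t \<in> {0..1} \<Longrightarrow> (D 0 has_vector_derivative D (Suc 0) t) (at t within
        {0..1})"
    using assms unfolding smooth_on_unit_interval_def by blast
  have "continuous_on {0..1} (D 0)"
    using D(2) has_vector_derivative_continuous continuous_on_eq_continuous_within by blast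
  then show ?thesis by (simp only: continuous_on_cong[OF refl D(1)])
qed

text \<open>Each plane of the isotopy is renumbered by the line from which it starts, so that the
  indices of the normal form are carried to time 1.\<close>

lemma (in normal_form) isotopic_family:
  assumes "lattice_isotopic (arr X Y Z A B S) C"
  shows "\<exists>\<gamma>. normal_form_family X Y Z A B S n \<gamma> \<and>
    inj_on (\<lambda>x. form_kernel (\<gamma> x 1)) (index_set A B S) \<and>
    C = (\<lambda>x. form_kernel (\<gamma> x 1)) ` index_set A B S"
proof -
  obtain d :: nat and \<alpha> :: "nat \<Rightarrow> real \<Rightarrow> complex^3" where
    I: "(\<forall>i\<in>{1..d}. smooth_on_unit_interval (\<alpha> i)) \<and>
        (\<forall>t\<in>{0..1}. (\<forall>i\<in>{1..d}. \<alpha> i t \<noteq> 0) \<and> inj_on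
            (\<lambda>i. form_kernel (\<alpha> i t)) {1..d}) \<and>
        (\<forall>I\<subseteq>{1..d}. \<forall>s\<in>{0..1}. \<forall>t\<in>{0..1}.
           vec.dim ((\<lambda>i. \<alpha> i s) ` I) = vec.dim ((\<lambda>i. \<alpha> i t) ` I)) \<and>
        arr X Y Z A B S = (\<lambda>i. form_kernel (\<alpha> i 0)) ` {1..d} \<and>
        C = (\<lambda>i. form_kernel (\<alpha> i 1)) ` {1..d}"
    using assms unfolding lattice_isotopic_def by (elim exE)
  have sm: "smooth_on_unit_interval (\<alpha> i)" if "i \<in> {1..d}" for i
    using I that by simp
  have nz: "\<alpha> i t \<noteq> 0" if "t \<in> {0..1}" "i \<in> {1..d}" for i t
    using I that by simp
  have inj: "inj_on (\<lambda>i. form_kernel (\<alpha> i t)) {1..d}" if "t \<in> {0..1}" for t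
    using I that by simp
  have rk: "vec.dim ((\<lambda>i. \<alpha> i s) ` I) = vec.dim ((\<lambda>i. \<alpha> i t) ` I)"
    if "I \<subseteq> {1..d}" "s \<in> {0..1}" "t \<in> {0..1}" for I s t
    using I[THEN conjunct2, THEN conjunct2, THEN conjunct1] that by blast
  have A0: "arr X Y Z A B S = (\<lambda>i. form_kernel (\<alpha> i 0)) ` {1..d}"
    using I by blast
  have C: "C = (\<lambda>i. form_kernel (\<alpha> i 1)) ` {1..d}"
    using I by blast
  let ?K = "index_set A B S"
  have "\<forall>x\<in>?K. \<exists>i\<in>{1..d}. form_kernel (\<alpha> i 0) = form_kernel (frm X Y
      Z id id x)"
    using A0 unfolding arr_eq_image by (metis (no_types, lifting) imageE imageI)
  then obtain r where r: "\<And>x. x \<in> ?K \<Longrightarrow> r x \<in> {1..d}"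
    "\<And>x. x \<in> ?K \<Longrightarrow> form_kernel (\<alpha> (r x) 0) = form_kernel (frm X Y Z
        id id x)" by metis
  have inj_r: "inj_on r ?K"
    using frm_inj r(2) by (metis (no_types, lifting) inj_onD inj_onI)
  have surj_r: "r ` ?K = {1..d}"
  proof
    show "{1..d} \<subseteq> r ` ?K"
    proof
      fix i assume i: "i \<in> {1..d}"
      then have "form_kernel (\<alpha> i 0) \<in> (\<lambda>x. form_kernel (frm X Y Z id id x)) ` ?K"
        using A0 unfolding arr_eq_image by blast
      then obtain x where x: "x \<in> ?K" "form_kernel (\<alpha> i 0) = form_kernel (\<alpha> (r x)
          0)" using r(2) by auto
      then have "i = r x" using inj_onD[OF inj[of 0] x(2)] i r(1)[OF x(1)] by simp
      then show "i \<in> r ` ?K" using x by blast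
    qed
  qed (use r(1) in blast)
  define \<gamma> where "\<gamma> x = \<alpha> (r x)" for x
  have det: "det3 (\<alpha> i s) (\<alpha> j s) (\<alpha> k s) = 0 \<longleftrightarrow> det3
      (\<alpha> i t) (\<alpha> j t) (\<alpha> k t) = 0"
    if "i \<in> {1..d}" "j \<in> {1..d}" "k \<in> {1..d}" "s \<in> {0..1}" "t \<in> {0..1}" for i j
        k s t
    using rk[of "{i, j, k}" s t] that dim_triple_iff[of "\<alpha> i s" "\<alpha> j s" "\<alpha> k s"]
      dim_triple_iff[of "\<alpha> i t" "\<alpha> j t" "\<alpha> k t"] by auto
  have indep: "cross (\<alpha> i t) (\<alpha> j t) \<noteq> 0"
    if ij: "i \<in> {1..d}" "j \<in> {1..d}" "i \<noteq> j" "t \<in> {0..1}" for i j t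
  proof
    assume "cross (\<alpha> i t) (\<alpha> j t) = 0"
    then obtain c where c: "\<alpha> j t = c *s \<alpha> i t" using cross_zero_iff[OF nz[OF
        ij(4,1)]] by blast
    moreover have "c \<noteq> 0" using c nz[OF ij(4,2)] by auto
    ultimately have "form_kernel (\<alpha> i t) = form_kernel (\<alpha> j t)" by (simp add:
        form_kernel_scale)
    then show False using inj_onD[OF inj[OF ij(4)]] ij by blast
  qed
  have "normal_form_family X Y Z A B S n \<gamma>"
  proof (intro normal_form_family.intro normal_form_axioms normal_form_family_axioms.intro)
    fix x y z t
    assume x: "x \<in> ?K"
    show "continuous_on {0..1} (\<gamma> x)" unfolding \<gamma>_def by (rule
        smooth_imp_continuous[OF sm[OF r(1)[OF x]]])
    show "form_kernel (\<gamma> x 0) = form_kernel (frm X Y Z id id x)" unfolding \<gamma>_def by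
        (rule r(2)[OF x])
    assume y: "y \<in> ?K"
    show "cross (\<gamma> x t) (\<gamma> y t) \<noteq> 0" if "x \<noteq> y" "t \<in> {0..1}"
      unfolding \<gamma>_def using inj_onD[OF inj_r _ x y] that by (intro indep r x y) auto
    assume "z \<in> ?K" "t \<in> {0..1}"
    then show "det3 (\<gamma> x t) (\<gamma> y t) (\<gamma> z t) = 0 \<longleftrightarrow> det3
        (\<gamma> x 0) (\<gamma> y 0) (\<gamma> z 0) = 0"
      unfolding \<gamma>_def by (intro det r x y) auto
  qed
  moreover have "inj_on (\<lambda>x. form_kernel (\<gamma> x 1)) ?K"
    using comp_inj_on[OF inj_r, of "\<lambda>i. form_kernel (\<alpha> i 1)"] inj[of 1] surj_r by
        (simp add: \<gamma>_def comp_def)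
  moreover have "C = (\<lambda>x. form_kernel (\<gamma> x 1)) ` ?K"
    unfolding C surj_r[symmetric] by (simp add: image_image \<gamma>_def)
  ultimately show ?thesis by blast
qed

context normal_form_family
begin

text \<open>With \<open>second_vertex\<close>: the positions at time 1 of the two modular
  points.\<close>

definition "first_vertex = cross (\<gamma> Base 1) (\<gamma> (First 0) 1)"
definition "second_vertex = cross (\<gamma> Base 1) (\<gamma> (Second 0) 1)"

text \<open>Once both modular points arrive at the corresponding vertices of the target,
  \<open>Base\<close> and the \<open>Third\<close> lines arrive at lines of the same kind, so the
  slopes correspond by some \<open>\<psi>\<close>. As \<open>\<psi>\<close> preserves quotients, it
  is multiplication by a constant.\<close>

lemma slopes_end_aligned:
  assumes nf: "normal_form X' Y' Z' A' B' S' n"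
    and C: "arr X' Y' Z' A' B' S' = (\<lambda>x. form_kernel (\<gamma> x 1)) ` K"
    and inj: "inj_on (\<lambda>x. form_kernel (\<gamma> x 1)) K" and cS: "card S' = card S"
    and v: "ev X' first_vertex = 0" "ev Y' first_vertex = 0" and w: "ev X' second_vertex = 0" "ev
        Z' second_vertex = 0"
  shows "\<exists>c. c \<noteq> 0 \<and> S' = (*) c ` S"
proof -
  interpret e: normal_form X' Y' Z' A' B' S' n by (rule nf)
  have z: "First 0 \<in> K" "Second 0 \<in> K" using zero by simp_all
  have nzv: "first_vertex \<noteq> 0" "second_vertex \<noteq> 0" unfolding first_vertex_def
      second_vertex_def using indep[OF _ z(1), of Base 1] indep[OF _ z(2), of Base 1] by auto
  have vz: "ev Z' first_vertex \<noteq> 0" "ev Y' second_vertex \<noteq> 0"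
    using basis_eq_0[OF e.basis] nzv v w by blast+
  have "\<exists>y c. y \<in> index_set A' B' S' \<and> c \<noteq> 0 \<and> \<gamma> x 1 = c *s frm
      X' Y' Z' id id y" if x: "x \<in> K" for x
  proof -
    have "form_kernel (\<gamma> x 1) \<in> arr X' Y' Z' A' B' S'" using C x by blast
    then obtain y where y: "y \<in> index_set A' B' S'" "form_kernel (\<gamma> x 1) = form_kernel
        (frm X' Y' Z' id id y)"
      unfolding e.arr_eq_image by blast
    then show ?thesis
      using form_kernel_eq_iff[OF e.frm_nonzero[OF y(1)] nonzero[OF x, of 1]] by auto
  qed
  then obtain y c where yc: "\<And>x. x \<in> K \<Longrightarrow> y x \<in> index_set A' B' S'"
      "\<And>x. x \<in> K \<Longrightarrow> c x \<noteq> 0"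
    "\<And>x. x \<in> K \<Longrightarrow> \<gamma> x 1 = c x *s frm X' Y' Z' id id (y x)" by metis
  have inj_y: "inj_on y K"
  proof (rule inj_onI)
    fix x x' assume "x \<in> K" "x' \<in> K" "y x = y x'"
    then have "form_kernel (\<gamma> x 1) = form_kernel (\<gamma> x' 1)" using yc(2,3) by (simp
        add: form_kernel_scale)
    then show "x = x'" using inj_onD[OF inj] \<open>x \<in> K\<close> \<open>x' \<in> K\<close> by blast
  qed
  have ev0: "ev (\<gamma> x 1) u = 0 \<longleftrightarrow> ev (frm X' Y' Z' id id (y x)) u = 0" if
      "x \<in> K" for x u
    using yc(2,3)[OF that] by simp
  have at_v: "y x = Base \<or> (\<exists>a. y x = First a)" if "x \<in> K" "ev (\<gamma> x 1)
      first_vertex = 0" for x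
    using that(2) yc(1)[OF that(1)] v vz unfolding ev0[OF that(1)] by (auto simp: index_set_def)
  have at_w: "y x = Base \<or> (\<exists>b. y x = Second b)" if "x \<in> K" "ev (\<gamma> x 1)
      second_vertex = 0" for x
    using that(2) yc(1)[OF that(1)] w vz unfolding ev0[OF that(1)]
    by (auto simp: index_set_def e.zero dest: e.zero(3)[THEN notE])
  have yB: "y Base = Base"
    using at_v[of Base] at_w[of Base] by (auto simp: first_vertex_def second_vertex_def)
  have "y (First 0) \<noteq> Base" "y (Second 0) \<noteq> Base"
    using inj_onD[OF inj_y _ z(1), of Base] inj_onD[OF inj_y _ z(2), of Base] yB by auto
  then obtain a b where yF: "y (First 0) = First a" and yS: "y (Second 0) = Second b"
    using at_v[OF z(1)] at_w[OF z(2)] by (auto simp: first_vertex_def second_vertex_def)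
  have "\<exists>\<sigma>\<in>S'. y (Third s) = Third \<sigma>" if s: "s \<in> S" for s
  proof -
    have k: "Third s \<in> K" using s by simp
    have "ev (\<gamma> (Third s) 1) first_vertex \<noteq> 0" "ev (\<gamma> (Third s) 1)
        second_vertex \<noteq> 0"
      using third_dets[OF s, of 1] unfolding det3_def first_vertex_def second_vertex_def by auto
    then show ?thesis
      using yc(1)[OF k] v w unfolding ev0[OF k] by (auto simp: index_set_def)
  qed
  then obtain \<psi> where \<psi>: "\<And>s. s \<in> S \<Longrightarrow> \<psi> s \<in> S'"
      "\<And>s. s \<in> S \<Longrightarrow> y (Third s) = Third (\<psi> s)" by metis
  have "inj_on \<psi> S"
  proof (rule inj_onI)
    fix s s' assume s: "s \<in> S" "s' \<in> S" "\<psi> s = \<psi> s'"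
    then have "y (Third s) = y (Third s')" using \<psi>(2) by simp
    then show "s = s'" using inj_onD[OF inj_y, of "Third s" "Third s'"] s by simp
  qed
  then have im: "\<psi> ` S = S'"
    using \<psi>(1) cS e.fin by (intro card_subset_eq) (auto simp: card_image)
  have ratio: "\<psi> s' / \<psi> s = s' / s" if s: "s \<in> S" "s' \<in> S" for s s'
  proof -
    \<comment> \<open>\<open>First 0\<close> and \<open>Second 0\<close> may have arrived at any
      positions \<open>a\<close> and \<open>b\<close>. With these two lines as axes the slopes are
      unchanged, and intercepts appear.\<close>
    define U where "U = Y' - a *s X'"
    define V where "V = Z' - b *s X'"
    have t: "Z' - u *s Y' = V - u *s U - (u * a - b) *s X'" for u
      by (simp add: U_def V_def vec3_eq_iff algebra_simps)
    have d: "det3 X' U V \<noteq> 0"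
    proof -
      have "det3 X' U V = det3 X' Y' Z'" by (simp add: U_def V_def vec3_simps algebra_simps)
      then show ?thesis using e.basis by simp
    qed
    have g: "\<gamma> Base 1 = c Base *s X'" "\<gamma> (First 0) 1 = c (First 0) *s U" "\<gamma>
        (Second 0) 1 = c (Second 0) *s V"
      using yc(3)[of Base] yc(3)[OF z(1)] yc(3)[OF z(2)] yB yF yS by (simp_all add: U_def V_def)
    have g3: "\<gamma> (Third r) 1 = c (Third r) *s (V - \<psi> r *s U - (\<psi> r * a - b) *s X')"
        if "r \<in> S" for r
      using yc(3)[of "Third r"] \<psi>(2)[OF that] that unfolding t[symmetric] by simp
    have "\<rho> s s' 1 = slope_ratio X' U V (V - \<psi> s *s U - (\<psi> s * a - b) *s X') (V -
        \<psi> s' *s U - (\<psi> s' * a - b) *s X')"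
      unfolding \<rho>_def g g3[OF s(1)] g3[OF s(2)]
      by (rule slope_ratio_scale) (use yc(2) z s in auto)
    also have "\<dots> = \<psi> s' / \<psi> s"
      by (rule slope_ratio_eq[OF d]) (use \<psi>(1)[OF s(1)] e.zero in auto)
    finally show ?thesis using ratio_end[OF s] by simp
  qed
  show ?thesis
  proof (cases "S = {}")
    case True
    then show ?thesis using im by (intro exI[of _ 1]) simp
  next
    case False
    then obtain s0 where s0: "s0 \<in> S" by blast
    have n0: "s0 \<noteq> 0" "\<psi> s0 \<noteq> 0" using s0 \<psi>(1)[OF s0] zero e.zero by auto
    have "\<psi> s = \<psi> s0 / s0 * s" if "s \<in> S" for s
      using ratio[OF s0 that] n0 by (simp add: field_simps)
    then have "S' = (*) (\<psi> s0 / s0) ` S" unfolding im[symmetric] by (intro image_cong) auto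
    then show ?thesis using n0 by (intro exI[of _ "\<psi> s0 / s0"]) simp
  qed
qed

text \<open>For \<open>n\<close> at least 2 and fewer than \<open>n\<close> slopes only two points
  of the target have multiplicity \<open>n + 2\<close>, so the modular points arrive there in one of
  two orders. The second order is the first after exchanging the target's pencils, which inverts its
  slopes.\<close>

lemma slopes_end:
  assumes nf: "normal_form X' Y' Z' A' B' S' n"
    and C: "arr X' Y' Z' A' B' S' = (\<lambda>x. form_kernel (\<gamma> x 1)) ` K"
    and inj: "inj_on (\<lambda>x. form_kernel (\<gamma> x 1)) K"
    and n2: "n \<ge> 2" "card S < n"
  shows "\<exists>c. c \<noteq> 0 \<and> (S' = (*) c ` S \<or> inverse ` S' = (*) c ` S)"
proof -
  interpret e: normal_form X' Y' Z' A' B' S' n by (rule nf)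
  have z: "First 0 \<in> K" "Second 0 \<in> K" using zero by simp_all
  have cS: "card S' = card S"
    using e.card_arr card_arr card_image[OF inj] card_image[OF frm_inj] unfolding C arr_eq_image by simp
  have nzv: "first_vertex \<noteq> 0" "second_vertex \<noteq> 0"
    unfolding first_vertex_def second_vertex_def using indep[OF _ z(1), of Base 1] indep[OF _ z(2),
        of Base 1] by auto
  have pencil: "ev X' P = 0 \<and> (ev Y' P = 0 \<or> ev Z' P = 0)"
    if P: "P \<noteq> 0" and T: "T \<subseteq> K" "card T = n + 2" "\<And>x. x \<in> T
        \<Longrightarrow> ev (\<gamma> x 1) P = 0" for P T
  proof -
    have "card T = card ((\<lambda>x. form_kernel (\<gamma> x 1)) ` T)"
      using inj_on_subset[OF inj T(1)] by (simp add: card_image)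
    also have "\<dots> \<le> card {l \<in> arr X' Y' Z' A' B' S'. P \<in> l}"
    proof (rule card_mono)
      show "finite {l \<in> arr X' Y' Z' A' B' S'. P \<in> l}"
        using e.line_arrangement_arr by (simp add: line_arrangement_def)
      show "(\<lambda>x. form_kernel (\<gamma> x 1)) ` T \<subseteq> {l \<in> arr X' Y' Z' A' B'
          S'. P \<in> l}"
        using T unfolding C by (auto simp: in_form_kernel)
    qed
    finally have "n + 2 \<le> card {l \<in> arr X' Y' Z' A' B' S'. P \<in> l}" using T(2) by simp
    then show ?thesis by (rule e.maximal_multiplicity_cases[OF P]) (use n2 cS in auto)
  qed
  have first: "ev X' first_vertex = 0 \<and> (ev Y' first_vertex = 0 \<or> ev Z' first_vertex = 0)"
  proof (rule pencil[OF nzv(1), of "insert Base (First ` A)"])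
    show "card (insert Base (First ` A)) = n + 2"
      using fin card by (subst card_insert_disjoint) (auto simp: card_image inj_on_def)
    show "ev (\<gamma> x 1) first_vertex = 0" if "x \<in> insert Base (First ` A)" for x
    proof -
      have "det3 (\<gamma> x 1) (\<gamma> Base 1) (\<gamma> (First 0) 1) = 0"
        using that z by (subst det_zero_iff) (auto simp: det3_def ev_3)
      then show ?thesis by (simp add: det3_def first_vertex_def)
    qed
  qed auto
  have second: "ev X' second_vertex = 0 \<and> (ev Y' second_vertex = 0 \<or> ev Z' second_vertex = 0)"
  proof (rule pencil[OF nzv(2), of "insert Base (Second ` B)"])
    show "card (insert Base (Second ` B)) = n + 2"
      using fin card by (subst card_insert_disjoint) (auto simp: card_image inj_on_def)
    show "ev (\<gamma> x 1) second_vertex = 0" if "x \<in> insert Base (Second ` B)" for x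
    proof -
      have "det3 (\<gamma> x 1) (\<gamma> Base 1) (\<gamma> (Second 0) 1) = 0"
        using that z by (subst det_zero_iff) (auto simp: det3_def ev_3)
      then show ?thesis by (simp add: det3_def second_vertex_def)
    qed
  qed auto
  \<comment> \<open>The two vertices are still distinct at time 1, so they cannot arrive at the same
    vertex of the target.\<close>
  have fs: "cross first_vertex second_vertex \<noteq> 0"
  proof -
    have "cross first_vertex second_vertex = det3 (\<gamma> Base 1) (\<gamma> (First 0) 1)
        (\<gamma> (Second 0) 1) *s \<gamma> Base 1"
      by (simp add: first_vertex_def second_vertex_def vec3_simps algebra_simps)
    moreover have "det3 (\<gamma> Base 1) (\<gamma> (First 0) 1) (\<gamma> (Second 0) 1) \<noteq> 0"
      using z by (subst det_zero_iff) (auto simp: det3_def ev_3)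
    ultimately show ?thesis using nonzero[of Base 1] by simp
  qed
  have "\<not> (ev Y' first_vertex = 0 \<and> ev Y' second_vertex = 0)" "\<not> (ev Z' first_vertex
      = 0 \<and> ev Z' second_vertex = 0)"
    using span_cross_eq[OF e.vertices_nonzero(1) nzv(1)] span_cross_eq[OF e.vertices_nonzero(1) nzv(2)]
      span_cross_eq[OF e.vertices_nonzero(2) nzv(1)] span_cross_eq[OF e.vertices_nonzero(2) nzv(2)]
      span_singleton_eq_iff[OF nzv] fs first second by auto
  then consider "ev Y' first_vertex = 0" "ev Z' second_vertex = 0" | "ev Z' first_vertex = 0" "ev
      Y' second_vertex = 0" using first second by blast
  then show ?thesis
  proof cases
    case 1
    then show ?thesis using slopes_end_aligned[OF nf C inj cS] first second by blast
  next
    case 2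
    have "card (inverse ` S') = card S" using cS by (simp add: card_image inj_on_def)
    then show ?thesis
      using slopes_end_aligned[OF e.swap _ inj, unfolded arr_swap[OF e.zero(3)], OF C] 2 first
          second by blast
  qed
qed

end

section \<open>Orbits of tuples and the classification\<close>

lemma standard_normal_form:
  assumes "n \<ge> 1" "S \<subseteq> mu n"
  shows "normal_form e1 e2 e3 (insert 0 (mu n)) (insert 0 (mu n)) S n"
proof
  show "(*) s ` insert 0 (mu n) = insert 0 (mu n)" if "s \<in> S" for s
  proof -
    have s: "s \<in> mu n" "s \<noteq> 0" using that assms zero_notin_mu by auto
    have "(*) s ` mu n = mu n"
    proof
      show "mu n \<subseteq> (*) s ` mu n"
        using mu_closed(3)[OF _ s(1)] s(2) by (auto intro!: image_eqI[of _ _ "_ / s"])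
    qed (use mu_closed(1) s in auto)
    then show ?thesis by simp
  qed
  show "finite S" using assms finite_mu finite_subset by blast
qed (use assms zero_notin_mu in \<open>auto simp: det3_axis finite_mu card_mu\<close>)

lemma set_G_act:
  assumes "\<sigma> permutes {..<length w}"
  shows "set (G_act \<sigma> a e w) = (\<lambda>s. a * s powi e) ` set w"
proof -
  have "set (G_act \<sigma> a e w) = (\<lambda>s. a * s powi e) ` (!) w ` \<sigma> ` {..<length w}"
    by (simp add: G_act_def image_image atLeast0LessThan)
  also have "\<dots> = (\<lambda>s. a * s powi e) ` set w"
    unfolding permutes_image[OF assms] by (auto simp: set_conv_nth)
  finally show ?thesis .
qed

text \<open>The permutations in \<open>G\<close> allow orbit membership to be tested on the sets of
  entries alone.\<close>

lemma G_orbit_relI: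
  assumes w: "w \<in> W n k" "w' \<in> W n k" and a: "a \<in> mu n" and e: "e \<in> {1, -1}"
    and "set w' = (\<lambda>s. a * s powi e) ` set w"
  shows "(w, w') \<in> G_orbit_rel n k"
proof -
  let ?u = "map (\<lambda>s. a * s powi e) w"
  have len: "length w = k" "length w' = k" "distinct w'" using w by (auto simp: W_def)
  have "set w' = set ?u" using assms(5) by simp
  moreover have "card (set ?u) = length ?u"
    using len calculation by (metis distinct_card length_map)
  then have "distinct ?u" by (rule card_distinct)
  ultimately have "mset w' = mset ?u" using len set_eq_iff_mset_eq_distinct by blast
  then obtain \<sigma> where \<sigma>: "\<sigma> permutes {..<length ?u}" "permute_list \<sigma> ?u
      = w'"
    using mset_eq_permutation by blast
  have "w' = G_act \<sigma> a e w"
    unfolding \<sigma>(2)[symmetric] G_act_def permute_list_def using permutes_in_image[OF \<sigma>(1)]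
    by (intro nth_equalityI) auto
  then show ?thesis using w a e \<sigma>(1) len unfolding G_orbit_rel_def by auto
qed

lemma projectively_equivalent_arr:
  assumes "det3 X Y Z \<noteq> 0"
  shows "projectively_equivalent (arr X Y Z A B S) (arr e1 e2 e3 A B S)"
proof -
  define P :: "complex^3^3" where "P = vector [X, Y, Z]"
  have P: "P *v v = vector [ev X v, ev Y v, ev Z v]" for v
    by (simp add: P_def vec3_eq_iff matrix_vector_mult_def ev_def)
  have "det P = det3 X Y Z" by (simp add: P_def det_3 vec3_simps algebra_simps)
  then have inv: "invertible P" using assms by (simp add: invertible_det_nz)
  have surj: "\<exists>v. P *v v = u" for u
    using basis_solve[OF assms, of "u$1" "u$2" "u$3"] by (force simp: P vec3_eq_iff)
  have "ev (frm X Y Z id id i) v = ev (frm e1 e2 e3 id id i) (P *v v)" for i v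
    by (cases i) (simp_all add: P ev_axis)
  then have "(\<lambda>v. P *v v) ` form_kernel (frm X Y Z id id i) = form_kernel (frm e1 e2 e3 id
      id i)" for i
    using surj unfolding form_kernel_eq by (auto simp: image_iff) metis
  then have "(\<lambda>l. (\<lambda>v. P *v v) ` l) ` arr X Y Z A B S = arr e1 e2 e3 A B S"
    using image_frm[of X Y Z id id A B S] image_frm[of e1 e2 e3 id id A B S]
    by (simp add: image_image flip: image_frm[of X Y Z id id A B S, simplified])
  then show ?thesis unfolding projectively_equivalent_def using inv by blast
qed

context normal_form
begin

lemma normalize:
  "\<exists>Y' Z' A' B' S'. normal_form X Y' Z' A' B' S' n \<and> arr X Y' Z' A' B' S' = arr X Y Z
      A B S \<and>
    S' \<subseteq> mu n \<and> card S' = card S"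
proof (cases "S = {}")
  case True
  then show ?thesis using normal_form_axioms by blast
next
  case False
  then obtain s0 where s0: "s0 \<in> S" by blast
  \<comment> \<open>All slopes are divided by \<open>s0\<close>. The factor is written
    \<open>1 / s0 / 1\<close> to match the shape \<open>d / c\<close> in \<open>rescale\<close>,
    with \<open>c = 1\<close>.\<close>
  then have n0: "s0 \<noteq> 0" using zero by auto
  have "(*) (1 / s0 / 1) ` S \<subseteq> mu n" using slope_ratio_in_mu[OF _ s0] by auto
  moreover have "card ((*) (1 / s0 / 1) ` S) = card S" using n0 by (simp add: card_image inj_on_def)
  moreover have "1 / s0 \<noteq> 0" using n0 by simp
  ultimately show ?thesis
    using rescale[OF one_neq_zero] arr_rescale[OF one_neq_zero, of _ X Y Z A B S] by blast
qed

text \<open>A change of representative is absorbed into the coordinates of the given arrangement,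
  which is thus joined directly to every tuple of the class; a concatenation of smooth paths may
  fail to be smooth.\<close>

lemma isotopic_tuple_arrangement:
  assumes "set w = (\<lambda>s. a * s powi e) ` S" "a \<noteq> 0" "e \<in> {1, -1}" "set w
      \<subseteq> mu n"
  shows "lattice_isotopic (arr X Y Z A B S) (tuple_arrangement n w)"
proof -
  have *: "lattice_isotopic (arr X' Y' Z' A' B' S') (tuple_arrangement n w)"
    if nf: "normal_form X' Y' Z' A' B' S' n" and S': "set w = (*) a ` S'" for X' Y' Z' A' B' S'
  proof -
    interpret e: normal_form X' Y' Z' A' B' S' n by (rule nf)
    have "set w = (*) (a / 1) ` S'" using S' by simp
    then show ?thesis
      using normal_form.isotopic_standard[OF e.rescale[of 1 a]] arr_rescale[of 1 a X' Y' Z' A' B'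
          S'] assms
        tuple_arrangement_eq[OF n_pos, of w] by simp
  qed
  show ?thesis
  proof (cases "e = 1")
    case True
    then show ?thesis using assms by (intro *[OF normal_form_axioms]) simp
  next
    case False
    then have "set w = (*) a ` inverse ` S" using assms by (auto simp: image_image power_int_minus)
    then show ?thesis using *[OF swap] unfolding arr_swap[OF zero(3)] by blast
  qed
qed

text \<open>Slope 1 forces \<open>B = A\<close>, and all roots of unity together make
  \<open>A - {0}\<close> a single orbit through some \<open>a\<close>. Scaling both pencils by
  \<open>1 / a\<close> fixes the slopes and brings the positions to the standard ones.\<close>

lemma projectively_equivalent_full_monomial:
  assumes "S = mu n"
  shows "projectively_equivalent (arr X Y Z A B S) (full_monomial n)"
proof -
  have "1 \<in> S" using assms mu_closed(4) by simp
  then have BA: "B = A" using slopes[of 1] by simp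
  have "card (A - {0}) = n" using card zero fin by simp
  then have "A - {0} \<noteq> {}" using n_pos by force
  then obtain a where a: "a \<in> A" "a \<noteq> 0" by blast
  have "(*) a ` mu n = A - {0}"
  proof (rule card_subset_eq)
    show "(*) a ` mu n \<subseteq> A - {0}"
    proof
      fix x assume "x \<in> (*) a ` mu n"
      then obtain s where s: "s \<in> mu n" "x = s * a" by (auto simp: mult.commute)
      then have "s * a \<in> A" using slopes[of s] a assms BA by blast
      then show "x \<in> A - {0}" using s a zero_notin_mu[OF n_pos] by auto
    qed
    show "card ((*) a ` mu n) = card (A - {0})"
      using \<open>card (A - {0}) = n\<close> a card_mu[OF n_pos] by (simp add: card_image inj_on_def)
  qed (use fin in auto)
  then have A: "A = (*) a ` insert 0 (mu n)" using zero by auto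
  have A': "(*) (1 / a) ` A = insert 0 (mu n)" unfolding A image_image using a by simp
  have S': "(*) ((1 / a) / (1 / a)) ` S = mu n" using a assms by simp
  have a': "1 / a \<noteq> 0" using a by simp
  interpret e: normal_form X "(1 / a) *s Y" "(1 / a) *s Z" "insert 0 (mu n)" "insert 0 (mu n)" "mu n" n
    using rescale[OF a' a'] unfolding BA A' S' .
  show ?thesis
    using projectively_equivalent_arr[OF e.basis, of "insert 0 (mu n)" "insert 0 (mu n)" "mu n"]
      arr_rescale[OF a' a', of X Y Z A B S]
    unfolding BA A' S' full_monomial_eq[OF n_pos] by (simp only:)
qed

end

lemma orbit_of_isotopic:
  assumes n: "n \<ge> 1" and nf: "normal_form X Y Z A B S n" and S: "S \<subseteq> mu n"
    and w: "w \<in> W n k" "set w = S" and w': "w' \<in> W n k'"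
    and iso: "lattice_isotopic (arr X Y Z A B S) (tuple_arrangement n w')"
  shows "k' = k" "(w, w') \<in> G_orbit_rel n k"
proof -
  interpret normal_form X Y Z A B S n by (rule nf)
  have w'_mu: "set w' \<subseteq> mu n" using w' by (simp add: W_def)
  interpret e: normal_form e1 e2 e3 "insert 0 (mu n)" "insert 0 (mu n)" "set w'" n
    by (rule standard_normal_form[OF n w'_mu])
  have kS: "card S = k" "card (set w') = k'"
    using w w' by (auto simp: W_def distinct_card)
  obtain \<gamma> where \<gamma>: "normal_form_family X Y Z A B S n \<gamma>"
    and inj: "inj_on (\<lambda>x. form_kernel (\<gamma> x 1)) (index_set A B S)"
    and C: "tuple_arrangement n w' = (\<lambda>x. form_kernel (\<gamma> x 1)) ` index_set A B S"
    using isotopic_family[OF iso] by blast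
  note C' = C[unfolded tuple_arrangement_eq[OF n]]
  show kk: "k' = k"
    using e.card_arr card_arr card_image[OF inj] card_image[OF frm_inj] kS unfolding C'
        arr_eq_image by simp
  have w'k: "w' \<in> W n k" using w' kk by simp
  have "\<exists>a\<in>mu n. \<exists>e\<in>{1, -1}. set w' = (\<lambda>s. a * s powi e) ` S"
  \<comment> \<open>For \<open>k = n\<close> there are further points of maximal multiplicity, which
    an isotopy might permute with \<open>p\<close> and \<open>q\<close>, but the slopes are then all
    of \<open>mu n\<close>; for \<open>k = 0\<close> there are none. Otherwise
    \<open>0 < k < n\<close>, whence \<open>n\<close> is at least 2, as \<open>slopes_end\<close>
    requires.\<close>
  proof (cases "k = n \<or> k = 0")
    case True
    then have "set w' = S"
    proof
      assume "k = n"
      then have "S = mu n" "set w' = mu n"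
        using card_subset_eq[OF finite_mu[OF n] S] card_subset_eq[OF finite_mu[OF n] w'_mu] kS kk
            card_mu[OF n]
        by simp_all
      then show ?thesis by simp
    qed (use kS kk fin in auto)
    then show ?thesis using mu_closed(4)[of n] by (intro bexI[of _ 1]) auto
  next
    case False
    then have "k < n" using card_slopes_le kS by simp
    moreover have "S \<noteq> {}" using False kS by auto
    then obtain s where s: "s \<in> S" by blast
    have s0: "s \<noteq> 0" "s \<in> mu n" using s zero S by auto
    obtain c where c: "c \<noteq> 0" "set w' = (*) c ` S \<or> inverse ` set w' = (*) c ` S"
      using normal_form_family.slopes_end[OF \<gamma> e.normal_form_axioms C' inj] calculation False kS
      by force
    from c(2) show ?thesis
    proof
      assume sw: "set w' = (*) c ` S"
      \<comment> \<open>The factor is a root of unity because it carries one root of unity to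
        another.\<close>
      then have "c * s \<in> mu n" using s w'_mu by blast
      then have "c \<in> mu n" using mu_closed(3)[of "c * s" n s] s0 by simp
      then show ?thesis using sw by (intro bexI[of _ c] bexI[of _ 1]) auto
    next
      assume sw: "inverse ` set w' = (*) c ` S"
      then obtain x where "x \<in> set w'" "inverse x = c * s" using s by (metis imageE imageI)
      then have "c * s \<in> mu n" using w'_mu mu_closed(2) by (metis subsetD)
      then have "c \<in> mu n" using mu_closed(3)[of "c * s" n s] s0 by simp
      then have "inverse c \<in> mu n" by (rule mu_closed)
      moreover have "set w' = inverse ` inverse ` set w'" by (simp add: image_image)
      then have "set w' = (\<lambda>s. inverse c * s powi -1) ` S" unfolding sw by (simp add:
          image_image power_int_minus)
      ultimately show ?thesis by blast
    qed
  qed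
  then show "(w, w') \<in> G_orbit_rel n k" using G_orbit_relI[OF w(1) w'k] w(2) by blast
qed

theorem theorem1p3:
  fixes A :: "(complex^3) set set" and m M :: nat
  assumes "m \<ge> 3"
    and "line_arrangement A"
    and "homogeneous_supersolvable m A"
    and "M = card (modular_points A)"
    and "M \<ge> 2"
  shows "\<exists>k c. k \<le> m - 2 \<and> c \<in> W_bar (m - 2) k \<and>
           (\<forall>w\<in>c. lattice_isotopic A (tuple_arrangement (m - 2) w)) \<and>
           (\<forall>k' c'. k' \<le> m - 2 \<and> c' \<in> W_bar (m - 2) k' \<and>
              (\<exists>w\<in>c'. lattice_isotopic A (tuple_arrangement (m - 2) w))
                  \<longrightarrow> k' = k \<and> c' = c) \<and>
           (\<forall>w\<in>c. lattice_isomorphic A (tuple_arrangement (m - 2) w)) \<and>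
           (k < m - 2 \<longrightarrow> M = 2) \<and>
           (k = m - 2 \<and> m - 2 \<ge> 2 \<longrightarrow> M = 3) \<and>
           (k = m - 2 \<and> m - 2 = 1 \<longrightarrow> M = 4) \<and>
           (k = m - 2 \<longrightarrow> projectively_equivalent A (full_monomial (m - 2)))"
proof -
  define n where "n = m - 2"
  have n: "n \<ge> 1" and m: "m = n + 2" using assms(1) by (auto simp: n_def)
  have hom: "multiplicity_at A p = n + 2" if "p \<in> modular_points A" for p
    using assms(3) that m by (simp add: homogeneous_supersolvable_def)
  obtain p q where pq: "p \<in> modular_points A" "q \<in> modular_points A" "p \<noteq> q"
  proof -
    have "\<not> card (modular_points A) \<le> 1" using assms(4,5) by simp
    \<comment> \<open>An infinite set would have cardinality 0, against
      \<open>M \<ge> 2\<close>.\<close>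
    moreover have "finite (modular_points A)" using assms(4,5) card.infinite by fastforce
    ultimately show ?thesis using that card_le_Suc0_iff_eq by (metis One_nat_def)
  qed
  obtain X Y Z P Q S where nf: "normal_form X Y Z P Q S n" and A: "A = arr X Y Z P Q S"
    and p: "p = vec.span {cross X Y}" and q: "q = vec.span {cross X Z}"
    using normal_form_exists[OF assms(2) n pq hom[OF pq(1)] hom[OF pq(2)]] by blast
  define k where "k = card S"
  have k: "k \<le> n" unfolding k_def by (rule normal_form.card_slopes_le[OF nf])
  \<comment> \<open>The count uses the normal form whose vertices are known to be \<open>p\<close>
    and \<open>q\<close>; normalising the slopes afterwards keeps their number.\<close>
  note count = normal_form.card_modular_points[OF nf hom[unfolded A] pq(1)[unfolded A p]
      pq(2)[unfolded A q],
      folded A k_def assms(4)]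
  obtain Y' Z' P' Q' S' where nf': "normal_form X Y' Z' P' Q' S' n"
    and A': "A = arr X Y' Z' P' Q' S'" and S': "S' \<subseteq> mu n" "card S' = k"
    using normal_form.normalize[OF nf] A k_def by metis
  \<comment> \<open>Any ordering of the slopes will do, as all orderings lie in one class.\<close>
  obtain w where w: "set w = S'" "distinct w"
    using finite_distinct_list normal_form.fin(3)[OF nf'] by blast
  then have wW: "w \<in> W n k" using S' distinct_card[of w] by (auto simp: W_def)
  define c where "c = G_orbit_rel n k `` {w}"
  note eq = equiv_G_orbit_rel[OF n]
  have cW: "c \<in> W_bar n k" unfolding W_bar_def c_def by (rule quotientI[OF wW])
  have iso: "lattice_isotopic A (tuple_arrangement n w')" if w': "w' \<in> c" for w'
  proof -
    obtain \<sigma> a e where g: "\<sigma> permutes {..<k}" "a \<in> mu n" "e \<in> {1, -1}" "w' =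
        G_act \<sigma> a e w" "w' \<in> W n k"
      using w' unfolding c_def G_orbit_rel_def by blast
    have "length w = k" using wW by (simp add: W_def)
    then have "set w' = (\<lambda>s. a * s powi e) ` S'" using set_G_act[of \<sigma> w a e] g w by simp
    moreover have "a \<noteq> 0" using g(2) zero_notin_mu[OF n] by auto
    moreover have "set w' \<subseteq> mu n" using g(5) by (simp add: W_def)
    ultimately show ?thesis
      unfolding A' using normal_form.isotopic_tuple_arrangement[OF nf'] g(3) by blast
  qed
  \<comment> \<open>An isotopy to any representative of \<open>c'\<close> puts that tuple into the
    orbit of \<open>w\<close>, and classes with related elements coincide.\<close>
  have uniq: "k' = k \<and> c' = c"
    if c': "c' \<in> W_bar n k'" and w': "w' \<in> c'" "lattice_isotopic A (tuple_arrangement n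
        w')" for k' c' w'
  proof -
    have "c' \<subseteq> W n k'" using c' in_quotient_imp_subset[OF eq] unfolding W_bar_def by blast
    then have w'W: "w' \<in> W n k'" using w'(1) by blast
    note o = orbit_of_isotopic[OF n nf' S'(1) wW w(1) w'W w'(2)[unfolded A']]
    have "c' = c"
      using quotient_eqI[OF eq c'[unfolded W_bar_def o(1)] cW[unfolded W_bar_def] w'(1)]
        equiv_class_self[OF eq wW] o equivE[OF eq] unfolding c_def by (metis symD)
    then show ?thesis using o(1) by simp
  qed
  have proj: "projectively_equivalent A (full_monomial n)" if "k = n"
  proof -
    have "S' = mu n" using S' that finite_mu[OF n] card_mu[OF n] by (intro card_subset_eq) auto
    then show ?thesis
      unfolding A' using normal_form.projectively_equivalent_full_monomial[OF nf'] by blast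
  qed
  show ?thesis
    unfolding n_def[symmetric]
  proof (intro exI conjI)
    show "\<forall>k' c'. k' \<le> n \<and> c' \<in> W_bar n k' \<and> (\<exists>w\<in>c'.
        lattice_isotopic A (tuple_arrangement n w)) \<longrightarrow>
        k' = k \<and> c' = c"
      using uniq by blast
    show "\<forall>w\<in>c. lattice_isomorphic A (tuple_arrangement n w)"
      using iso lattice_isotopic_imp_isomorphic by blast
  qed (use k cW iso count proj in auto)
qed

end
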